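(* As $x\to\infty$, $$\sum_{n\le x}\mu(n)\omega(n)^2\left\{\frac{x}{n}\right\}\ll\frac{x(\log\log x)^{3/2}}{\log x}.$$
   Context: $\mu$ is the Möbius function, $\omega(n)$ the number of distinct prime factors of $n$, and $\{w\}=w-\lfloor w\rfloor$ is the fractional part of the real number $w$. $f\ll g$ means $|f|\le Kg$ for some constant $K$ and all sufficiently large $x$. *)

theory Defs
  imports
    "HOL-Analysis.Analysis"
    "HOL-Library.Landau_Symbols"
    "HOL-Computational_Algebra.Computational_Algebra"
begin

definition prime_omega :: "nat \<Rightarrow> nat" where
  "prime_omega n = card (prime_factors n)"

(* The value at 0 is irrelevant: it is 0, since 0 is not squarefree. *)
definition moebius_mu :: "nat \<Rightarrow> int" where
  "moebius_mu n = (if squarefree n then (-1) ^ prime_omega n else 0)"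

end

(* Since mu * omega^2 is the Dirichlet convolution of mu with
   g(n) = 2 [omega(n) = 2] - [omega(n) = 1], writing {x/n} = x/n - floor(x/n) turns the sum into
     x * sum_{d <= x} g(d)/d * m(x/d) - sum_{n <= x} g(n),   m(y) = sum_{n <= y} mu(n)/n.
   Chebyshev-type bounds control g, and the first sum is cut into dyadic blocks of d; it is small
   as soon as |m(y)| << (log y)^(-a) with some a > 1 (here a = 8/7).

   For this, m(e^u) has the Laplace transform 1/Z(s) with Z(s) = s zeta(1+s). By the 3-4-1
   inequality, 1/Z and its first two derivatives are O((1+|t|)^(-3/4)) uniformly on the lines
   Re s = delta, delta -> 0+. Integrating by parts twice in the Fourier integral of 1/Z against a
   Gaussian shows that the average of m(e^u) over a window of width h around v is
   O(h^(-3/4) v^(-2)); m(e^u) changes by O(h) over such a window, and h = v^(-8/7) balances the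
   two errors. No continuation of zeta beyond a neighbourhood of Re s = 1 and no contour shift is
   needed. *)
theory Submission
  imports Defs "HOL-Complex_Analysis.Complex_Analysis" "HOL-Probability.Probability"
begin

section \<open>The function $s\zeta(1+s)$ near the line $\mathrm{Re}\, s = 0$\<close>

text \<open>Multiplying zeta(1+s) by s removes the pole and supplies decay, so that a loss of
  |t|^\<theta> with a fixed small \<theta> is affordable. Put P = 1 + |t|. From |Z|, |Z'|, |Z''| <<
  P^(1+\<theta>) the 3-4-1 inequality yields |Z| >> P^(1-4\<theta>), and the worst term Z'^2/Z^3 of
  (1/Z)'' is O(P^(-1+14\<theta>)). Any exponent -\<alpha> with 1/2 < \<alpha> < 1 would serve: part
  of the Gaussian is spent on the integrable weight P^(-2\<alpha>) at the price h^(-\<alpha>), and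
  h^(-\<alpha>) v^(-2) = h gives h = v^(-2/(1+\<alpha>)) with an exponent above 1. The choice
  \<alpha> = 3/4 fixes \<theta> = 1/56, 57/56 = 1+\<theta>, 13/14 = 1-4\<theta> and 8/7 =
  2/(1+\<alpha>). A single integration by parts would only reach 1/(1+\<alpha>) < 1. With exponent 1
  in the bound for m(y), the sum over dyadic blocks would acquire a further factor log log x and
  overshoot the power 3/2. All estimates live on lines Re s = \<delta> > 0, where the series for
  1/zeta(1+s) converges absolutely; only the smoothed average passes to \<delta> = 0.\<close>

lemma vector_derivative_norm_bound:
  fixes f :: "real \<Rightarrow> complex"
  assumes "a \<le> b" and "\<And>x. x \<in> {a..b} \<Longrightarrow> (f has_vector_derivative f' x) (at x within {a..b})"
    and "\<And>x. x \<in> {a..b} \<Longrightarrow> norm (f' x) \<le> B"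
  shows "norm (f b - f a) \<le> B * (b - a)"
proof -
  have "norm (f b - f a) \<le> B * norm (b - a)"
  proof (rule differentiable_bound[where S = "{a..b}" and f' = "\<lambda>x h. h *\<^sub>R f' x"])
    show "(f has_derivative (\<lambda>h. h *\<^sub>R f' x)) (at x within {a..b})" if "x \<in> {a..b}" for x
      using assms(2)[OF that] by (simp add: has_vector_derivative_def)
    show "onorm (\<lambda>h. h *\<^sub>R f' x) \<le> B" if "x \<in> {a..b}" for x
    proof -
      have "0 \<le> B" using assms(3)[OF that] norm_ge_zero order_trans by blast
      then show ?thesis
        using assms(3)[OF that] by (intro onorm_bound) (simp_all add: mult.commute[of B] mult_left_mono)
    qed
  qed (use assms(1) in auto)
  then show ?thesis using assms(1) by simp
qed

lemma has_vector_derivative_of_real_powr: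
  fixes z :: complex
  assumes "x > 0"
  shows "((\<lambda>u. of_real u powr z) has_vector_derivative z * of_real x powr (z - 1)) (at x within S)"
proof -
  have "((\<lambda>w::complex. w powr z) has_field_derivative z * of_real x powr (z - 1)) (at (of_real x))"
    using assms by (intro has_field_derivative_powr) (auto simp: complex_nonpos_Reals_iff)
  then show ?thesis
    by (rule has_vector_derivative_real_field)
qed

text \<open>With N = n + 1 this is the integral over [N, N+1] of s (N^(-1-s) - u^(-1-s)) du: the
  difference between a summand of s zeta(1+s) and the integral that approximates it.\<close>

definition szeta_term :: "nat \<Rightarrow> complex \<Rightarrow> complex" where
  "szeta_term n s = s * of_nat (Suc n) powr (- 1 - s) - of_nat (Suc n) powr (- s) + of_nat (Suc (Suc n)) powr (- s)"

text \<open>Telescoping shows that this is $s\zeta(1+s)$ for $\mathrm{Re}\, s > 0$; the series converges for $\mathrm{Re}\, s > -1$ and removes the pole.\<close>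

definition szeta :: "complex \<Rightarrow> complex" where
  "szeta s = 1 + (\<Sum>n. szeta_term n s)"

text \<open>The difference N^(-1-s) - u^(-1-s) has the trivial bound 2 N^(-1-\<sigma>) and the mean
  value bound |1+s| N^(-2-\<sigma>). Interpolating with exponent \<theta> costs |1+s|^\<theta> and
  gains N^(-\<theta>); half of the gain pays for Re s down to -\<theta>/2, the other half makes the
  sum over n converge.\<close>

lemma szeta_term_bound:
  assumes th: "0 \<le> \<theta>" "\<theta> \<le> 1" and s: "- \<theta> / 2 \<le> Re s"
  shows "norm (szeta_term n s) \<le> 2 * norm s * norm (1 + s) powr \<theta> * real (Suc n) powr (- 1 - \<theta> / 2)"
proof -
  define N where "N = real (Suc n)"
  have N: "N \<ge> 1" by (simp add: N_def)
  define \<sigma> where "\<sigma> = Re s"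
  have sig: "- 1 / 2 \<le> \<sigma>" using th s by (simp add: \<sigma>_def)
  \<comment> \<open>The increment of \<open>q\<close> over [N, N+1] is exactly
    \<open>szeta_term n s\<close>, so a bound for its derivative \<open>q'\<close> suffices.\<close>
  define q where "q = (\<lambda>u. s * of_real N powr (- 1 - s) * of_real u + of_real u powr (- s))"
  define q' where "q' = (\<lambda>u. s * (of_real N powr (- 1 - s) - of_real u powr (- 1 - s)))"
  have der: "(q has_vector_derivative q' u) (at u within {N..N+1})" if "u \<in> {N..N+1}" for u
  proof -
    have "u > 0" using that N by simp
    have 1: "((\<lambda>u. s * of_real N powr (- 1 - s) * complex_of_real u) has_vector_derivative s * of_real N powr (- 1 - s)) (at u within {N..N+1})"
      by (auto intro!: derivative_eq_intros)
    have "(q has_vector_derivative s * of_real N powr (- 1 - s) + (- s) * of_real u powr (- s - 1)) (at u within {N..N+1})"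
      unfolding q_def
      by (intro has_vector_derivative_add 1 has_vector_derivative_of_real_powr \<open>u > 0\<close>)
    moreover have "- s - 1 = - 1 - s" by simp
    ultimately show ?thesis
      by (simp add: q'_def algebra_simps)
  qed
  have d1: "norm (complex_of_real N powr (- 1 - s) - of_real u powr (- 1 - s)) \<le> 2 * N powr (- 1 - \<sigma>)"
    if "u \<in> {N..N+1}" for u
  proof -
    have "norm (complex_of_real N powr (- 1 - s) - of_real u powr (- 1 - s)) \<le> N powr (- 1 - \<sigma>) + u powr (- 1 - \<sigma>)"
      using that N by (intro order_trans[OF norm_triangle_ineq4]) (simp add: norm_powr_real_powr \<sigma>_def)
    also have "u powr (- 1 - \<sigma>) \<le> N powr (- 1 - \<sigma>)"
      using that N sig by (intro powr_mono2') auto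
    finally show ?thesis by simp
  qed
  have d2: "norm (complex_of_real N powr (- 1 - s) - of_real u powr (- 1 - s)) \<le> norm (1 + s) * N powr (- 2 - \<sigma>)"
    if u: "u \<in> {N..N+1}" for u
  proof -
    have "norm (complex_of_real u powr (- 1 - s) - of_real N powr (- 1 - s)) \<le> (norm (1 + s) * N powr (- 2 - \<sigma>)) * (u - N)"
    proof (rule vector_derivative_norm_bound)
      show "N \<le> u" using u by simp
      fix x assume x: "x \<in> {N..u}"
      then have "x > 0" using N by simp
      then show "((\<lambda>u. complex_of_real u powr (- 1 - s)) has_vector_derivative (- 1 - s) * of_real x powr (- 1 - s - 1)) (at x within {N..u})"
        by (rule has_vector_derivative_of_real_powr)
      have "norm ((- 1 - s) * of_real x powr (- 1 - s - 1)) = norm (1 + s) * x powr (- 2 - \<sigma>)"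
        using \<open>x > 0\<close> norm_minus_cancel[of "1 + s"] by (simp add: norm_mult norm_powr_real_powr \<sigma>_def)
      also have "\<dots> \<le> norm (1 + s) * N powr (- 2 - \<sigma>)"
        using x N sig by (intro mult_left_mono powr_mono2') auto
      finally show "norm ((- 1 - s) * of_real x powr (- 1 - s - 1)) \<le> norm (1 + s) * N powr (- 2 - \<sigma>)" .
    qed
    also have "\<dots> \<le> (norm (1 + s) * N powr (- 2 - \<sigma>)) * 1"
      using u by (intro mult_left_mono) auto
    finally show ?thesis by (simp add: norm_minus_commute)
  qed
  \<comment> \<open>\<open>y\<close> compares the two bounds. For y <= 1 the mean value bound is
    used, with y <= y^\<theta>; for y > 1 the trivial one, with 1 <= y^\<theta>.\<close>
  define y where "y = norm (1 + s) / N"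
  have y0: "y \<ge> 0" using N by (simp add: y_def)
  have sp: "norm (1 + s) > 0"
  proof -
    have "Re (1 + s) > 0" using sig by (simp add: \<sigma>_def)
    then have "1 + s \<noteq> 0" by (metis less_irrefl zero_complex.sel(1))
    then show ?thesis by simp
  qed
  have yp: "y > 0" using sp N by (simp add: y_def)
  have d3: "norm (complex_of_real N powr (- 1 - s) - of_real u powr (- 1 - s)) \<le> 2 * N powr (- 1 - \<sigma>) * y powr \<theta>"
    if u: "u \<in> {N..N+1}" for u
  proof (cases "y \<le> 1")
    case True
    have e: "norm (1 + s) * N powr (- 2 - \<sigma>) = N powr (- 1 - \<sigma>) * y"
    proof -
      have "N powr (- 1 - \<sigma>) = N powr (- 2 - \<sigma>) * N"
        using N by (simp add: powr_mult_base mult.commute)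
      then show ?thesis using N by (simp add: y_def)
    qed
    have "y \<le> y powr \<theta>"
      using powr_mono'[of \<theta> 1 y] th True y0 yp by simp
    then have "norm (1 + s) * N powr (- 2 - \<sigma>) \<le> N powr (- 1 - \<sigma>) * y powr \<theta>"
      unfolding e by (intro mult_left_mono) auto
    moreover have "0 \<le> N powr (- 1 - \<sigma>) * y powr \<theta>" by simp
    ultimately show ?thesis using d2[OF u] by linarith
  next
    case False
    then have "1 \<le> y powr \<theta>" using th by (intro ge_one_powr_ge_zero) auto
    then have "2 * N powr (- 1 - \<sigma>) * 1 \<le> 2 * N powr (- 1 - \<sigma>) * y powr \<theta>"
      by (intro mult_left_mono) auto
    then show ?thesis using d1[OF u] by simp
  qed
  have "norm (q (N + 1) - q N) \<le> (norm s * (2 * N powr (- 1 - \<sigma>) * y powr \<theta>)) * (N + 1 - N)"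
  proof (rule vector_derivative_norm_bound[OF _ der])
    show "norm (q' x) \<le> norm s * (2 * N powr (- 1 - \<sigma>) * y powr \<theta>)" if "x \<in> {N..N+1}" for x
      unfolding q'_def norm_mult by (intro mult_left_mono d3 that) auto
  qed auto
  moreover have "q (N + 1) - q N = szeta_term n s"
    by (simp add: q_def szeta_term_def N_def algebra_simps)
  moreover have "N powr (- 1 - \<sigma>) * y powr \<theta> \<le> norm (1 + s) powr \<theta> * N powr (- 1 - \<theta> / 2)"
  proof -
    have "N powr (- 1 - \<sigma>) * y powr \<theta> = norm (1 + s) powr \<theta> * (N powr (- 1 - \<sigma>) * N powr (- \<theta>))"
      using N by (simp add: y_def powr_divide powr_minus field_simps)
    also have "\<dots> = norm (1 + s) powr \<theta> * N powr (- 1 - \<sigma> - \<theta>)"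
      by (simp flip: powr_add)
    also have "\<dots> \<le> norm (1 + s) powr \<theta> * N powr (- 1 - \<theta> / 2)"
      using N s by (intro mult_left_mono powr_mono) (auto simp: \<sigma>_def)
    finally show ?thesis .
  qed
  then have "norm s * (2 * N powr (- 1 - \<sigma>) * y powr \<theta>) \<le> norm s * (2 * (norm (1 + s) powr \<theta> * N powr (- 1 - \<theta> / 2)))"
    by (intro mult_left_mono) auto
  ultimately show ?thesis by (simp add: N_def algebra_simps)
qed

lemma summable_Suc_powr: "a < - 1 \<Longrightarrow> summable (\<lambda>n. real (Suc n) powr a)"
  using summable_real_powr_iff[of a] summable_Suc_iff[of "\<lambda>n. real n powr a"] by simp

text \<open>Growth with exponent 1 + \<theta> for arbitrarily small \<theta> > 0, on a half-plane
  that reaches beyond Re s = 0, so that discs around points of that line fit inside it for Cauchy's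
  inequality.\<close>

lemma szeta_bound:
  assumes th: "0 < \<theta>" "\<theta> \<le> 1"
  obtains C where "C > 0" "\<And>s. - \<theta> / 2 \<le> Re s \<Longrightarrow> norm (szeta s) \<le> 1 + C * norm s * norm (1 + s) powr \<theta>"
proof -
  define C where "C = 2 * (\<Sum>n. real (Suc n) powr (- 1 - \<theta> / 2))"
  have sm: "summable (\<lambda>n. real (Suc n) powr (- 1 - \<theta> / 2))"
    using th by (intro summable_Suc_powr) auto
  show ?thesis
  proof
    show "C > 0" unfolding C_def using sm by (intro mult_pos_pos suminf_pos) auto
    fix s assume s: "- \<theta> / 2 \<le> Re s"
    have b: "norm (szeta_term n s) \<le> (2 * norm s * norm (1 + s) powr \<theta>) * real (Suc n) powr (- 1 - \<theta> / 2)" for n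
      using szeta_term_bound[of \<theta> s n] th s by simp
    have sm2: "summable (\<lambda>n. (2 * norm s * norm (1 + s) powr \<theta>) * real (Suc n) powr (- 1 - \<theta> / 2))"
      by (intro summable_mult sm)
    have "norm (\<Sum>n. szeta_term n s) \<le> (\<Sum>n. (2 * norm s * norm (1 + s) powr \<theta>) * real (Suc n) powr (- 1 - \<theta> / 2))"
      using b sm2 by (rule norm_suminf_le)
    also have "\<dots> = C * norm s * norm (1 + s) powr \<theta>"
      by (subst suminf_mult[OF sm]) (simp add: C_def algebra_simps)
    finally show "norm (szeta s) \<le> 1 + C * norm s * norm (1 + s) powr \<theta>"
      unfolding szeta_def by (intro order_trans[OF norm_triangle_ineq]) simp
  qed
qed

lemma szeta_holomorphic: "szeta holomorphic_on {s. - 1 / 2 < Re s}"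
proof -
  let ?S = "{s. - 1 / 2 < Re s}"
  have op: "open ?S" by (rule open_halfspace_Re_gt)
  have hol: "szeta_term n holomorphic_on ?S" for n
    unfolding szeta_term_def by (intro holomorphic_intros)
  have "(\<lambda>s. \<Sum>n. szeta_term n s) holomorphic_on ?S"
  proof (rule holomorphic_uniform_sequence[OF op])
    show "(\<lambda>s. \<Sum>n<N. szeta_term n s) holomorphic_on ?S" for N
      by (intro holomorphic_intros hol)
    fix x assume x: "x \<in> ?S"
    then obtain d where d: "d > 0" "cball x d \<subseteq> ?S"
      using op by (meson open_contains_cball)
    define R where "R = norm x + d"
    have "uniform_limit (cball x d) (\<lambda>N s. \<Sum>n<N. szeta_term n s) (\<lambda>s. \<Sum>n. szeta_term n s) sequentially"
    proof (rule Weierstrass_m_test)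
      \<comment> \<open>This is the case \<theta> = 1 of the term bound: it covers Re s >= -1/2 and
        decays like n^(-3/2).\<close>
      show "summable (\<lambda>n. (2 * R * (1 + R) powr 1) * real (Suc n) powr (- 1 - 1 / 2))"
        by (intro summable_mult summable_Suc_powr) auto
      fix n s assume s: "s \<in> cball x d"
      then have s2: "- 1 / 2 \<le> Re s" using d(2) by fastforce
      have R: "norm s \<le> R"
      proof -
        have "norm s \<le> norm x + norm (s - x)" by (metis norm_triangle_sub)
        then show ?thesis using s by (simp add: R_def dist_norm norm_minus_commute)
      qed
      have R1: "norm (1 + s) \<le> 1 + R" using R norm_triangle_ineq[of 1 s] by simp
      have "norm (szeta_term n s) \<le> 2 * norm s * norm (1 + s) powr 1 * real (Suc n) powr (- 1 - 1 / 2)"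
        using szeta_term_bound[of 1 s n] s2 by simp
      also have "\<dots> \<le> (2 * R * (1 + R) powr 1) * real (Suc n) powr (- 1 - 1 / 2)"
        by (intro mult_right_mono mult_mono powr_mono2 R R1) (use order_trans[OF norm_ge_zero R] in auto)
      finally show "norm (szeta_term n s) \<le> (2 * R * (1 + R) powr 1) * real (Suc n) powr (- 1 - 1 / 2)" .
    qed
    then show "\<exists>d>0. cball x d \<subseteq> ?S \<and> uniform_limit (cball x d) (\<lambda>N s. \<Sum>n<N. szeta_term n s) (\<lambda>s. \<Sum>n. szeta_term n s) sequentially"
      using d by blast
  qed
  then show ?thesis unfolding szeta_def by (intro holomorphic_intros)
qed

lemma szeta_0: "szeta 0 = 1"
proof -
  have "szeta_term n 0 = 0" for n
    by (simp add: szeta_term_def del: of_nat_Suc)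
  then show ?thesis by (simp add: szeta_def)
qed

section \<open>The inequality $\zeta(\sigma)^3|\zeta(\sigma+it)|^4|\zeta(\sigma+2it)| \ge 1$\<close>

lemma norm_of_nat_powr: "norm (of_nat n powr (- s) :: complex) = real n powr (- Re s)"
  using norm_powr_real_powr[of "real n" "- s"] by simp

lemma of_nat_powr_mult: "(of_nat (a * b) :: complex) powr s = of_nat a powr s * of_nat b powr s"
  using powr_times_real[of "of_nat a" "of_nat b" s] by simp

lemma dirichlet_abs_summable: "Re s > 1 \<Longrightarrow> (\<lambda>n. norm (of_nat n powr (- s) :: complex)) summable_on A"
proof -
  assume s: "Re s > 1"
  have "summable (\<lambda>n. real n powr (- Re s))"
    using s by (simp add: summable_real_powr_iff)
  then have "(\<lambda>n. norm (of_nat n powr (- s) :: complex)) summable_on UNIV"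
    by (intro norm_summable_imp_summable_on) (simp add: norm_of_nat_powr)
  then show ?thesis
    using summable_on_subset_banach by blast
qed

lemma dirichlet_summable: "Re s > 1 \<Longrightarrow> (\<lambda>n. of_nat n powr (- s) :: complex) summable_on A"
  by (rule abs_summable_summable[OF dirichlet_abs_summable])

text \<open>The index runs over all naturals; \<open>0 powr z = 0\<close> makes the term at 0
  vanish.\<close>

definition zeta_sum :: "complex \<Rightarrow> complex" where
  "zeta_sum s = (\<Sum>\<^sub>\<infinity>n. of_nat n powr (- s))"

lemma szeta_eq_zeta_sum:
  assumes "Re s > 0"
  shows "szeta s = s * zeta_sum (1 + s)"
proof -
  have "(\<lambda>n. of_nat n powr (- (1 + s))) sums zeta_sum (1 + s)"
    unfolding zeta_sum_def using assms by (intro has_sum_imp_sums has_sum_infsum dirichlet_summable) simp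
  then have "(\<lambda>n. of_nat (Suc n) powr (- (1 + s))) sums zeta_sum (1 + s)"
    by (subst sums_Suc_iff) simp
  then have 1: "(\<lambda>n. s * of_nat (Suc n) powr (- (1 + s))) sums (s * zeta_sum (1 + s))"
    by (rule sums_mult)
  have "(\<lambda>n. real n powr (- Re s)) \<longlonglongrightarrow> 0"
    using assms by (intro tendsto_neg_powr filterlim_real_sequentially) auto
  then have "(\<lambda>n. of_nat n powr (- s) :: complex) \<longlonglongrightarrow> 0"
    by (subst tendsto_norm_zero_iff[symmetric]) (simp add: norm_of_nat_powr)
  then have "(\<lambda>n. of_nat (Suc n) powr (- s) :: complex) \<longlonglongrightarrow> 0"
    by (rule LIMSEQ_Suc)
  then have "(\<lambda>n. of_nat (Suc (Suc n)) powr (- s) - of_nat (Suc n) powr (- s)) sums (0 - (of_nat (Suc 0) powr (- s) :: complex))"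
    by (rule telescope_sums)
  from sums_add[OF 1 this] have "(\<lambda>n. szeta_term n s) sums (s * zeta_sum (1 + s) - 1)"
    by (simp add: szeta_term_def algebra_simps)
  then show ?thesis unfolding szeta_def by (simp add: sums_iff)
qed

section \<open>Integers without small prime factors\<close>

definition rough :: "nat \<Rightarrow> nat set" where
  "rough N = {n. n > 0 \<and> (\<forall>p. prime p \<longrightarrow> p dvd n \<longrightarrow> p > N)}"

lemma rough_0: "rough 0 = {0<..}"
  by (auto simp: rough_def prime_gt_0_nat)

lemma rough_Suc_not_prime: "\<not> prime (Suc N) \<Longrightarrow> rough (Suc N) = rough N"
proof -
  assume np: "\<not> prime (Suc N)"
  have "Suc N < p \<longleftrightarrow> N < p" if "prime p" for p
    using that np by (metis Suc_lessD Suc_lessI)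
  then show ?thesis unfolding rough_def by blast
qed

text \<open>With p = Suc N, an integer all of whose prime factors are at least p either avoids p or
  is p times another such integer.\<close>

lemma rough_Suc_prime:
  assumes p: "prime (Suc N)"
  shows "rough N = rough (Suc N) \<union> (*) (Suc N) ` rough N"
    and "rough (Suc N) \<inter> (*) (Suc N) ` rough N = {}"
proof -
  show "rough (Suc N) \<inter> (*) (Suc N) ` rough N = {}"
  proof -
    have "Suc N * m \<notin> rough (Suc N)" for m
      using p dvd_triv_left[of "Suc N" m] unfolding rough_def by blast
    then show ?thesis by blast
  qed
  show "rough N = rough (Suc N) \<union> (*) (Suc N) ` rough N"
  proof (intro set_eqI iffI)
    fix n assume n: "n \<in> rough N"
    show "n \<in> rough (Suc N) \<union> (*) (Suc N) ` rough N"
    proof (cases "Suc N dvd n")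
      case True
      then obtain m where m: "n = Suc N * m" by blast
      have "m \<in> rough N" using n unfolding rough_def m by (auto simp del: mult_Suc)
      then show ?thesis using m by blast
    next
      case False
      then have "n \<in> rough (Suc N)"
        using n Suc_lessI unfolding rough_def by blast
      then show ?thesis by blast
    qed
  next
    fix n assume "n \<in> rough (Suc N) \<union> (*) (Suc N) ` rough N"
    then show "n \<in> rough N"
    proof
      assume "n \<in> rough (Suc N)"
      then show ?thesis unfolding rough_def by (auto dest: Suc_lessD)
    next
      assume "n \<in> (*) (Suc N) ` rough N"
      then obtain m where m: "n = Suc N * m" "m \<in> rough N" by blast
      have "q > N" if "prime q" "q dvd n" for q
      proof -
        from that have "q dvd Suc N \<or> q dvd m" unfolding m by (simp only: prime_dvd_mult_iff)
        then show ?thesis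
        proof
          assume "q dvd Suc N"
          then have "q = Suc N" using p \<open>prime q\<close> by (metis primes_dvd_imp_eq)
          then show ?thesis by simp
        qed (use m that in \<open>auto simp: rough_def\<close>)
      qed
      moreover have "n > 0" using m by (auto simp: rough_def)
      ultimately show ?thesis by (auto simp: rough_def)
    qed
  qed
qed

text \<open>This is $\zeta(s) \prod_{p \le N} (1 - p^{-s})$, which tends to 1; it replaces the Euler product.\<close>

definition rough_sum :: "nat \<Rightarrow> complex \<Rightarrow> complex" where
  "rough_sum N s = (\<Sum>\<^sub>\<infinity>n\<in>rough N. of_nat n powr (- s))"

lemma rough_sum_0: "rough_sum 0 s = zeta_sum s"
  unfolding rough_sum_def zeta_sum_def rough_0 by (rule infsum_cong_neutral) auto

text \<open>Splitting \<open>rough N\<close> by divisibility by p = Suc N gives S_N = S_(N+1) +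
  p^(-s) S_N, so raising the sieve limit past p multiplies the sum by 1 - p^(-s).\<close>

lemma rough_sum_Suc:
  assumes s: "Re s > 1" and p: "prime (Suc N)"
  shows "rough_sum (Suc N) s = (1 - of_nat (Suc N) powr (- s)) * rough_sum N s"
proof -
  have "rough_sum N s = rough_sum (Suc N) s + (\<Sum>\<^sub>\<infinity>n\<in>(*) (Suc N) ` rough N. of_nat n powr (- s))"
    unfolding rough_sum_def
    by (subst rough_Suc_prime(1)[OF p])
       (intro infsum_Un_disjoint dirichlet_summable s rough_Suc_prime(2)[OF p])
  also have "(\<Sum>\<^sub>\<infinity>n\<in>(*) (Suc N) ` rough N. of_nat n powr (- s)) = (\<Sum>\<^sub>\<infinity>n\<in>rough N. (of_nat (Suc N * n) powr (- s) :: complex))"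
    by (subst infsum_reindex) (auto simp: inj_on_def o_def simp del: mult_Suc)
  also have "\<dots> = of_nat (Suc N) powr (- s) * rough_sum N s"
    unfolding of_nat_powr_mult rough_sum_def by (rule infsum_cmult_right')
  finally show ?thesis by (simp add: algebra_simps)
qed

text \<open>Apart from 1, every member of \<open>rough N\<close> exceeds N, so the distance to 1 is
  at most a tail of an absolutely convergent series.\<close>

lemma rough_sum_tendsto:
  assumes s: "Re s > 1"
  shows "(\<lambda>N. rough_sum N s) \<longlonglongrightarrow> 1"
proof -
  let ?f = "\<lambda>n. real n powr (- Re s)"
  have sm: "summable ?f" using s by (simp add: summable_real_powr_iff)
  have sm': "?f summable_on A" for A
    using dirichlet_abs_summable[OF s, of A] by (simp add: norm_of_nat_powr)
  have bd: "norm (rough_sum N s - 1) \<le> suminf ?f - (\<Sum>n\<le>N. ?f n)" for N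
  proof -
    have 1: "1 \<in> rough N" by (auto simp: rough_def)
    have big: "n > N" if "n \<in> rough N - {1}" for n
    proof -
      have "n \<noteq> 1" "n > 0" using that by (auto simp: rough_def)
      then obtain q where "prime q" "q dvd n" using prime_factor_nat by blast
      then have "N < q" "q \<le> n" using that \<open>n > 0\<close> by (auto simp: rough_def dvd_imp_le)
      then show ?thesis by simp
    qed
    have "rough_sum N s = (\<Sum>\<^sub>\<infinity>n\<in>{1} \<union> (rough N - {1}). of_nat n powr (- s))"
      using 1 by (simp add: rough_sum_def insert_absorb)
    also have "\<dots> = 1 + (\<Sum>\<^sub>\<infinity>n\<in>rough N - {1}. of_nat n powr (- s))"
      by (subst infsum_Un_disjoint) (use s in \<open>auto intro: dirichlet_summable\<close>)
    finally have "norm (rough_sum N s - 1) = norm (\<Sum>\<^sub>\<infinity>n\<in>rough N - {1}. of_nat n powr (- s) :: complex)"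
      by simp
    also have "\<dots> \<le> (\<Sum>\<^sub>\<infinity>n\<in>rough N - {1}. norm (of_nat n powr (- s) :: complex))"
      by (rule norm_infsum_bound) (rule dirichlet_abs_summable[OF s])
    also have "\<dots> = (\<Sum>\<^sub>\<infinity>n\<in>rough N - {1}. ?f n)"
      by (simp add: norm_of_nat_powr)
    also have "\<dots> \<le> (\<Sum>\<^sub>\<infinity>n\<in>{N<..}. ?f n)"
      using big by (intro infsum_mono_neutral sm') auto
    also have "\<dots> = (\<Sum>\<^sub>\<infinity>n\<in>{..N} \<union> {N<..}. ?f n) - (\<Sum>n\<le>N. ?f n)"
      by (subst infsum_Un_disjoint) (auto intro: sm')
    also have "{..N} \<union> {N<..} = UNIV" by auto
    also have "infsum ?f UNIV = suminf ?f"
      using has_sum_infsum[OF sm'[of UNIV]] by (simp add: has_sum_imp_sums sums_unique)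
    finally show ?thesis .
  qed
  have "(\<lambda>N. suminf ?f - (\<Sum>n\<le>N. ?f n)) \<longlonglongrightarrow> suminf ?f - suminf ?f"
    by (intro tendsto_diff tendsto_const summable_LIMSEQ' sm)
  then have "(\<lambda>N. suminf ?f - (\<Sum>n\<le>N. ?f n)) \<longlonglongrightarrow> 0" by simp
  then have "(\<lambda>N. rough_sum N s - 1) \<longlonglongrightarrow> 0"
    by (rule Lim_null_comparison[rotated]) (use bd in auto)
  then show ?thesis by (simp add: LIM_zero_iff)
qed

text \<open>Expand -ln |1 - w| as the sum of Re(w^n)/n. With z^n = e^(ia) the n-th coefficients
  combine to r^n (3 + 4 cos a + cos 2a)/n, which is nonnegative.\<close>

lemma three_four_one_factor:
  fixes r :: real and z :: complex
  assumes r: "0 \<le> r" "r < 1" and z: "norm z = 1"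
  shows "norm (1 - of_real r :: complex) ^ 3 * norm (1 - of_real r * z) ^ 4 * norm (1 - of_real r * z\<^sup>2) \<le> 1"
proof -
  \<comment> \<open>The term n = 0 is a division by zero and hence 0, so the series may start
    there.\<close>
  have L: "(\<lambda>n. Re (w ^ n) / n) sums (- ln (norm (1 - w)))" if "norm w < 1" for w :: complex
  proof -
    have "1 - w \<noteq> 0" using that by auto
    have "(\<lambda>n. - (w ^ n) / of_nat n) sums Ln (1 - w)"
      using Ln_series'[of "- w"] that by simp
    from sums_minus[OF sums_Re[OF this]] show ?thesis
      using \<open>1 - w \<noteq> 0\<close> by simp
  qed
  have n1: "norm (of_real r :: complex) < 1" "norm (of_real r * z) < 1" "norm (of_real r * z\<^sup>2) < 1"
    using r z by (auto simp: norm_mult norm_power)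
  let ?a = "\<lambda>n. 3 * (Re (of_real r ^ n) / n) + 4 * (Re ((of_real r * z) ^ n) / n) + Re ((of_real r * z\<^sup>2) ^ n) / n"
  have S: "?a sums (3 * (- ln (norm (1 - of_real r :: complex))) + 4 * (- ln (norm (1 - of_real r * z))) + (- ln (norm (1 - of_real r * z\<^sup>2))))"
    by (intro sums_add sums_mult L n1)
  have nn: "0 \<le> ?a n" for n
  proof -
    define w where "w = z ^ n"
    have "norm w = 1" using z by (simp add: w_def norm_power)
    then have "(Re w)\<^sup>2 + (Im w)\<^sup>2 = 1" by (metis cmod_power2 one_power2)
    \<comment> \<open>This is 3 + 4 cos a + cos 2a = 2 (1 + cos a)^2, with cos a = Re w.\<close>
    then have e0: "3 + 4 * Re w + Re (w\<^sup>2) = 2 * (1 + Re w)\<^sup>2"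
      by (simp add: power2_eq_square algebra_simps)
    have e1: "Re ((of_real r * z\<^sup>2) ^ n) = r ^ n * Re (w\<^sup>2)"
      by (simp add: power_mult_distrib w_def power_mult[symmetric] mult.commute flip: of_real_power)
    have e2: "Re ((of_real r * z) ^ n) = r ^ n * Re w"
      by (simp add: power_mult_distrib w_def flip: of_real_power)
    have e3: "Re (of_real r ^ n :: complex) = r ^ n" by (simp flip: of_real_power)
    have "?a n = r ^ n * (3 + 4 * Re w + Re (w\<^sup>2)) / n"
      unfolding e1 e2 e3 by (simp only: add_divide_distrib distrib_left) (simp add: mult_ac)
    also have "\<dots> = r ^ n * (2 * (1 + Re w)\<^sup>2) / n" by (simp only: e0)
    also have "\<dots> \<ge> 0" using r by simp
    finally show ?thesis .
  qed
  then have "0 \<le> 3 * (- ln (norm (1 - of_real r :: complex))) + 4 * (- ln (norm (1 - of_real r * z))) + (- ln (norm (1 - of_real r * z\<^sup>2)))"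
    by (intro sums_le[OF _ sums_zero S])
  moreover have "norm (1 - w) > 0" if "norm w < 1" for w :: complex using that by auto
  note pos = this[OF n1(1)] this[OF n1(2)] this[OF n1(3)]
  have "ln (norm (1 - of_real r :: complex) ^ 3 * norm (1 - of_real r * z) ^ 4 * norm (1 - of_real r * z\<^sup>2)) =
     3 * ln (norm (1 - of_real r :: complex)) + 4 * ln (norm (1 - of_real r * z)) + ln (norm (1 - of_real r * z\<^sup>2))"
    using pos by (simp add: ln_mult ln_realpow)
  ultimately have "ln (norm (1 - of_real r :: complex) ^ 3 * norm (1 - of_real r * z) ^ 4 * norm (1 - of_real r * z\<^sup>2)) \<le> 0"
    by linarith
  then show ?thesis
    using pos by (subst (asm) ln_le_zero_iff) auto
qed

text \<open>The Euler product is read backwards: sieving by a further prime multiplies the threefold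
  product by a factor at most 1, so \<open>V\<close> decreases. Its limit is 1, hence its value at
  0, the product of the zeta values, is at least 1.\<close>

lemma three_four_one:
  fixes \<sigma> t :: real
  assumes \<sigma>: "\<sigma> > 1"
  shows "1 \<le> norm (zeta_sum (of_real \<sigma>)) ^ 3 * norm (zeta_sum (Complex \<sigma> t)) ^ 4 * norm (zeta_sum (Complex \<sigma> (2 * t)))"
proof -
  define V where "V = (\<lambda>N. norm (rough_sum N (of_real \<sigma>)) ^ 3 * norm (rough_sum N (Complex \<sigma> t)) ^ 4 * norm (rough_sum N (Complex \<sigma> (2 * t))))"
  have Re: "Re (of_real \<sigma>) > 1" "Re (Complex \<sigma> t) > 1" "Re (Complex \<sigma> (2 * t)) > 1" using \<sigma> by auto
  have "V (Suc N) \<le> V N" for N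
  proof (cases "prime (Suc N)")
    case False
    then show ?thesis by (simp add: V_def rough_sum_def rough_Suc_not_prime)
  next
    case True
    define p where "p = real (Suc N)"
    \<comment> \<open>The powers of p at the three points are r, r z and r z^2 with |z| = 1, as
      required by \<open>three_four_one_factor\<close>.\<close>
    define r where "r = p powr (- \<sigma>)"
    define z where "z = (of_real p :: complex) powr (- Complex 0 t)"
    have "p > 1" using prime_gt_1_nat[OF True] by (simp add: p_def)
    then have r: "0 \<le> r" "r < 1" using \<sigma> by (auto simp: r_def intro: powr_less_one)
    have nz: "norm z = 1" using \<open>p > 1\<close> by (simp add: z_def norm_powr_real_powr)
    have e0: "of_nat (Suc N) powr (- of_real \<sigma>) = (of_real r :: complex)"
      using \<open>p > 1\<close> powr_of_real[of p "- \<sigma>"] by (simp add: r_def p_def)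
    have "Complex \<sigma> t = of_real \<sigma> + Complex 0 t" by (simp add: complex_eq_iff)
    then have "of_nat (Suc N) powr (- Complex \<sigma> t) = of_nat (Suc N) powr (- of_real \<sigma>) * (of_nat (Suc N) powr (- Complex 0 t) :: complex)"
      by (simp flip: powr_add)
    then have e1: "of_nat (Suc N) powr (- Complex \<sigma> t) = of_real r * z"
      unfolding e0 by (simp add: z_def p_def)
    have "Complex \<sigma> (2 * t) = of_real \<sigma> + (Complex 0 t + Complex 0 t)" by (simp add: complex_eq_iff)
    then have "of_nat (Suc N) powr (- Complex \<sigma> (2 * t)) = of_nat (Suc N) powr (- of_real \<sigma>) * (of_nat (Suc N) powr (- Complex 0 t) * of_nat (Suc N) powr (- Complex 0 t) :: complex)"
      by (simp flip: powr_add)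
    then have e2: "of_nat (Suc N) powr (- Complex \<sigma> (2 * t)) = of_real r * z\<^sup>2"
      unfolding e0 by (simp add: z_def p_def power2_eq_square)
    have "V (Suc N) = (norm (1 - of_real r :: complex) ^ 3 * norm (1 - of_real r * z) ^ 4 * norm (1 - of_real r * z\<^sup>2)) * V N"
      unfolding V_def rough_sum_Suc[OF Re(1) True] rough_sum_Suc[OF Re(2) True] rough_sum_Suc[OF Re(3) True] e0 e1 e2
      by (simp only: norm_mult power_mult_distrib mult_ac)
    also have "\<dots> \<le> 1 * V N"
      by (intro mult_right_mono three_four_one_factor r nz) (simp add: V_def)
    finally show ?thesis by simp
  qed
  then have "decseq V" by (rule decseq_SucI)
  moreover have "V \<longlonglongrightarrow> norm (1::complex) ^ 3 * norm (1::complex) ^ 4 * norm (1::complex)"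
    unfolding V_def by (intro tendsto_intros rough_sum_tendsto Re)
  ultimately have "1 \<le> V 0" using decseq_ge by fastforce
  then show ?thesis by (simp add: V_def rough_sum_0)
qed

section \<open>Bounds for the reciprocal and its derivatives\<close>

text \<open>Cauchy's inequality on discs of radius 1/112 = \<theta>/2 with \<theta> = 1/56: centred
  in Re s >= 0, they stay in Re s >= -\<theta>/2, where \<open>szeta_bound\<close> holds. The case n
  = 0 is the function itself.\<close>

lemma szeta_deriv_bounds:
  obtains C where "C \<ge> 1"
    "\<And>s n. 0 \<le> Re s \<Longrightarrow> Re s \<le> 1 \<Longrightarrow> n \<le> 2 \<Longrightarrow> norm ((deriv ^^ n) szeta s) \<le> C * (1 + \<bar>Im s\<bar>) powr (57/56)"
proof -
  obtain B where B: "B > 0" "\<And>s. - (1/56) / 2 \<le> Re s \<Longrightarrow> norm (szeta s) \<le> 1 + B * norm s * norm (1 + s) powr (1/56)"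
    using szeta_bound[of "1/56"] by auto
  \<comment> \<open>2 = 2! and 112^2 come from Cauchy's inequality at n = 2; 12 = 3 * 4 comes from
    |w| <= 3P and |1+w|^(1/56) <= 4 P^(1/56).\<close>
  define C where "C = 2 * (1 + 12 * B) * 112 ^ 2"
  show ?thesis
  proof
    show "C \<ge> 1" using B(1) by (simp add: C_def)
    fix s :: complex and n :: nat
    assume s: "0 \<le> Re s" "Re s \<le> 1" and n: "n \<le> 2"
    define P where "P = 1 + \<bar>Im s\<bar>"
    have P: "P \<ge> 1" by (simp add: P_def)
    have reg: "- 1 / 112 \<le> Re w \<and> norm w \<le> 3 * P \<and> norm (1 + w) \<le> 4 * P" if "w \<in> cball s (1/112)" for w
    proof -
      have "norm (w - s) \<le> 1/112" using that by (simp add: dist_norm norm_minus_commute)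
      then have 1: "\<bar>Re w - Re s\<bar> \<le> 1/112" "\<bar>Im w - Im s\<bar> \<le> 1/112"
        using abs_Re_le_cmod[of "w - s"] abs_Im_le_cmod[of "w - s"] by auto
      have 5: "Re w - Re s \<le> 1/112" "- (Re w - Re s) \<le> 1/112" using 1(1) unfolding abs_le_iff by auto
      have 2: "- 1 / 112 \<le> Re w" using 5 s by linarith
      have 3: "\<bar>Re w\<bar> \<le> 1 + 1 / 112" using 5 s by linarith
      have 4: "\<bar>Im w\<bar> \<le> \<bar>Im s\<bar> + 1 / 112" using 1(2) by arith
      have 6: "norm w \<le> (1 + 1 / 112) + (\<bar>Im s\<bar> + 1 / 112)"
        by (rule order_trans[OF cmod_le add_mono[OF 3 4]])
      also have "\<dots> \<le> 3 * P" by (simp add: P_def)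
      finally have 7: "norm w \<le> 3 * P" .
      moreover have "norm (1 + w) \<le> 1 + norm w" using norm_triangle_ineq[of 1 w] by simp
      then have "norm (1 + w) \<le> 4 * P" using 7 P by simp
      ultimately show ?thesis using 2 by simp
    qed
    have bd: "norm (szeta w) \<le> (1 + 12 * B) * P powr (57/56)" if "w \<in> cball s (1/112)" for w
    proof -
      note r = reg[OF that]
      have "norm (szeta w) \<le> 1 + B * norm w * norm (1 + w) powr (1/56)"
        using B(2)[of w] r by simp
      also have "\<dots> \<le> 1 + B * (3 * P) * (4 * P) powr (1/56)"
        using r B(1) P by (intro add_left_mono mult_mono powr_mono2) auto
      also have "(4 * P) powr (1/56) = 4 powr (1/56) * P powr (1/56)"
        using P by (simp add: powr_mult)
      also have "1 + B * (3 * P) * (4 powr (1/56) * P powr (1/56)) \<le> 1 + B * (3 * P) * (4 powr 1 * P powr (1/56))"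
        using B(1) P by (intro add_left_mono mult_left_mono mult_right_mono powr_mono) auto
      also have "\<dots> = 1 + 12 * B * (P * P powr (1/56))" by simp
      also have "P * P powr (1/56) = P powr (57/56)"
        using P by (simp add: powr_mult_base)
      also have "1 + 12 * B * P powr (57/56) \<le> P powr (57/56) + 12 * B * P powr (57/56)"
        using P by (intro add_right_mono ge_one_powr_ge_zero) auto
      finally show ?thesis by (simp add: algebra_simps)
    qed
    have sub: "cball s (1/112) \<subseteq> {s. - 1 / 2 < Re s}" using reg by force
    have hol: "szeta holomorphic_on cball s (1/112)"
      using szeta_holomorphic sub by (rule holomorphic_on_subset)
    have "norm ((deriv ^^ n) szeta s) \<le> fact n * ((1 + 12 * B) * P powr (57/56)) / (1/112) ^ n"
    proof (rule Cauchy_inequality)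
      show "szeta holomorphic_on ball s (1/112)" using hol by (rule holomorphic_on_subset) auto
      show "continuous_on (cball s (1/112)) szeta" using hol by (rule holomorphic_on_imp_continuous_on)
      show "norm (szeta x) \<le> (1 + 12 * B) * P powr (57/56)" if "norm (s - x) = 1/112" for x
        using that by (intro bd) (simp add: dist_norm)
    qed simp
    also have "\<dots> = (fact n * 112 ^ n) * ((1 + 12 * B) * P powr (57/56))"
      by (simp add: power_one_over divide_simps)
    also have "\<dots> \<le> (2 * 112 ^ 2) * ((1 + 12 * B) * P powr (57/56))"
      using fact_mono[OF n, where 'a = real] B(1) n
      by (intro mult_right_mono mult_mono power_increasing) (auto simp: fact_numeral)
    also have "\<dots> = C * P powr (57/56)" by (simp add: C_def)
    finally show "norm ((deriv ^^ n) szeta s) \<le> C * (1 + \<bar>Im s\<bar>) powr (57/56)"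
      by (simp add: P_def)
  qed
qed

lemma szeta_field_derivative:
  assumes "- 1/2 < Re s"
  shows "(szeta has_field_derivative deriv szeta s) (at s)" "(deriv szeta has_field_derivative (deriv ^^ 2) szeta s) (at s)"
proof -
  have op: "open {s. - 1 / 2 < Re s}" by (rule open_halfspace_Re_gt)
  show "(szeta has_field_derivative deriv szeta s) (at s)"
    using holomorphic_derivI[OF szeta_holomorphic op] assms by auto
  have "deriv szeta holomorphic_on {s. - 1 / 2 < Re s}"
    using holomorphic_deriv[OF szeta_holomorphic op] .
  from holomorphic_derivI[OF this op] assms
  show "(deriv szeta has_field_derivative (deriv ^^ 2) szeta s) (at s)"
    by (auto simp: numeral_2_eq_2)
qed

text \<open>The factor \<delta>^3 |\<delta>+it|^4 |\<delta>+2it|, which is at least \<delta>^3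
  |t|^5, turns the zeta values of the 3-4-1 inequality into values of \<open>szeta\<close>.\<close>

lemma szeta_lower_three_four_one:
  fixes \<delta> t :: real
  assumes \<delta>: "\<delta> > 0" and t: "t \<noteq> 0"
  shows "\<delta> ^ 3 * \<bar>t\<bar> ^ 5 \<le> norm (szeta (of_real \<delta>)) ^ 3 * norm (szeta (Complex \<delta> t)) ^ 4 * norm (szeta (Complex \<delta> (2 * t)))"
proof -
  have e: "1 + Complex \<delta> u = Complex (1 + \<delta>) u" for u by (simp add: complex_eq_iff)
  have "\<delta> ^ 3 * \<bar>t\<bar> ^ 5 = \<delta> ^ 3 * \<bar>t\<bar> ^ 4 * \<bar>t\<bar>" by (simp add: eval_nat_numeral)
  also have "\<dots> \<le> \<delta> ^ 3 * norm (Complex \<delta> t) ^ 4 * norm (Complex \<delta> (2 * t))"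
    using \<delta> abs_Im_le_cmod[of "Complex \<delta> t"] abs_Im_le_cmod[of "Complex \<delta> (2 * t)"]
    by (intro mult_mono power_mono) (auto simp: abs_mult)
  also have "\<dots> * 1 \<le> \<delta> ^ 3 * norm (Complex \<delta> t) ^ 4 * norm (Complex \<delta> (2 * t)) *
     (norm (zeta_sum (of_real (1 + \<delta>))) ^ 3 * norm (zeta_sum (Complex (1 + \<delta>) t)) ^ 4 * norm (zeta_sum (Complex (1 + \<delta>) (2 * t))))"
    using \<delta> by (intro mult_left_mono three_four_one) auto
  also have "\<dots> = norm (szeta (of_real \<delta>)) ^ 3 * norm (szeta (Complex \<delta> t)) ^ 4 * norm (szeta (Complex \<delta> (2 * t)))"
    using \<delta> by (simp add: szeta_eq_zeta_sum e norm_mult power_mult_distrib)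
  finally show ?thesis by simp
qed

text \<open>For $\delta$ below $x_0^4$ the value is compared with the one at $\mathrm{Re}\, s = x_0^4$, with $x_0$ chosen so that the bound from the 3-4-1 inequality there is twice the possible variation.\<close>

lemma szeta_lower_bound:
  obtains c t0 where "c > 0" "0 < t0" "t0 \<le> 1"
    "\<And>\<delta> t. 0 < \<delta> \<Longrightarrow> \<delta> < t0 \<Longrightarrow> c * (1 + \<bar>t\<bar>) powr (13/14) \<le> norm (szeta (Complex \<delta> t))"
proof -
  obtain C where C: "C \<ge> 1"
    "\<And>s n. 0 \<le> Re s \<Longrightarrow> Re s \<le> 1 \<Longrightarrow> n \<le> 2 \<Longrightarrow> norm ((deriv ^^ n) szeta s) \<le> C * (1 + \<bar>Im s\<bar>) powr (57/56)"
    by (rule szeta_deriv_bounds) blast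
  have C0: "norm (szeta s) \<le> C * (1 + \<bar>Im s\<bar>) powr (57/56)" if "0 \<le> Re s" "Re s \<le> 1" for s
    using C(2)[OF that, of 0] by simp
  have C1: "norm (deriv szeta s) \<le> C * (1 + \<bar>Im s\<bar>) powr (57/56)" if "0 \<le> Re s" "Re s \<le> 1" for s
    using C(2)[OF that, of 1] by simp
  \<comment> \<open>The 3-4-1 bound degenerates as t tends to 0; near the origin Z(0) = 1 and
    continuity give |Z| >= 1/2 instead.\<close>
  have "isCont szeta 0"
    using szeta_field_derivative(1)[of 0] by (intro DERIV_isCont) auto
  then obtain d where d: "d > 0" "\<And>s. dist s 0 < d \<Longrightarrow> dist (szeta s) (szeta 0) < 1/2"
    unfolding continuous_at_eps_delta by (metis half_gt_zero_iff zero_less_one)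
  define r where "r = min 1 (d / 2)"
  have r: "0 < r" "r \<le> 1" "2 * r \<le> d" using d(1) by (auto simp: r_def)
  \<comment> \<open>The minimum of |t|/(1+|t|) over |t| >= r.\<close>
  define \<kappa> where "\<kappa> = r / (1 + r)"
  have \<kappa>: "\<kappa> > 0" using r by (simp add: \<kappa>_def)
  \<comment> \<open>With this fourth root the 3-4-1 inequality reads |Z(x^4 + it)| >= D x^3
    P^(223/224). In 4 C^4, the value at the real point accounts for C^3 and the one at ordinate 2t
    for 4C.\<close>
  define D where "D = (\<kappa> ^ 5 / (4 * C ^ 4)) powr (1/4)"
  have D: "D > 0" "D ^ 4 = \<kappa> ^ 5 / (4 * C ^ 4)"
    using \<kappa> C(1) by (auto simp: D_def powr_power)
  \<comment> \<open>C b <= D/2 ensures that moving from Re s = x0^4 to a smaller \<delta> changes Z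
    by at most half of its lower bound.\<close>
  define b where "b = min 1 (D / (2 * C))"
  have b: "0 < b" "b \<le> 1" "C * b \<le> D / 2" using D C(1) by (auto simp: b_def min_def field_simps)
  \<comment> \<open>Writing \<delta> = x^4 keeps the powers of x integral. The exponent 223/224 = (5
    - 57/56)/4 is what the fourth root leaves of |t|^5 after division by the growth at ordinate
    2t.\<close>
  have A: "D * x ^ 3 * (1 + \<bar>t\<bar>) powr (223/224) \<le> norm (szeta (Complex (x ^ 4) t))"
    if x: "0 < x" "x \<le> 1" and t: "r \<le> \<bar>t\<bar>" for x t
  proof -
    define P where "P = 1 + \<bar>t\<bar>"
    have P: "P \<ge> 1" by (simp add: P_def)
    have x4: "0 < x ^ 4" "x ^ 4 \<le> 1" using x by (auto intro: power_le_one)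
    have tk: "\<kappa> * P \<le> \<bar>t\<bar>" using r t by (simp add: \<kappa>_def P_def field_simps)
    have b1: "norm (szeta (of_real (x ^ 4))) \<le> C"
      using C0[of "of_real (x ^ 4)"] x4 by (simp del: of_real_power)
    have b2: "norm (szeta (Complex (x ^ 4) (2 * t))) \<le> 4 * C * P powr (57/56)"
    proof -
      have "norm (szeta (Complex (x ^ 4) (2 * t))) \<le> C * (1 + 2 * \<bar>t\<bar>) powr (57/56)"
        using C0[of "Complex (x ^ 4) (2 * t)"] x4 by (simp add: abs_mult)
      also have "\<dots> \<le> C * (2 * P) powr (57/56)"
        using C(1) by (intro mult_left_mono powr_mono2) (auto simp: P_def)
      also have "\<dots> = C * (2 powr (57/56) * P powr (57/56))"
        using P by (simp add: powr_mult)
      also have "\<dots> \<le> C * (2 powr 2 * P powr (57/56))"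
        using C(1) by (intro mult_left_mono mult_right_mono powr_mono) auto
      finally show ?thesis by simp
    qed
    have "(x ^ 4) ^ 3 * (\<kappa> * P) ^ 5 \<le> (x ^ 4) ^ 3 * \<bar>t\<bar> ^ 5"
      using tk \<kappa> P x4 by (intro mult_left_mono power_mono) auto
    also have "\<dots> \<le> norm (szeta (of_real (x ^ 4))) ^ 3 * norm (szeta (Complex (x ^ 4) t)) ^ 4 * norm (szeta (Complex (x ^ 4) (2 * t)))"
      using x4 t r by (intro szeta_lower_three_four_one) auto
    also have "\<dots> \<le> C ^ 3 * norm (szeta (Complex (x ^ 4) t)) ^ 4 * (4 * C * P powr (57/56))"
      using C(1) by (intro mult_mono power_mono b1 b2) auto
    finally have 1: "(x ^ 4) ^ 3 * (\<kappa> * P) ^ 5 \<le> 4 * C ^ 4 * norm (szeta (Complex (x ^ 4) t)) ^ 4 * P powr (57/56)"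
      by (simp add: eval_nat_numeral mult_ac)
    have p1: "P ^ 5 = P powr (223/56) * P powr (57/56)"
      using P by (simp flip: powr_add powr_numeral)
    have "(x ^ 4) ^ 3 * (\<kappa> ^ 5 * P powr (223/56)) * P powr (57/56) \<le> 4 * C ^ 4 * norm (szeta (Complex (x ^ 4) t)) ^ 4 * P powr (57/56)"
      using 1 by (simp add: power_mult_distrib p1 mult_ac)
    then have "(x ^ 4) ^ 3 * (\<kappa> ^ 5 * P powr (223/56)) \<le> 4 * C ^ 4 * norm (szeta (Complex (x ^ 4) t)) ^ 4"
      by (rule mult_right_le_imp_le) (use P in auto)
    then have "(x ^ 4) ^ 3 * (D ^ 4 * P powr (223/56)) \<le> norm (szeta (Complex (x ^ 4) t)) ^ 4"
      unfolding D(2) using C(1) by (simp add: field_simps)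
    moreover have "(D * x ^ 3 * P powr (223/224)) ^ 4 = (x ^ 4) ^ 3 * (D ^ 4 * P powr (223/56))"
      using P by (simp add: power_mult_distrib powr_power flip: power_mult)
    ultimately show ?thesis
      unfolding P_def[symmetric] using power_mono_iff[of "D * x ^ 3 * P powr (223/224)" "norm (szeta (Complex (x ^ 4) t))" 4] D(1) x
      by simp
  qed
  define c where "c = min (1/4) (D * b ^ 3 / 2)"
  show ?thesis
  proof
    show "c > 0" using D b by (simp add: c_def)
    show "0 < r" "r \<le> 1" by (fact r)+
    fix \<delta> t :: real
    assume \<delta>: "0 < \<delta>" "\<delta> < r"
    define P where "P = 1 + \<bar>t\<bar>"
    have P: "P \<ge> 1" by (simp add: P_def)
    show "c * (1 + \<bar>t\<bar>) powr (13/14) \<le> norm (szeta (Complex \<delta> t))"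
    proof (cases "\<bar>t\<bar> < r")
      case True
      have "norm (Complex \<delta> t) \<le> \<bar>\<delta>\<bar> + \<bar>t\<bar>" using cmod_le[of "Complex \<delta> t"] by simp
      then have "dist (Complex \<delta> t) 0 < d" using True \<delta> r by simp
      from d(2)[OF this] have "norm (szeta (Complex \<delta> t) - 1) < 1/2" by (simp add: dist_norm szeta_0)
      then have 1: "norm (szeta (Complex \<delta> t)) \<ge> 1/2"
        using norm_triangle_ineq3[of "szeta (Complex \<delta> t)" 1] by simp
      have "P powr (13/14) \<le> P powr 1" using P by (intro powr_mono) auto
      then have "P powr (13/14) \<le> 2" using True r P by (simp add: P_def)
      then have "c * P powr (13/14) \<le> (1/4) * 2"
        by (intro mult_mono) (auto simp: c_def)
      then show ?thesis using 1 by (simp add: P_def)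
    next
      case False
      \<comment> \<open>The exponent -5/224 makes x0^3 P^(223/224) and x0^4 P^(57/56) multiples of
        the same power P^(13/14).\<close>
      define x0 where "x0 = b * P powr (- 5 / 224)"
      have x0: "0 < x0" "x0 \<le> 1"
      proof -
        show "0 < x0" using b P by (simp add: x0_def)
        have "x0 \<le> 1 * 1" unfolding x0_def
          using b P powr_mono[of "- 5 / 224" 0 P] by (intro mult_mono) auto
        then show "x0 \<le> 1" by simp
      qed
      have cP: "D * x0 ^ 3 * P powr (223/224) = D * b ^ 3 * P powr (13/14)"
        using P by (simp add: x0_def power_mult_distrib powr_power flip: powr_add)
      show ?thesis
      proof (cases "x0 ^ 4 \<le> \<delta>")
        case True
        \<comment> \<open>For \<delta> >= x0^4 the 3-4-1 bound is applied at \<delta> itself, since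
          it increases with \<delta>.\<close>
        define x where "x = \<delta> powr (1/4)"
        have x: "0 < x" "x ^ 4 = \<delta>" "x \<le> 1"
          using \<delta> r by (auto simp: x_def powr_power powr_le1)
        have "x0 \<le> x" using True x x0 by (metis less_eq_real_def power_mono_iff zero_less_numeral)
        have "c * P powr (13/14) \<le> D * b ^ 3 * P powr (13/14)"
          using D b by (intro mult_right_mono) (auto simp: c_def min_def)
        also have "\<dots> = D * x0 ^ 3 * P powr (223/224)" by (rule cP[symmetric])
        also have "\<dots> \<le> D * x ^ 3 * P powr (223/224)"
          using D x0 \<open>x0 \<le> x\<close> by (intro mult_right_mono mult_left_mono power_mono) auto
        also have "\<dots> \<le> norm (szeta (Complex (x ^ 4) t))"
          unfolding P_def using False x by (intro A) auto
        finally show ?thesis using x by (simp add: P_def)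
      next
        case F: False
        have x04: "x0 ^ 4 \<le> 1" using x0 by (simp add: power_le_one)
        have der: "((\<lambda>x. szeta (Complex x t)) has_vector_derivative deriv szeta (Complex x t)) (at x within S)" if "x > 0" for x S
        proof -
          have "((\<lambda>x. Complex x t) has_vector_derivative 1) (at x within S)"
            unfolding Complex_eq by (auto intro!: derivative_eq_intros)
          moreover have "(szeta has_field_derivative deriv szeta (Complex x t)) (at (Complex x t) within (\<lambda>x. Complex x t) ` S)"
            using that by (intro has_field_derivative_at_within[OF szeta_field_derivative(1)]) simp
          ultimately show ?thesis
            using field_vector_diff_chain_within[of "\<lambda>x. Complex x t" 1 x S szeta] by (simp add: o_def)
        qed
        have "norm (szeta (Complex (x0 ^ 4) t) - szeta (Complex \<delta> t)) \<le> (C * P powr (57/56)) * (x0 ^ 4 - \<delta>)"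
        proof (rule vector_derivative_norm_bound)
          show "\<delta> \<le> x0 ^ 4" using F by simp
          fix x assume x: "x \<in> {\<delta>..x0 ^ 4}"
          then show "((\<lambda>x. szeta (Complex x t)) has_vector_derivative deriv szeta (Complex x t)) (at x within {\<delta>..x0 ^ 4})"
            using \<delta> by (intro der) auto
          show "norm (deriv szeta (Complex x t)) \<le> C * P powr (57/56)"
            using C1[of "Complex x t"] x \<delta> x04 by (simp add: P_def)
        qed
        also have "\<dots> \<le> (C * P powr (57/56)) * x0 ^ 4"
          using C(1) \<delta> by (intro mult_left_mono) auto
        also have "\<dots> = (C * b) * b ^ 3 * P powr (13/14)"
          using P by (simp add: x0_def power_mult_distrib powr_power eval_nat_numeral flip: powr_add)
        also have "\<dots> \<le> (D / 2) * b ^ 3 * P powr (13/14)"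
          using b by (intro mult_right_mono) auto
        finally have 1: "norm (szeta (Complex (x0 ^ 4) t) - szeta (Complex \<delta> t)) \<le> (D / 2) * b ^ 3 * P powr (13/14)" .
        have 2: "D * b ^ 3 * P powr (13/14) \<le> norm (szeta (Complex (x0 ^ 4) t))"
          unfolding cP[symmetric] using False x0 unfolding P_def by (intro A) auto
        have 3: "c * P powr (13/14) \<le> (D * b ^ 3 / 2) * P powr (13/14)"
          by (intro mult_right_mono) (auto simp: c_def)
        have "norm (szeta (Complex (x0 ^ 4) t)) \<le> norm (szeta (Complex \<delta> t)) + norm (szeta (Complex (x0 ^ 4) t) - szeta (Complex \<delta> t))"
          by (metis norm_triangle_sub)
        then show ?thesis using 1 2 3 by (simp add: P_def)
      qed
    qed
  qed
qed

definition rszeta :: "complex \<Rightarrow> complex" where "rszeta s = 1 / szeta s"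
definition rszeta1 :: "complex \<Rightarrow> complex" where "rszeta1 s = - deriv szeta s / (szeta s)\<^sup>2"
definition rszeta2 :: "complex \<Rightarrow> complex" where "rszeta2 s = 2 * (deriv szeta s)\<^sup>2 / (szeta s) ^ 3 - (deriv ^^ 2) szeta s / (szeta s)\<^sup>2"

lemma rszeta_derivatives:
  assumes "- 1/2 < Re s" "szeta s \<noteq> 0"
  shows "(rszeta has_field_derivative rszeta1 s) (at s)" "(rszeta1 has_field_derivative rszeta2 s) (at s)"
proof -
  note d = szeta_field_derivative[OF assms(1)]
  show "(rszeta has_field_derivative rszeta1 s) (at s)"
    unfolding rszeta_def[abs_def] rszeta1_def using assms(2)
    by (auto intro!: derivative_eq_intros d simp: power2_eq_square)
  show "(rszeta1 has_field_derivative rszeta2 s) (at s)"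
    unfolding rszeta1_def[abs_def] rszeta2_def using assms(2)
    by (auto intro!: derivative_eq_intros d simp: field_simps eval_nat_numeral)
qed

text \<open>The exponents are -13/14 for 1/Z, 57/56 - 26/14 = -47/56 for Z'/Z^2 and Z''/Z^2, and
  57/28 - 39/14 = -3/4 for Z'^2/Z^3; the last is the weakest and sets the common exponent.\<close>

lemma rszeta_bounds:
  obtains C t0 where "C > 0" "0 < t0" "t0 \<le> 1"
    "\<And>\<delta> t. 0 < \<delta> \<Longrightarrow> \<delta> < t0 \<Longrightarrow> szeta (Complex \<delta> t) \<noteq> 0"
    "\<And>\<delta> t. 0 < \<delta> \<Longrightarrow> \<delta> < t0 \<Longrightarrow> norm (rszeta (Complex \<delta> t)) \<le> C * (1 + \<bar>t\<bar>) powr (- 3/4)"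
    "\<And>\<delta> t. 0 < \<delta> \<Longrightarrow> \<delta> < t0 \<Longrightarrow> norm (rszeta1 (Complex \<delta> t)) \<le> C * (1 + \<bar>t\<bar>) powr (- 3/4)"
    "\<And>\<delta> t. 0 < \<delta> \<Longrightarrow> \<delta> < t0 \<Longrightarrow> norm (rszeta2 (Complex \<delta> t)) \<le> C * (1 + \<bar>t\<bar>) powr (- 3/4)"
proof -
  obtain B where B: "B \<ge> 1"
    "\<And>s n. 0 \<le> Re s \<Longrightarrow> Re s \<le> 1 \<Longrightarrow> n \<le> 2 \<Longrightarrow> norm ((deriv ^^ n) szeta s) \<le> B * (1 + \<bar>Im s\<bar>) powr (57/56)"
    by (rule szeta_deriv_bounds) blast
  obtain c t0 where c: "c > 0" "0 < t0" "t0 \<le> 1"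
    "\<And>\<delta> t. 0 < \<delta> \<Longrightarrow> \<delta> < t0 \<Longrightarrow> c * (1 + \<bar>t\<bar>) powr (13/14) \<le> norm (szeta (Complex \<delta> t))"
    by (rule szeta_lower_bound) blast
  define C where "C = 1 / c + B / c\<^sup>2 + 2 * B\<^sup>2 / c ^ 3"
  have Cle: "1 / c \<le> C" "B / c\<^sup>2 \<le> C" "B / c\<^sup>2 + 2 * B\<^sup>2 / c ^ 3 \<le> C"
    using c(1) B(1) by (auto simp: C_def)
  show ?thesis
  proof
    show "C > 0" unfolding C_def using c(1) B(1) by (intro add_pos_pos divide_pos_pos mult_pos_pos) auto
    show "0 < t0" "t0 \<le> 1" by (fact c)+
    fix \<delta> t :: real assume \<delta>: "0 < \<delta>" "\<delta> < t0"
    define P where "P = 1 + \<bar>t\<bar>"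
    have P: "P \<ge> 1" by (simp add: P_def)
    let ?s = "Complex \<delta> t"
    have L: "c * P powr (13/14) \<le> norm (szeta ?s)" using c(4)[OF \<delta>] by (simp add: P_def)
    have Lp: "0 < c * P powr (13/14)" using c(1) P by simp
    show nz: "szeta ?s \<noteq> 0" using L Lp by auto
    have d1: "norm (deriv szeta ?s) \<le> B * P powr (57/56)" using B(2)[of ?s 1] \<delta> c(3) by (simp add: P_def)
    have d2: "norm ((deriv ^^ 2) szeta ?s) \<le> B * P powr (57/56)" using B(2)[of ?s 2] \<delta> c(3) by (simp add: P_def)
    have e1: "norm (rszeta ?s) \<le> (1 / c) * P powr (- 13/14)"
    proof -
      have "norm (rszeta ?s) = 1 / norm (szeta ?s)" by (simp add: rszeta_def norm_divide)
      also have "\<dots> \<le> 1 / (c * P powr (13/14))" using L Lp nz c(1) P by (intro divide_left_mono mult_pos_pos) auto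
      also have "\<dots> = (1 / c) * P powr (- 13/14)" using powr_minus_divide[of P "13/14"] by simp
      finally show ?thesis .
    qed
    have e2: "norm (x / (szeta ?s)\<^sup>2) \<le> (B / c\<^sup>2) * P powr (- 47/56)" if "norm x \<le> B * P powr (57/56)" for x
    proof -
      have "norm (x / (szeta ?s)\<^sup>2) = norm x / norm (szeta ?s) ^ 2" by (simp add: norm_divide norm_power)
      also have "\<dots> \<le> (B * P powr (57/56)) / (c * P powr (13/14)) ^ 2"
        using L Lp that B(1) by (intro frac_le power_mono) auto
      also have "\<dots> = (B / c\<^sup>2) * (P powr (57/56) * P powr (- 13 / 7))"
        using P powr_minus_divide[of P "13/7"] by (simp add: power_mult_distrib powr_power)
      also have "\<dots> = (B / c\<^sup>2) * P powr (- 47/56)" by (simp flip: powr_add)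
      finally show ?thesis .
    qed
    have e3: "norm (2 * (deriv szeta ?s)\<^sup>2 / (szeta ?s) ^ 3) \<le> (2 * B\<^sup>2 / c ^ 3) * P powr (- 3/4)"
    proof -
      have "norm (2 * (deriv szeta ?s)\<^sup>2 / (szeta ?s) ^ 3) = 2 * norm (deriv szeta ?s) ^ 2 / norm (szeta ?s) ^ 3"
        by (simp add: norm_divide norm_power norm_mult)
      also have "\<dots> \<le> 2 * (B * P powr (57/56)) ^ 2 / (c * P powr (13/14)) ^ 3"
        using L Lp d1 B(1) by (intro frac_le power_mono mult_left_mono) auto
      also have "\<dots> = (2 * B\<^sup>2 / c ^ 3) * (P powr (57/28) * P powr (- 39 / 14))"
        using P powr_minus_divide[of P "39/14"] by (simp add: power_mult_distrib powr_power)
      also have "\<dots> = (2 * B\<^sup>2 / c ^ 3) * P powr (- 3/4)" by (simp flip: powr_add)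
      finally show ?thesis .
    qed
    have up: "x * P powr a \<le> x * P powr (- 3/4)" if "a \<le> - 3/4" "x \<ge> 0" for x a
      using that P by (intro mult_left_mono powr_mono) auto
    have fin: "x * P powr (- 3/4) \<le> C * P powr (- 3/4)" if "x \<le> C" for x
      using that by (intro mult_right_mono) auto
    show "norm (rszeta ?s) \<le> C * (1 + \<bar>t\<bar>) powr (- 3/4)"
      unfolding P_def[symmetric]
      by (rule order_trans[OF e1 order_trans[OF up fin]]) (use c(1) Cle in auto)
    show "norm (rszeta1 ?s) \<le> C * (1 + \<bar>t\<bar>) powr (- 3/4)"
      unfolding P_def[symmetric] rszeta1_def
      by (rule order_trans[OF e2 order_trans[OF up fin]]) (use c(1) B(1) d1 Cle in auto)
    have "norm (rszeta2 ?s) \<le> (2 * B\<^sup>2 / c ^ 3) * P powr (- 3/4) + (B / c\<^sup>2) * P powr (- 3/4)"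
      unfolding rszeta2_def
      by (rule order_trans[OF norm_triangle_ineq4 add_mono[OF e3 order_trans[OF e2[OF d2] up]]]) (use c(1) B(1) in auto)
    also have "\<dots> = (B / c\<^sup>2 + 2 * B\<^sup>2 / c ^ 3) * P powr (- 3/4)" by (simp add: algebra_simps)
    also have "\<dots> \<le> C * P powr (- 3/4)" by (rule fin[OF Cle(3)])
    finally show "norm (rszeta2 ?s) \<le> C * (1 + \<bar>t\<bar>) powr (- 3/4)" by (simp add: P_def)
  qed
qed

section \<open>Moebius convolutions\<close>

lemma prime_factors_prod_primes:
  fixes S :: "nat set"
  assumes "finite S" "\<And>p. p \<in> S \<Longrightarrow> prime p"
  shows "prime_factors (\<Prod>S) = S"
proof -
  have "\<Prod>S \<noteq> 0" using assms by (auto dest: prime_gt_0_nat)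
  then have "prime_factors (\<Prod>S) = {p. prime p \<and> p dvd \<Prod>S}" by (simp add: prime_factors_dvd)
  also have "\<dots> = S"
    using assms prime_dvd_prod_iff[OF assms(1), of _ "\<lambda>x. x"] primes_dvd_imp_eq by blast
  finally show ?thesis .
qed

lemma squarefree_eq_prod_prime_factors:
  assumes "squarefree (n::nat)"
  shows "\<Prod>(prime_factors n) = n"
proof -
  have n: "n \<noteq> 0" using assms by (metis not_squarefree_0)
  have "p ^ multiplicity p n = p" if p: "p \<in> prime_factors n" for p
  proof -
    have "multiplicity p n \<le> 1" using assms n p squarefree_factorial_semiring''[OF n] by auto
    moreover have "multiplicity p n > 0" using p by (simp add: prime_factors_multiplicity)
    ultimately have "multiplicity p n = 1" by simp
    then show ?thesis by simp
  qed
  then have "\<Prod>(prime_factors n) = (\<Prod>p\<in>prime_factors n. p ^ multiplicity p n)" by simp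
  also have "\<dots> = n" using prod_prime_factors[OF n] by simp
  finally show ?thesis .
qed

text \<open>The squarefree divisors of n are the products over subsets S of its set of primes, and
  mu and omega depend on S only through \<open>card S\<close>.\<close>

lemma sum_moebius_divisors:
  fixes n :: nat and F :: "nat \<Rightarrow> int"
  assumes n: "n > 0"
  shows "(\<Sum>d | d dvd n. moebius_mu d * F (prime_omega d)) =
    (\<Sum>S\<in>Pow (prime_factors n). (-1) ^ card S * F (card S))"
proof -
  have pr: "prime p" if "p \<in> prime_factors n" for p using that by auto
  have "(\<Sum>d | d dvd n. moebius_mu d * F (prime_omega d)) =
    (\<Sum>d | d dvd n \<and> squarefree d. moebius_mu d * F (prime_omega d))"
    using n by (intro sum.mono_neutral_right) (auto simp: moebius_mu_def)
  also have "\<dots> = (\<Sum>S\<in>Pow (prime_factors n). (-1) ^ card S * F (card S))"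
  proof (rule sum.reindex_bij_witness[where i = "\<lambda>S. \<Prod>S" and j = prime_factors])
    fix S assume S: "S \<in> Pow (prime_factors n)"
    have fS: "finite S" using S by (auto intro: finite_subset)
    show "prime_factors (\<Prod>S) = S" using S pr fS by (intro prime_factors_prod_primes) auto
    have "squarefree (\<Prod>S)"
      using S pr by (intro squarefree_prod_coprime) (auto intro!: primes_coprime squarefree_prime)
    moreover have "\<Prod>S dvd \<Prod>(prime_factors n)" using S by (intro prod_dvd_prod_subset) auto
    moreover have "\<Prod>(prime_factors n) dvd (\<Prod>p\<in>prime_factors n. p ^ multiplicity p n)"
    proof (intro prod_dvd_prod)
      fix p assume "p \<in> prime_factors n"
      then have "multiplicity p n > 0" by (simp add: prime_factors_multiplicity)
      then show "p dvd p ^ multiplicity p n" by simp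
    qed
    ultimately show "\<Prod>S \<in> {d. d dvd n \<and> squarefree d}"
      using n prod_prime_factors[of n] by (auto intro: dvd_trans)
  next
    fix d assume d: "d \<in> {d. d dvd n \<and> squarefree d}"
    show "\<Prod>(prime_factors d) = d" using d by (intro squarefree_eq_prod_prime_factors) auto
    show "prime_factors d \<in> Pow (prime_factors n)" using d n dvd_prime_factors[of n d] by auto
    show "(-1) ^ card (prime_factors d) * F (card (prime_factors d)) = moebius_mu d * F (prime_omega d)"
      using d by (simp add: moebius_mu_def prime_omega_def)
  qed
  finally show ?thesis .
qed

lemma sum_Pow_insert:
  assumes "finite P" "x \<notin> P"
  shows "(\<Sum>S\<in>Pow (insert x P). H (card S)) = (\<Sum>S\<in>Pow P. H (card S)) + (\<Sum>S\<in>Pow P. (H (Suc (card S)) :: int))"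
proof -
  have "(\<Sum>S\<in>Pow (insert x P). H (card S)) = (\<Sum>S\<in>Pow P. H (card S)) + (\<Sum>S\<in>insert x ` Pow P. H (card S))"
    unfolding Pow_insert using assms by (intro sum.union_disjoint) auto
  also have "(\<Sum>S\<in>insert x ` Pow P. H (card S)) = (\<Sum>S\<in>Pow P. H (card (insert x S)))"
    using assms by (subst sum.reindex) (auto simp: inj_on_def o_def)
  also have "\<dots> = (\<Sum>S\<in>Pow P. H (Suc (card S)))"
    using assms by (intro sum.cong refl arg_cong[of _ _ H] card_insert_disjoint) (auto intro: finite_subset)
  finally show ?thesis .
qed

text \<open>With k = \<open>card P\<close> these sums are (-1)^k times the k-th finite difference at
  0 of 1, j and j^2, which vanishes once k exceeds the degree. This is why the divisor sums of mu
  omega^2 live on integers with one or two prime factors.\<close>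

lemma alternating_card_sums:
  assumes "finite P"
  shows "(\<Sum>S\<in>Pow P. (-1) ^ card S * (1::int)) = (if card P = 0 then 1 else 0)"
    and "(\<Sum>S\<in>Pow P. (-1) ^ card S * int (card S)) = (if card P = 1 then - 1 else 0)"
    and "(\<Sum>S\<in>Pow P. (-1) ^ card S * int (card S) ^ 2) = (if card P = 2 then 2 else if card P = 1 then - 1 else 0)"
proof -
  have a: "(\<Sum>S\<in>Pow P. (-1) ^ card S * (1::int)) = (if card P = 0 then 1 else 0)" if "finite P" for P :: "'a set"
    using that
  proof (induction P)
    case (insert x P)
    show ?case
      using insert.hyps sum_Pow_insert[OF insert.hyps, of "\<lambda>k. (-1) ^ k * 1"]
      by (simp add: sum_negf)
  qed simp
  have b: "(\<Sum>S\<in>Pow P. (-1) ^ card S * int (card S)) = (if card P = 1 then - 1 else 0)" if "finite P" for P :: "'a set"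
    using that
  proof (induction P)
    case (insert x P)
    show ?case
      using insert.hyps insert.IH a[OF insert.hyps(1)] sum_Pow_insert[OF insert.hyps, of "\<lambda>k. (-1) ^ k * int k"]
      by (simp add: sum_negf distrib_left sum.distrib sum_subtractf del: card_eq_0_iff card_0_eq)
  qed simp
  have c: "(\<Sum>S\<in>Pow P. (-1) ^ card S * int (card S) ^ 2) = (if card P = 2 then 2 else if card P = 1 then - 1 else 0)" if "finite P" for P :: "'a set"
    using that
  proof (induction P)
    case (insert x P)
    \<comment> \<open>Adding an element flips the sign and shifts j to j + 1; expanding (j+1)^2
      reduces to the three sums over P.\<close>
    have "(\<Sum>S\<in>Pow P. (-1) ^ Suc (card S) * int (Suc (card S)) ^ 2) =
      - (\<Sum>S\<in>Pow P. (-1) ^ card S * int (card S) ^ 2) - 2 * (\<Sum>S\<in>Pow P. (-1) ^ card S * int (card S)) - (\<Sum>S\<in>Pow P. (-1) ^ card S * (1::int))"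
      unfolding sum_negf[symmetric] sum_distrib_left sum_subtractf[symmetric]
      by (intro sum.cong refl) (simp add: power2_eq_square algebra_simps)
    then show ?case
      using insert.hyps a[OF insert.hyps(1)] b[OF insert.hyps(1)] sum_Pow_insert[OF insert.hyps, of "\<lambda>k. (-1) ^ k * int k ^ 2"]
      by (simp del: card_eq_0_iff card_0_eq)
  qed simp
  show "(\<Sum>S\<in>Pow P. (-1) ^ card S * (1::int)) = (if card P = 0 then 1 else 0)"
    "(\<Sum>S\<in>Pow P. (-1) ^ card S * int (card S)) = (if card P = 1 then - 1 else 0)"
    "(\<Sum>S\<in>Pow P. (-1) ^ card S * int (card S) ^ 2) = (if card P = 2 then 2 else if card P = 1 then - 1 else 0)"
    using a b c assms by blast+
qed

lemma prime_omega_eq_0_iff: "n > 0 \<Longrightarrow> prime_omega n = 0 \<longleftrightarrow> n = 1"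
  unfolding prime_omega_def by (auto simp: prime_factorization_empty_iff)

text \<open>This is g of the overview: the Dirichlet convolution of 1 with the pointwise product of
  mu and omega^2.\<close>

definition omega_conv :: "nat \<Rightarrow> int" where
  "omega_conv n = (if prime_omega n = 2 then 2 else if prime_omega n = 1 then - 1 else 0)"

lemma sum_moebius: "n > 0 \<Longrightarrow> (\<Sum>d | d dvd n. moebius_mu d) = (if n = 1 then 1 else 0)"
  using sum_moebius_divisors[of n "\<lambda>_. 1"] alternating_card_sums(1)[of "prime_factors n"] prime_omega_eq_0_iff[of n]
  by (simp add: prime_omega_def)

lemma sum_moebius_omega_sq: "n > 0 \<Longrightarrow> (\<Sum>d | d dvd n. moebius_mu d * int (prime_omega d) ^ 2) = omega_conv n"
  using sum_moebius_divisors[of n "\<lambda>k. int k ^ 2"] alternating_card_sums(3)[of "prime_factors n"]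
  by (simp add: omega_conv_def prime_omega_def)

text \<open>Both sides sum F e j k over the factorisations n = e j k; this is associativity of
  Dirichlet convolution.\<close>

lemma sum_divisors_swap:
  fixes F :: "nat \<Rightarrow> nat \<Rightarrow> nat \<Rightarrow> 'a::comm_monoid_add"
  assumes n: "n > 0"
  shows "(\<Sum>d | d dvd n. \<Sum>e | e dvd d. F e (d div e) (n div d)) = (\<Sum>e | e dvd n. \<Sum>k | k dvd n div e. F e (n div e div k) k)"
proof -
  have fin: "finite {d. d dvd m}" if "m dvd n" for m using that n by (auto dest: dvd_pos_nat)
  have "(\<Sum>d | d dvd n. \<Sum>e | e dvd d. F e (d div e) (n div d)) = (\<Sum>(d, e)\<in>Sigma {d. d dvd n} (\<lambda>d. {e. e dvd d}). F e (d div e) (n div d))"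
    using fin by (intro sum.Sigma) auto
  also have "\<dots> = (\<Sum>(e, k)\<in>Sigma {e. e dvd n} (\<lambda>e. {k. k dvd n div e}). F e (n div e div k) k)"
  proof (rule sum.reindex_bij_witness[where i = "\<lambda>(e, k). (n div k, e)" and j = "\<lambda>(d, e). (e, n div d)"])
    fix a assume "a \<in> Sigma {d. d dvd n} (\<lambda>d. {e. e dvd d})"
    then obtain e j k where a: "a = (e * j, e)" "n = e * j * k" by (auto elim!: dvdE)
    then have pos: "e > 0" "j > 0" "k > 0" using n by auto
    show "(case case a of (d, e) \<Rightarrow> (e, n div d) of (e, k) \<Rightarrow> (n div k, e)) = a"
      "(case a of (d, e) \<Rightarrow> (e, n div d)) \<in> Sigma {e. e dvd n} (\<lambda>e. {k. k dvd n div e})"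
      "(case case a of (d, e) \<Rightarrow> (e, n div d) of (e, k) \<Rightarrow> F e (n div e div k) k) = (case a of (d, e) \<Rightarrow> F e (d div e) (n div d))"
      using pos by (auto simp: a mult.assoc)
  next
    fix b assume "b \<in> Sigma {e. e dvd n} (\<lambda>e. {k. k dvd n div e})"
    then obtain e k where b: "b = (e, k)" "e dvd n" "k dvd n div e" by auto
    obtain m where m: "n = e * m" using b by blast
    have "e > 0" using m n by auto
    then obtain j where j: "m = k * j" using b m by auto
    have pos: "j > 0" "k > 0" using n by (auto simp: m j)
    show "(case case b of (e, k) \<Rightarrow> (n div k, e) of (d, e) \<Rightarrow> (e, n div d)) = b"
      "(case b of (e, k) \<Rightarrow> (n div k, e)) \<in> Sigma {d. d dvd n} (\<lambda>d. {e. e dvd d})"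
      using pos \<open>e > 0\<close> by (auto simp: b(1) m j mult.assoc mult.left_commute[of e k])
  qed
  also have "\<dots> = (\<Sum>e | e dvd n. \<Sum>k | k dvd n div e. F e (n div e div k) k)"
    using fin by (intro sum.Sigma[symmetric]) (auto simp: dvd_div_iff_mult intro: fin)
  finally show ?thesis .
qed

text \<open>With a the product of mu and omega^2, g is the convolution of a with 1. Convolving g
  with mu returns a, since 1 and mu are inverse to each other.\<close>

lemma moebius_omega_sq_convolution:
  assumes n: "n > 0"
  shows "moebius_mu n * int (prime_omega n) ^ 2 = (\<Sum>d | d dvd n. omega_conv d * moebius_mu (n div d))"
proof -
  let ?a = "\<lambda>e. moebius_mu e * int (prime_omega e) ^ 2"
  have "(\<Sum>d | d dvd n. omega_conv d * moebius_mu (n div d)) = (\<Sum>d | d dvd n. \<Sum>e | e dvd d. ?a e * moebius_mu (n div d))"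
    using n by (intro sum.cong refl) (auto simp: sum_distrib_right[symmetric] sum_moebius_omega_sq dvd_pos_nat)
  also have "\<dots> = (\<Sum>e | e dvd n. \<Sum>k | k dvd n div e. ?a e * moebius_mu k)"
    by (rule sum_divisors_swap[OF n, of "\<lambda>e _ k. ?a e * moebius_mu k"])
  also have "\<dots> = (\<Sum>e | e dvd n. if e = n then ?a e else 0)"
  proof (intro sum.cong refl)
    fix e assume e: "e \<in> {e. e dvd n}"
    then obtain m where m: "n = e * m" by blast
    have pos: "e > 0" "m > 0" using m n by auto
    have "(\<Sum>k | k dvd n div e. ?a e * moebius_mu k) = ?a e * (\<Sum>k | k dvd m. moebius_mu k)"
      using pos by (simp add: m sum_distrib_left)
    also have "\<dots> = (if e = n then ?a e else 0)"
      using pos by (auto simp: m sum_moebius)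
    finally show "(\<Sum>k | k dvd n div e. ?a e * moebius_mu k) = (if e = n then ?a e else 0)" .
  qed
  also have "\<dots> = ?a n" using n by simp
  finally show ?thesis by simp
qed

lemma sum_divisors_hyperbola:
  fixes F :: "nat \<Rightarrow> nat \<Rightarrow> 'a::comm_monoid_add"
  shows "(\<Sum>n=1..N. \<Sum>d | d dvd n. F d (n div d)) = (\<Sum>d=1..N. \<Sum>e=1..N div d. F d e)"
proof -
  have "(\<Sum>n=1..N. \<Sum>d | d dvd n. F d (n div d)) = (\<Sum>(n, d)\<in>Sigma {1..N} (\<lambda>n. {d. d dvd n}). F d (n div d))"
    by (intro sum.Sigma) auto
  also have "\<dots> = (\<Sum>(d, e)\<in>Sigma {1..N} (\<lambda>d. {1..N div d}). F d e)"
  proof (rule sum.reindex_bij_witness[where i = "\<lambda>(d, e). (d * e, d)" and j = "\<lambda>(n, d). (d, n div d)"])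
    fix a assume "a \<in> Sigma {1..N} (\<lambda>n. {d. d dvd n})"
    then obtain d e where a: "a = (d * e, d)" "d * e \<ge> 1" "d * e \<le> N" by (auto elim!: dvdE)
    then have pos: "d > 0" "e > 0" by auto
    have "d \<le> N" using a(3) pos by (metis mult_le_mono2 mult.right_neutral Suc_leI One_nat_def le_trans)
    moreover have "e \<le> N div d" using a(3) pos by (simp add: less_eq_div_iff_mult_less_eq mult.commute)
    ultimately show "(case case a of (n, d) \<Rightarrow> (d, n div d) of (d, e) \<Rightarrow> (d * e, d)) = a"
      "(case a of (n, d) \<Rightarrow> (d, n div d)) \<in> Sigma {1..N} (\<lambda>d. {1..N div d})"
      "(case case a of (n, d) \<Rightarrow> (d, n div d) of (d, e) \<Rightarrow> F d e) = (case a of (n, d) \<Rightarrow> F d (n div d))"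
      using pos by (auto simp: a)
  next
    fix b assume "b \<in> Sigma {1..N} (\<lambda>d. {1..N div d})"
    then obtain d e where b: "b = (d, e)" "d \<ge> 1" "e \<ge> 1" "e \<le> N div d" by auto
    then have "d * e \<le> N" by (simp add: less_eq_div_iff_mult_less_eq mult.commute)
    then show "(case case b of (d, e) \<Rightarrow> (d * e, d) of (n, d) \<Rightarrow> (d, n div d)) = b"
      "(case b of (d, e) \<Rightarrow> (d * e, d)) \<in> Sigma {1..N} (\<lambda>n. {d. d dvd n})"
      using b by auto
  qed
  also have "\<dots> = (\<Sum>d=1..N. \<Sum>e=1..N div d. F d e)"
    by (intro sum.Sigma[symmetric]) auto
  finally show ?thesis .
qed

section \<open>Partial sums of mu(n)/n and the sum with fractional parts\<close>

lemma abs_moebius_mu_le: "\<bar>moebius_mu n\<bar> \<le> 1"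
  by (simp add: moebius_mu_def power_abs)

text \<open>m(y) depends only on floor y, hence the natural argument; m(x/d) becomes
  \<open>mu_sum (N div d)\<close> with N = floor x.\<close>

definition mu_sum :: "nat \<Rightarrow> real" where
  "mu_sum N = (\<Sum>n=1..N. of_int (moebius_mu n) / real n)"

lemma frac_sum_eq:
  fixes x :: real
  assumes x: "x \<ge> 0"
  shows "(\<Sum>n | 1 \<le> n \<and> real n \<le> x. of_int (moebius_mu n) * real (prime_omega n) ^ 2 * frac (x / real n)) =
    x * (\<Sum>d=1..nat \<lfloor>x\<rfloor>. of_int (omega_conv d) / real d * mu_sum (nat \<lfloor>x\<rfloor> div d)) - (\<Sum>n=1..nat \<lfloor>x\<rfloor>. of_int (omega_conv n))"
proof -
  define N where "N = nat \<lfloor>x\<rfloor>"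
  let ?a = "\<lambda>n. moebius_mu n * int (prime_omega n) ^ 2"
  have set: "{n. 1 \<le> n \<and> real n \<le> x} = {1..N}"
    using x unfolding N_def by (auto simp: le_nat_iff le_floor_iff)
  \<comment> \<open>Rounding x down to N beforehand does not change the floor of x/n.\<close>
  have fl: "frac (x / real n) = x / real n - real (N div n)" if "n \<ge> 1" for n
  proof -
    have "\<lfloor>x / real n\<rfloor> = \<lfloor>x\<rfloor> div int n"
      using floor_divide_real_eq_div[of "int n" x] by simp
    also have "\<dots> = int (N div n)" using x by (simp add: N_def zdiv_int)
    finally show ?thesis by (simp add: frac_def)
  qed
  have "(\<Sum>n | 1 \<le> n \<and> real n \<le> x. of_int (moebius_mu n) * real (prime_omega n) ^ 2 * frac (x / real n)) =
    (\<Sum>n=1..N. of_int (?a n) * (x / real n - real (N div n)))"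
    unfolding set by (intro sum.cong refl) (simp add: fl)
  also have "\<dots> = x * (\<Sum>n=1..N. of_int (?a n) / real n) - (\<Sum>n=1..N. of_int (?a n) * real (N div n))"
    by (simp add: sum_subtractf right_diff_distrib sum_distrib_left mult.commute mult.left_commute)
  also have "(\<Sum>n=1..N. of_int (?a n) / real n) = (\<Sum>n=1..N. \<Sum>d | d dvd n. of_int (omega_conv d) * of_int (moebius_mu (n div d)) / (real d * real (n div d)))"
  proof (intro sum.cong refl)
    fix n assume "n \<in> {1..N}"
    then have n: "n > 0" by simp
    have "of_int (?a n) / real n = (\<Sum>d | d dvd n. of_int (omega_conv d) * of_int (moebius_mu (n div d)) / real n)"
      by (subst moebius_omega_sq_convolution[OF n]) (simp add: sum_divide_distrib)
    also have "\<dots> = (\<Sum>d | d dvd n. of_int (omega_conv d) * of_int (moebius_mu (n div d)) / (real d * real (n div d)))"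
      by (intro sum.cong refl) (auto simp flip: of_nat_mult)
    finally show "of_int (?a n) / real n = (\<Sum>d | d dvd n. of_int (omega_conv d) * of_int (moebius_mu (n div d)) / (real d * real (n div d)))" .
  qed
  also have "\<dots> = (\<Sum>d=1..N. \<Sum>e=1..N div d. of_int (omega_conv d) * of_int (moebius_mu e) / (real d * real e))"
    by (rule sum_divisors_hyperbola[of "\<lambda>d e. of_int (omega_conv d) * of_int (moebius_mu e) / (real d * real e)"])
  also have "\<dots> = (\<Sum>d=1..N. of_int (omega_conv d) / real d * mu_sum (N div d))"
    by (simp add: mu_sum_def sum_distrib_left)
  \<comment> \<open>\<open>N div d\<close> counts the e with d e <= N; regrouping by n = d e
    produces the divisor sum of mu omega^2, that is, g(n).\<close>
  also have "(\<Sum>n=1..N. of_int (?a n) * real (N div n)) = (\<Sum>d=1..N. \<Sum>e=1..N div d. real_of_int (?a d))"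
    by (simp add: mult.commute)
  also have "\<dots> = (\<Sum>n=1..N. \<Sum>d | d dvd n. real_of_int (?a d))"
    by (rule sum_divisors_hyperbola[of "\<lambda>d _. real_of_int (?a d)", symmetric])
  also have "\<dots> = (\<Sum>n=1..N. of_int (omega_conv n))"
  proof (intro sum.cong refl)
    fix n assume "n \<in> {1..N}"
    then have "omega_conv n = (\<Sum>d | d dvd n. ?a d)" by (simp add: sum_moebius_omega_sq)
    then show "(\<Sum>d | d dvd n. real_of_int (?a d)) = of_int (omega_conv n)" by (simp only: of_int_sum)
  qed
  finally show ?thesis by (simp add: N_def)
qed

section \<open>The Dirichlet series of the Moebius function\<close>

lemma moebius_dirichlet_abs_summable:
  assumes "Re s > 1"
  shows "(\<lambda>n. norm (of_int (moebius_mu n) * of_nat n powr (- s) :: complex)) summable_on A"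
proof (rule Infinite_Sum.abs_summable_on_comparison_test[OF dirichlet_abs_summable[OF assms]])
  fix n
  have "norm (of_int (moebius_mu n) :: complex) \<le> 1"
    using abs_moebius_mu_le[of n] by (simp flip: of_int_abs)
  then show "norm (of_int (moebius_mu n) * of_nat n powr (- s) :: complex) \<le> norm (of_nat n powr (- s) :: complex)"
    unfolding norm_mult by (intro mult_left_le_one_le) auto
qed

text \<open>Absolute convergence permits grouping the pairs (a, b) by their product n; the inner sum
  is that of mu over the divisors of n and leaves only n = 1. The index 0 is dropped beforehand,
  because every natural number divides it.\<close>

lemma moebius_dirichlet_inverse:
  assumes s: "Re s > 1"
  shows "(\<Sum>\<^sub>\<infinity>n. of_int (moebius_mu n) * of_nat n powr (- s)) * zeta_sum s = 1"
proof -
  let ?A = "{0::nat<..}"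
  define f where "f = (\<lambda>a b. (of_int (moebius_mu a) * of_nat a powr (- s)) * (of_nat b powr (- s) :: complex))"
  have sm: "(\<lambda>(a, b). f a b) summable_on ?A \<times> ?A"
  proof (rule abs_summable_summable, subst Infinite_Sum.abs_summable_on_Sigma_iff, intro conjI ballI)
    show "(\<lambda>y. norm ((\<lambda>(a, b). f a b) (a, y))) summable_on ?A" for a
      using summable_on_cmult_right[OF dirichlet_abs_summable[OF s]] by (simp add: f_def norm_mult)
    have "(\<Sum>\<^sub>\<infinity>y\<in>?A. norm (f a y)) = norm (of_int (moebius_mu a) * of_nat a powr (- s) :: complex) * (\<Sum>\<^sub>\<infinity>y\<in>?A. norm (of_nat y powr (- s) :: complex))" for a
      unfolding f_def by (subst norm_mult, rule infsum_cmult_right')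
    then show "(\<lambda>x. norm (\<Sum>\<^sub>\<infinity>y\<in>?A. norm ((\<lambda>(a, b). f a b) (x, y)))) summable_on ?A"
      using summable_on_cmult_left[OF moebius_dirichlet_abs_summable[OF s], where c = "\<bar>\<Sum>\<^sub>\<infinity>y\<in>?A. norm (of_nat y powr (- s) :: complex)\<bar>"]
      by (simp add: abs_mult norm_mult)
  qed
  have "(\<Sum>\<^sub>\<infinity>n. of_int (moebius_mu n) * of_nat n powr (- s)) * zeta_sum s = (\<Sum>\<^sub>\<infinity>n\<in>?A. of_int (moebius_mu n) * of_nat n powr (- s)) * (\<Sum>\<^sub>\<infinity>n\<in>?A. of_nat n powr (- s))"
    unfolding zeta_sum_def by (intro arg_cong2[where f = "(*)"] infsum_cong_neutral) auto
  also have "\<dots> = (\<Sum>\<^sub>\<infinity>a\<in>?A. \<Sum>\<^sub>\<infinity>b\<in>?A. f a b)"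
    unfolding f_def by (simp add: infsum_cmult_right' infsum_cmult_left')
  also have "\<dots> = (\<Sum>\<^sub>\<infinity>(a, b)\<in>?A \<times> ?A. f a b)"
    by (rule infsum_Sigma'_banach[OF sm])
  finally have 1: "(\<Sum>\<^sub>\<infinity>n. of_int (moebius_mu n) * of_nat n powr (- s)) * zeta_sum s = (\<Sum>\<^sub>\<infinity>(a, b)\<in>?A \<times> ?A. f a b)" .
  let ?g = "\<lambda>(n, d). of_int (moebius_mu d) * of_nat n powr (- s) :: complex"
  let ?S = "Sigma ?A (\<lambda>n. {d. d dvd n})"
  have bij: "bij_betw (\<lambda>(a, b). (a * b, a)) (?A \<times> ?A) ?S"
    by (rule bij_betw_byWitness[where f' = "\<lambda>(n, d). (d, n div d)"]) (auto simp: dvd_pos_nat elim!: dvdE)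
  have eq: "?g ((\<lambda>(a, b). (a * b, a)) z) = (\<lambda>(a, b). f a b) z" for z
    by (cases z) (simp only: f_def of_nat_powr_mult case_prod_conv mult.assoc)
  have sm2: "?g summable_on ?S"
    using sm summable_on_reindex_bij_betw[OF bij, of ?g] unfolding eq by simp
  have "(\<Sum>\<^sub>\<infinity>(a, b)\<in>?A \<times> ?A. f a b) = infsum ?g ?S"
    using infsum_reindex_bij_betw[OF bij, of ?g] unfolding eq by simp
  also have "\<dots> = (\<Sum>\<^sub>\<infinity>n\<in>?A. \<Sum>\<^sub>\<infinity>d | d dvd n. of_int (moebius_mu d) * of_nat n powr (- s))"
    using sm2 by (intro infsum_Sigma'_banach[symmetric]) simp
  also have "\<dots> = (\<Sum>\<^sub>\<infinity>n\<in>?A. if n = 1 then 1 else 0)"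
  proof (rule infsum_cong)
    fix n :: nat assume n: "n \<in> ?A"
    then have "(\<Sum>\<^sub>\<infinity>d | d dvd n. of_int (moebius_mu d) * of_nat n powr (- s)) = of_int (\<Sum>d | d dvd n. moebius_mu d) * (of_nat n powr (- s) :: complex)"
      by (simp add: sum_distrib_right)
    also have "\<dots> = (if n = 1 then 1 else 0)" using n by (simp add: sum_moebius)
    finally show "(\<Sum>\<^sub>\<infinity>d | d dvd n. of_int (moebius_mu d) * of_nat n powr (- s)) = (if n = 1 then 1 else (0::complex))" .
  qed
  also have "\<dots> = (\<Sum>\<^sub>\<infinity>n\<in>{1::nat}. 1)" by (rule infsum_cong_neutral) auto
  finally show ?thesis using 1 by simp
qed

section \<open>Chebyshev bounds for integers with at most two prime factors\<close>

lemma prod_primes_dvd: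
  fixes n :: nat
  assumes "finite A" "\<And>p. p \<in> A \<Longrightarrow> prime p \<and> p dvd n"
  shows "\<Prod>A dvd n"
  using assms
proof (induction A)
  case (insert p A)
  have "coprime p (\<Prod>A)"
    using insert by (intro prod_coprime_right primes_coprime) auto
  then show ?case using insert by (auto intro: divides_mult)
qed simp

definition theta :: "nat \<Rightarrow> real" where
  "theta N = (\<Sum>p | prime p \<and> p \<le> N. ln (real p))"

lemma finite_primes_le: "finite {p. prime p \<and> p \<le> (N::nat)}"
  by (rule finite_subset[of _ "{..N}"]) auto

text \<open>Every prime in (m, 2m] divides the central binomial coefficient of 2m, which is at most
  4^m.\<close>

lemma theta_double: "theta (2 * m) \<le> theta m + 2 * real m * ln 2"
proof -
  let ?A = "{p. prime p \<and> m < p \<and> p \<le> 2 * m}"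
  have fin: "finite ?A" by (rule finite_subset[of _ "{..2*m}"]) auto
  have "p dvd (2 * m choose m)" if "p \<in> ?A" for p
  proof -
    have "p dvd fact (2 * m)" using that by (subst prime_dvd_fact_iff) auto
    then have "p dvd fact m * fact m * (2 * m choose m)"
      using binomial_fact_lemma[of m "2 * m"] by simp
    moreover have "\<not> p dvd fact m" using that by (subst prime_dvd_fact_iff) auto
    ultimately show ?thesis using that by (auto simp: prime_dvd_mult_iff)
  qed
  then have "\<Prod>?A dvd (2 * m choose m)" using fin by (intro prod_primes_dvd) auto
  then have "\<Prod>?A \<le> (2 * m choose m)" by (rule dvd_imp_le) simp
  also have "\<dots> \<le> 2 ^ (2 * m)" by (rule binomial_le_pow2)
  finally have le: "real (\<Prod>?A) \<le> 2 ^ (2 * m)" by (metis of_nat_le_iff of_nat_numeral of_nat_power)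
  have pos: "real p > 0" if "p \<in> ?A" for p using that by (auto dest: prime_gt_0_nat)
  have "(\<Sum>p\<in>?A. ln (real p)) = ln (\<Prod>p\<in>?A. real p)"
    using fin pos by (intro ln_prod[symmetric]) auto
  also have "\<dots> \<le> ln (2 ^ (2 * m))"
    using le pos by (intro ln_mono prod_pos) (auto simp: of_nat_prod)
  also have "\<dots> = 2 * real m * ln 2" by (simp add: ln_realpow)
  finally have 1: "(\<Sum>p\<in>?A. ln (real p)) \<le> 2 * real m * ln 2" .
  have "{p. prime p \<and> p \<le> 2 * m} = {p. prime p \<and> p \<le> m} \<union> ?A" by auto
  then have "theta (2 * m) = theta m + (\<Sum>p\<in>?A. ln (real p))"
    unfolding theta_def using fin finite_primes_le[of m] by (simp add: sum.union_disjoint disjoint_iff)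
  then show ?thesis using 1 by simp
qed

lemma theta_pow2: "theta (2 ^ k) \<le> 2 ^ k * (2 * ln 2)"
proof (induction k)
  case 0
  have "(\<Sum>p | prime p \<and> p \<le> (2::nat) ^ 0. ln (real p)) = 0" by (rule sum.neutral) (auto dest: prime_gt_1_nat)
  then have "theta (2 ^ 0) = 0" by (simp only: theta_def)
  then show ?case by simp
next
  case (Suc k)
  then show ?case using theta_double[of "2 ^ k"] by (simp add: algebra_simps)
qed

lemma ex_pow2_bounds:
  fixes N :: nat
  assumes "N \<ge> 1"
  obtains J where "2 ^ J \<le> N" "N < 2 ^ Suc J"
proof -
  have "\<exists>J. N < 2 ^ J" using less_exp by blast
  define K where "K = (LEAST J. N < 2 ^ J)"
  have K: "N < 2 ^ K" unfolding K_def using \<open>\<exists>J. N < 2 ^ J\<close> by (rule LeastI_ex)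
  have "K \<noteq> 0" using K assms by (intro notI) simp
  then obtain J where J: "K = Suc J" by (cases K) auto
  have "\<not> N < 2 ^ J" using not_less_Least[of J "\<lambda>J. N < 2 ^ J"] J by (simp add: K_def)
  then show ?thesis using K J that[of J] by simp
qed

text \<open>Rounding N up to a power of two, which is at most 2N, doubles the constant of
  \<open>theta_pow2\<close>.\<close>

lemma theta_le: "theta N \<le> 4 * ln 2 * real N"
proof (cases "N = 0")
  case True
  have "{p. prime p \<and> p \<le> (0::nat)} = {}" by (auto dest: prime_gt_1_nat)
  then show ?thesis using True by (simp add: theta_def)
next
  case False
  then obtain J where J: "2 ^ J \<le> N" "N < 2 ^ Suc J" using ex_pow2_bounds[of N] by auto
  have "theta N \<le> theta (2 ^ Suc J)"
    unfolding theta_def using J by (intro sum_mono2 finite_primes_le) (auto dest: prime_gt_0_nat intro!: ln_ge_zero)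
  also have "\<dots> \<le> 2 ^ Suc J * (2 * ln 2)" by (rule theta_pow2)
  also have "\<dots> = real (2 ^ J) * (4 * ln 2)" by simp
  also have "\<dots> \<le> real N * (4 * ln 2)" using J(1) by (intro mult_right_mono) (auto simp del: of_nat_power)
  finally show ?thesis by (simp add: mult_ac)
qed

section \<open>Prime powers and their reciprocals\<close>

lemma prime_omega_eq_1_E:
  assumes "prime_omega q = 1"
  obtains p a where "prime p" "a \<ge> 1" "q = p ^ a"
proof -
  have "q \<noteq> 0" using assms by (intro notI) (simp add: prime_omega_def)
  obtain p where p: "prime_factors q = {p}" using assms by (auto simp: prime_omega_def card_1_singleton_iff)
  then have "p \<in> prime_factors q" by simp
  then have "prime p" "multiplicity p q > 0" by (auto simp: prime_factors_multiplicity)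
  moreover have "q = p ^ multiplicity p q" using prod_prime_factors[OF \<open>q \<noteq> 0\<close>] p by simp
  ultimately show ?thesis using that[of p "multiplicity p q"] by simp
qed

lemma prime_omega_prime_power: "prime p \<Longrightarrow> a > 0 \<Longrightarrow> prime_omega (p ^ a) = 1"
  by (simp add: prime_omega_def prime_factorization_prime_power)

lemma ln_le_4_root: "x \<ge> 1 \<Longrightarrow> (ln x)\<^sup>2 \<le> 16 * sqrt x"
proof -
  assume x: "x \<ge> 1"
  have "ln x = 4 * ln (x powr (1/4))" using x by (simp add: ln_powr)
  also have "\<dots> \<le> 4 * (x powr (1/4))" using x ln_le_minus_one[of "x powr (1/4)"] by simp
  finally have "(ln x)\<^sup>2 \<le> (4 * (x powr (1/4)))\<^sup>2" using x by (intro power_mono) auto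
  also have "\<dots> = 16 * x powr (1/2)" using x by (simp add: power_mult_distrib powr_power)
  finally show ?thesis using x by (simp add: powr_half_sqrt)
qed

text \<open>Primes are handled by \<open>theta\<close>. A prime power p^a <= N with a >= 2 has p <=
  sqrt N and a <= log_2 N, so there are at most sqrt N log_2 N of these, each contributing at most
  ln N. Finally (ln N)^2 <= 16 sqrt N.\<close>

lemma sum_ln_prime_powers:
  obtains B where "B > 0" "\<And>N. (\<Sum>q | prime_omega q = 1 \<and> q \<le> N. ln (real q)) \<le> B * real N"
proof -
  define B where "B = 4 * ln 2 + 16 / ln (2::real)"
  show ?thesis
  proof
    show "B > 0" by (simp add: B_def add_pos_pos)
    fix N :: nat
    show "(\<Sum>q | prime_omega q = 1 \<and> q \<le> N. ln (real q)) \<le> B * real N"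
    proof (cases "N = 0")
      case True
      have "{q. prime_omega q = 1 \<and> q \<le> (0::nat)} = {}" by (auto simp: prime_omega_def)
      then show ?thesis using True by simp
    next
      case False
      then have N: "N \<ge> 1" by simp
      let ?P = "{p. prime p \<and> p \<le> N}"
      let ?I = "{1..nat \<lfloor>sqrt N\<rfloor>} \<times> {1..nat \<lfloor>log 2 N\<rfloor>}"
      let ?Q = "(\<lambda>(p, a). p ^ a) ` ?I \<inter> {1..N}"
      \<comment> \<open>The rectangle \<open>?I\<close> also contains pairs that yield no prime
        power; only an upper bound for the cardinality is extracted from it.\<close>
      have sub: "{q. prime_omega q = 1 \<and> q \<le> N} \<subseteq> ?P \<union> ?Q"
      proof
        fix q assume q: "q \<in> {q. prime_omega q = 1 \<and> q \<le> N}"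
        then obtain p a where pa: "prime p" "a \<ge> 1" "q = p ^ a" using prime_omega_eq_1_E[of q] by auto
        have p2: "p \<ge> 2" using pa by (simp add: prime_ge_2_nat)
        show "q \<in> ?P \<union> ?Q"
        proof (cases "a = 1")
          case True
          then show ?thesis using pa q by simp
        next
          case False
          then have "p ^ 2 \<le> p ^ a" using pa p2 by (intro power_increasing) auto
          then have "p ^ 2 \<le> N" using q pa by simp
          then have "real p ^ 2 \<le> real N" by (metis of_nat_le_iff of_nat_power)
          then have "real p \<le> sqrt N" using real_le_rsqrt by blast
          then have 1: "p \<le> nat \<lfloor>sqrt N\<rfloor>" by (simp add: le_nat_iff le_floor_iff)
          have "2 ^ a \<le> p ^ a" using p2 by (intro power_mono) auto
          then have "2 ^ a \<le> N" using q pa(3) by (auto intro: order_trans)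
          then have "(2::real) ^ a \<le> real N" by (metis of_nat_le_iff of_nat_power of_nat_numeral)
          then have "real a \<le> log 2 N" by (intro le_log_of_power) auto
          then have 2: "a \<le> nat \<lfloor>log 2 N\<rfloor>" by (simp add: le_nat_iff le_floor_iff)
          have "p \<ge> 1" "q \<ge> 1" using p2 pa by auto
          then have "(p, a) \<in> ?I" using 1 2 pa by simp
          then show ?thesis using pa(3) q \<open>q \<ge> 1\<close> by (intro UnI2 IntI image_eqI[of _ _ "(p, a)"]) auto
        qed
      qed
      have lnpos: "ln (real q) \<ge> 0" for q by (cases "q = 0") auto
      have "(\<Sum>q | prime_omega q = 1 \<and> q \<le> N. ln (real q)) \<le> (\<Sum>q\<in>?P \<union> ?Q. ln (real q))"
        using sub lnpos by (intro sum_mono2) (auto intro: finite_primes_le)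
      also have "\<dots> \<le> (\<Sum>q\<in>?P. ln (real q)) + (\<Sum>q\<in>?Q. ln (real q))"
        using lnpos by (subst sum_Un) (auto intro!: sum_nonneg finite_primes_le)
      also have "(\<Sum>q\<in>?Q. ln (real q)) \<le> real (card ?Q) * ln N"
        using N by (intro sum_bounded_above) auto
      also have "\<dots> \<le> (sqrt N * log 2 N) * ln N"
      proof -
        have "card ?Q \<le> card ((\<lambda>(p, a). p ^ a) ` ?I)" by (intro card_mono) auto
        also have "\<dots> \<le> card ?I" by (intro card_image_le) auto
        also have "\<dots> = nat \<lfloor>sqrt N\<rfloor> * nat \<lfloor>log 2 N\<rfloor>" by (simp add: card_cartesian_product)
        finally have "real (card ?Q) \<le> real (nat \<lfloor>sqrt N\<rfloor>) * real (nat \<lfloor>log 2 N\<rfloor>)"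
          by (metis of_nat_le_iff of_nat_mult)
        also have "\<dots> \<le> sqrt N * log 2 N"
          using N by (intro mult_mono) auto
        finally show ?thesis using N by (intro mult_right_mono) auto
      qed
      also have "\<dots> = sqrt N * (ln N)\<^sup>2 / ln 2" by (simp add: log_def power2_eq_square)
      also have "\<dots> \<le> sqrt N * (16 * sqrt N) / ln 2"
        using N by (intro divide_right_mono mult_left_mono ln_le_4_root) auto
      also have "\<dots> = 16 / ln 2 * N" by simp
      finally have "(\<Sum>q | prime_omega q = 1 \<and> q \<le> N. ln (real q)) \<le> theta N + 16 / ln 2 * N"
        by (simp add: theta_def)
      then show ?thesis using theta_le[of N] by (simp add: B_def algebra_simps)
    qed
  qed
qed

lemma prime_omega_pos_ge_2: "prime_omega n > 0 \<Longrightarrow> n \<ge> 2"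
  by (cases "n = 0 \<or> n = 1") (auto simp: prime_omega_def)

text \<open>On (2^j, 2^(j+1)] one has 1/q <= 2^(-j) <= 2^(-j) ln q / (j ln 2). This takes the place
  of partial summation when passing from weights ln q to weights 1/q.\<close>

lemma dyadic_reciprocal_bound:
  fixes S :: "nat set"
  assumes j: "j \<ge> 1" and b: "(\<Sum>q | q \<in> S \<and> q \<le> 2 ^ Suc j. ln (real q)) \<le> b * 2 ^ Suc j"
  shows "(\<Sum>q | q \<in> S \<and> 2 ^ j < q \<and> q \<le> 2 ^ Suc j. 1 / real q) \<le> 2 * b / (real j * ln 2)"
proof -
  let ?D = "{q \<in> S. 2 ^ j < q \<and> q \<le> 2 ^ Suc j}"
  have fin: "finite {q \<in> S. q \<le> 2 ^ Suc j}" by (rule finite_subset[of _ "{..2 ^ Suc j}"]) auto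
  have jl: "0 < real j * ln 2" using j by simp
  have "(\<Sum>q\<in>?D. 1 / real q) \<le> (\<Sum>q\<in>?D. ln (real q) / (2 ^ j * (real j * ln 2)))"
  proof (intro sum_mono)
    fix q assume q: "q \<in> ?D"
    then have q1: "(2::real) ^ j \<le> real q" by (metis (mono_tags, lifting) less_imp_le mem_Collect_eq numeral_power_le_of_nat_cancel_iff)
    have "real j * ln 2 = ln (2 ^ j)" by (simp add: ln_realpow)
    also have "\<dots> \<le> ln (real q)" using q1 by (intro ln_mono) auto
    finally have l: "real j * ln 2 \<le> ln (real q)" .
    have qp: "real q > 0" using q1 by (smt (verit) zero_less_power)
    have "1 / real q \<le> 1 / 2 ^ j" using q1 qp by (intro divide_left_mono) auto
    also have "\<dots> = (real j * ln 2) / (2 ^ j * (real j * ln 2))" using j by (simp add: field_simps)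
    also have "\<dots> \<le> ln (real q) / (2 ^ j * (real j * ln 2))" using l jl by (intro divide_right_mono) auto
    finally show "1 / real q \<le> ln (real q) / (2 ^ j * (real j * ln 2))" .
  qed
  also have "\<dots> = (\<Sum>q\<in>?D. ln (real q)) / (2 ^ j * (real j * ln 2))" by (simp add: sum_divide_distrib)
  also have "\<dots> \<le> (\<Sum>q | q \<in> S \<and> q \<le> 2 ^ Suc j. ln (real q)) / (2 ^ j * (real j * ln 2))"
  proof -
    have "ln (real q) \<ge> 0" for q :: nat by (cases "q = 0") auto
    then show ?thesis using jl fin by (intro divide_right_mono sum_mono2) auto
  qed
  also have "\<dots> \<le> b * 2 ^ Suc j / (2 ^ j * (real j * ln 2))" using b jl by (intro divide_right_mono) auto
  also have "\<dots> = 2 * b / (real j * ln 2)" by simp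
  finally show ?thesis by simp
qed

lemma harm_mono': "m \<le> n \<Longrightarrow> harm m \<le> (harm n :: real)"
  unfolding harm_def by (intro sum_mono2) auto

lemma harm_ge_1: "n \<ge> 1 \<Longrightarrow> (harm n :: real) \<ge> 1"
  using harm_mono'[of 1 n] by (simp add: harm_def)

lemma harm_le_ln: "n \<ge> 1 \<Longrightarrow> (harm n :: real) \<le> 1 + ln n"
  using decseq_harm_diff_ln[unfolded decseq_def, rule_format, of 0 "n - 1"] by (simp add: harm_def)

text \<open>Each dyadic block contributes O(1/j), and summing over the blocks gives the harmonic
  number \<open>harm J\<close>, which plays the role of log log N.\<close>

lemma sum_reciprocal_prime_powers:
  obtains B where "B > 0" "\<And>J N. J \<ge> 1 \<Longrightarrow> N \<le> 2 ^ J \<Longrightarrow> (\<Sum>q | prime_omega q = 1 \<and> q \<le> N. 1 / real q) \<le> B * harm J"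
proof -
  obtain B where B: "B > 0" "\<And>N. (\<Sum>q | prime_omega q = 1 \<and> q \<le> N. ln (real q)) \<le> B * real N"
    using sum_ln_prime_powers by blast
  have fin: "finite {q. prime_omega q = 1 \<and> q \<le> N}" for N by (rule finite_subset[of _ "{..N}"]) auto
  define C where "C = 1 + 2 * B / ln 2"
  have C: "C \<ge> 1" "C \<ge> 2 * B / ln 2" using B by (auto simp: C_def)
  have main: "(\<Sum>q | prime_omega q = 1 \<and> q \<le> 2 ^ Suc J. 1 / real q) \<le> 2 * C * harm (Suc J)" for J
  proof (induction J)
    case 0
    have "(\<Sum>q | prime_omega q = 1 \<and> q \<le> 2 ^ Suc 0. 1 / real q) \<le> (\<Sum>q\<in>{2::nat}. 1 / real q)"
    proof (rule sum_mono2)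
      show "{q. prime_omega q = 1 \<and> q \<le> 2 ^ Suc 0} \<subseteq> {2}"
      proof
        fix q assume "q \<in> {q. prime_omega q = 1 \<and> q \<le> 2 ^ Suc 0}"
        then show "q \<in> {2}" using prime_omega_pos_ge_2[of q] by simp
      qed
    qed auto
    then show ?case using C by (simp add: harm_def)
  next
    case (Suc J)
    let ?j = "Suc J"
    have split: "{q. prime_omega q = 1 \<and> q \<le> 2 ^ Suc ?j} = {q. prime_omega q = 1 \<and> q \<le> 2 ^ ?j} \<union> {q. q \<in> {q. prime_omega q = 1} \<and> 2 ^ ?j < q \<and> q \<le> 2 ^ Suc ?j}"
      using power_increasing[of ?j "Suc ?j" "2::nat"] by auto
    have "(\<Sum>q | prime_omega q = 1 \<and> q \<le> 2 ^ Suc ?j. 1 / real q) = (\<Sum>q | prime_omega q = 1 \<and> q \<le> 2 ^ ?j. 1 / real q) + (\<Sum>q | q \<in> {q. prime_omega q = 1} \<and> 2 ^ ?j < q \<and> q \<le> 2 ^ Suc ?j. 1 / real q)"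
      unfolding split by (rule sum.union_disjoint) (auto intro: fin finite_subset[OF _ fin[of "2 ^ Suc ?j"]])
    also have "(\<Sum>q | q \<in> {q. prime_omega q = 1} \<and> 2 ^ ?j < q \<and> q \<le> 2 ^ Suc ?j. 1 / real q) \<le> 2 * B / (real ?j * ln 2)"
      using B(2)[of "2 ^ Suc ?j"] by (intro dyadic_reciprocal_bound) auto
    also have "\<dots> = (2 * B / ln 2) * (1 / real ?j)" by simp
    also have "\<dots> \<le> (2 * C) * (1 / real (Suc ?j))"
    proof -
      \<comment> \<open>The loss of a factor 2 turns 1/j into the next term 1/(j+1) of the harmonic
        number.\<close>
      have "1 / real ?j \<le> 2 / real (Suc ?j)" by (simp add: field_simps)
      then have "(2 * B / ln 2) * (1 / real ?j) \<le> C * (2 / real (Suc ?j))" using C B by (intro mult_mono) auto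
      then show ?thesis by (simp add: mult.commute)
    qed
    finally show ?case using Suc.IH by (simp add: harm_Suc algebra_simps inverse_eq_divide)
  qed
  show ?thesis
  proof
    show "2 * C > 0" using C by simp
    fix J N :: nat assume "J \<ge> 1" "N \<le> 2 ^ J"
    then obtain i where i: "J = Suc i" by (cases J) auto
    have "(\<Sum>q | prime_omega q = 1 \<and> q \<le> N. 1 / real q) \<le> (\<Sum>q | prime_omega q = 1 \<and> q \<le> 2 ^ Suc i. 1 / real q)"
      using \<open>N \<le> 2 ^ J\<close> i by (intro sum_mono2 fin) auto
    also have "\<dots> \<le> 2 * C * harm (Suc i)" by (rule main)
    finally show "(\<Sum>q | prime_omega q = 1 \<and> q \<le> N. 1 / real q) \<le> 2 * C * harm J" by (simp add: i)
  qed
qed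

section \<open>Integers with one or two prime factors\<close>

lemma prime_omega_eq_2_E:
  assumes "prime_omega m = 2"
  obtains q r where "prime_omega q = 1" "prime_omega r = 1" "m = q * r"
proof -
  have "m \<noteq> 0" using assms by (intro notI) (simp add: prime_omega_def)
  obtain p1 p2 where p: "prime_factors m = {p1, p2}" "p1 \<noteq> p2"
    using assms by (auto simp: prime_omega_def card_2_iff)
  then have "p1 \<in> prime_factors m" "p2 \<in> prime_factors m" by auto
  then have 1: "prime p1" "multiplicity p1 m > 0" "prime p2" "multiplicity p2 m > 0"
    by (auto simp: prime_factors_multiplicity)
  have "m = p1 ^ multiplicity p1 m * p2 ^ multiplicity p2 m"
    using prod_prime_factors[OF \<open>m \<noteq> 0\<close>] p by simp
  then show ?thesis using that 1 prime_omega_prime_power by blast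
qed

text \<open>An integer with two prime factors is a product q r of prime powers, and ln m = ln q + ln
  r. By symmetry the sum is at most twice that of ln r over q r <= N; the inner sum over r is O(N/q)
  by Chebyshev, and the sum of 1/q is O(\<open>harm J\<close>).\<close>

lemma sum_ln_omega_2:
  obtains B where "B > 0" "\<And>J N. J \<ge> 1 \<Longrightarrow> N \<le> 2 ^ J \<Longrightarrow>
    (\<Sum>m | m \<in> {m. prime_omega m = 1 \<or> prime_omega m = 2} \<and> m \<le> N. ln (real m)) \<le> B * harm J * real N"
proof -
  obtain B where B: "B > 0" "\<And>N. (\<Sum>q | prime_omega q = 1 \<and> q \<le> N. ln (real q)) \<le> B * real N"
    using sum_ln_prime_powers by blast
  obtain E where E: "E > 0" "\<And>J N. J \<ge> 1 \<Longrightarrow> N \<le> 2 ^ J \<Longrightarrow> (\<Sum>q | prime_omega q = 1 \<and> q \<le> N. 1 / real q) \<le> E * harm J"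
    using sum_reciprocal_prime_powers by blast
  have fin: "finite {q. R q \<and> q \<le> N}" for N :: nat and R by (rule finite_subset[of _ "{..N}"]) auto
  show ?thesis
  proof
    show "B + 2 * B * E > 0" using B E by (simp add: add_pos_pos)
    fix J N :: nat assume J: "J \<ge> 1" "N \<le> 2 ^ J"
    define Q where "Q = (\<lambda>N. {q. prime_omega q = 1 \<and> q \<le> N})"
    have Q: "finite (Q M)" "q \<in> Q M \<Longrightarrow> q \<ge> 1" for M q
      using fin[of "\<lambda>q. prime_omega q = 1"] prime_omega_pos_ge_2[of q] by (auto simp: Q_def)
    let ?I = "Sigma (Q N) (\<lambda>q. Q (N div q))"
    have finI: "finite ?I" using Q by (intro finite_SigmaI) auto
    have lnpos: "ln (real q) \<ge> 0" for q by (cases "q = 0") auto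
    have img: "{m. prime_omega m = 2 \<and> m \<le> N} \<subseteq> (\<lambda>(q, r). q * r) ` ?I"
    proof
      fix m assume m: "m \<in> {m. prime_omega m = 2 \<and> m \<le> N}"
      then obtain q r where qr: "prime_omega q = 1" "prime_omega r = 1" "m = q * r"
        using prime_omega_eq_2_E[of m] by auto
      have "q \<ge> 2" "r \<ge> 2" using qr prime_omega_pos_ge_2 by auto
      then have "q \<le> q * r" by simp
      also have "q * r \<le> N" using m qr by simp
      finally have "q \<le> N" .
      moreover have "r \<le> N div q"
        using m qr \<open>q \<ge> 2\<close> by (auto simp: less_eq_div_iff_mult_less_eq mult.commute)
      ultimately show "m \<in> (\<lambda>(q, r). q * r) ` ?I"
        using qr by (intro image_eqI[of _ _ "(q, r)"]) (auto simp: Q_def)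
    qed
    have "(\<Sum>m | prime_omega m = 2 \<and> m \<le> N. ln (real m)) \<le> (\<Sum>m\<in>(\<lambda>(q, r). q * r) ` ?I. ln (real m))"
      using img finI lnpos by (intro sum_mono2) auto
    \<comment> \<open>Multiplication is not injective on the pairs, but the terms are nonnegative,
      so counting an integer several times only enlarges the sum.\<close>
    also have "\<dots> \<le> sum ((\<lambda>m. ln (real m)) \<circ> (\<lambda>(q, r). q * r)) ?I"
      by (rule sum_image_le[OF finI]) (rule lnpos)
    also have "\<dots> = (\<Sum>(q, r)\<in>?I. ln (real (q * r)))"
      by (simp add: o_def case_prod_beta)
    also have "\<dots> = (\<Sum>(q, r)\<in>?I. ln (real q) + ln (real r))"
      using Q(2) by (intro sum.cong refl) (auto simp: ln_mult dest!: Q(2))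
    also have "\<dots> = (\<Sum>(q, r)\<in>?I. ln (real q)) + (\<Sum>(q, r)\<in>?I. ln (real r))"
      by (simp add: sum.distrib case_prod_beta)
    \<comment> \<open>The region q r <= N is symmetric in q and r, although \<open>?I\<close>
      presents it with the range of r depending on q.\<close>
    also have "(\<Sum>(q, r)\<in>?I. ln (real q)) = (\<Sum>(q, r)\<in>?I. ln (real r))"
    proof -
      have sw: "(r, q) \<in> ?I" if "(q, r) \<in> ?I" for q r
      proof -
        have qr: "prime_omega q = 1" "prime_omega r = 1" "r \<le> N div q"
          using that by (auto simp: Q_def)
        have "q \<ge> 2" "r \<ge> 2" using qr prime_omega_pos_ge_2 by auto
        then have q: "q \<ge> 1" "r \<ge> 1" "q * r \<le> N" "prime_omega q = 1" "prime_omega r = 1"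
          using qr by (auto simp: less_eq_div_iff_mult_less_eq mult.commute)
        have "r \<le> q * r" using q(1) by simp
        also note q(3)
        finally have "r \<le> N" .
        then show ?thesis using q by (auto simp: Q_def less_eq_div_iff_mult_less_eq mult.commute)
      qed
      show ?thesis
      proof (rule sum.reindex_bij_witness[where i = prod.swap and j = prod.swap])
        fix z assume "z \<in> ?I"
        then show "prod.swap z \<in> ?I" by (cases z) (simp only: prod.swap_def fst_conv snd_conv sw)
        then show "prod.swap z \<in> ?I" .
      qed (simp_all add: case_prod_beta)
    qed
    also have "(\<Sum>(q, r)\<in>?I. ln (real r)) = (\<Sum>q\<in>Q N. \<Sum>r\<in>Q (N div q). ln (real r))"
      using Q by (intro sum.Sigma[symmetric]) auto
    also have "\<dots> \<le> (\<Sum>q\<in>Q N. B * (real N * (1 / real q)))"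
    proof (intro sum_mono)
      fix q assume "q \<in> Q N"
      have "(\<Sum>r\<in>Q (N div q). ln (real r)) \<le> B * real (N div q)" unfolding Q_def by (rule B)
      also have "real (N div q) \<le> real N / real q" by (rule of_nat_div_le_of_nat)
      finally show "(\<Sum>r\<in>Q (N div q). ln (real r)) \<le> B * (real N * (1 / real q))" using B by simp
    qed
    also have "\<dots> = B * real N * (\<Sum>q\<in>Q N. 1 / real q)"
      by (simp add: sum_distrib_left mult.assoc)
    also have "\<dots> \<le> B * real N * (E * harm J)"
      unfolding Q_def using B J by (intro mult_left_mono E) auto
    finally have 2: "(\<Sum>m | prime_omega m = 2 \<and> m \<le> N. ln (real m)) \<le> 2 * B * E * harm J * real N"
      by (simp add: mult_ac)
    have "B * real N * 1 \<le> B * real N * harm J"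
      using B harm_ge_1[OF J(1)] by (intro mult_left_mono) auto
    then have 1: "(\<Sum>m | prime_omega m = 1 \<and> m \<le> N. ln (real m)) \<le> B * harm J * real N"
      using B(2)[of N] by (simp add: mult_ac)
    have "{m. m \<in> {m. prime_omega m = 1 \<or> prime_omega m = 2} \<and> m \<le> N} = {m. prime_omega m = 1 \<and> m \<le> N} \<union> {m. prime_omega m = 2 \<and> m \<le> N}"
      by auto
    then have "(\<Sum>m | m \<in> {m. prime_omega m = 1 \<or> prime_omega m = 2} \<and> m \<le> N. ln (real m)) =
      (\<Sum>m | prime_omega m = 1 \<and> m \<le> N. ln (real m)) + (\<Sum>m | prime_omega m = 2 \<and> m \<le> N. ln (real m))"
      using fin[of "\<lambda>q. prime_omega q = 1"] fin[of "\<lambda>q. prime_omega q = 2"] by (simp add: sum.union_disjoint disjoint_iff)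
    then show "(\<Sum>m | m \<in> {m. prime_omega m = 1 \<or> prime_omega m = 2} \<and> m \<le> N. ln (real m)) \<le> (B + 2 * B * E) * harm J * real N"
      using 1 2 by (simp add: algebra_simps)
  qed
qed

section \<open>Reduction to a bound for the partial sums of $\mu(n)/n$\<close>

text \<open>The exponent above 1 is what keeps this at O(1/J): the sum of k^(-8/7) converges,
  whereas 1/(i k) summed over i + k = J + 2 has the order (log J)/J.\<close>

lemma dyadic_convolution_bound:
  obtains K where "K > 0" "\<And>J. (\<Sum>j<Suc J. 1 / real (j + 1) * real (J - j + 1) powr (- 8/7)) \<le> K / real (J + 2)"
proof -
  let ?u = "\<lambda>n. real (Suc n) powr (- 8/7)"
  have sm: "summable ?u" by (rule summable_Suc_powr) simp
  define K where "K = 3 * suminf ?u"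
  have "suminf ?u > 0" using sm by (intro suminf_pos) auto
  show ?thesis
  proof
    show "K > 0" using \<open>suminf ?u > 0\<close> by (simp add: K_def)
    fix J :: nat
    \<comment> \<open>With $i = j+1$ and $k = J-j+1$, $i + k = J + 2$ and $i^{-1} k^{-1/7} \le i^{-8/7} + k^{-8/7}$.\<close>
    have "(\<Sum>j<Suc J. real (J + 2) * (1 / real (j + 1) * real (J - j + 1) powr (- 8/7))) \<le> (\<Sum>j<Suc J. ?u j + 2 * ?u (Suc J - Suc j))"
    proof (intro sum_mono)
      fix j assume "j \<in> {..<Suc J}"
      define i where "i = real (j + 1)"
      define k where "k = real (J - j + 1)"
      have ik: "i \<ge> 1" "k \<ge> 1" "real (J + 2) = i + k" using \<open>j \<in> _\<close> by (auto simp: i_def k_def of_nat_diff)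
      have "k powr (- 8/7) * k = k powr (- 1/7)" using ik by (simp add: powr_mult_base mult.commute)
      then have "(i + k) * (1 / i * k powr (- 8/7)) = k powr (- 8/7) + 1 / i * k powr (- 1/7)"
        using ik by (simp add: field_simps)
      also have "1 / i * k powr (- 1/7) \<le> i powr (- 8/7) + k powr (- 8/7)"
      proof (cases "i \<le> k")
        case True
        have "1 / i * k powr (- 1/7) \<le> 1 / i * i powr (- 1/7)"
          using True ik by (intro mult_left_mono powr_mono2') auto
        also have "\<dots> = i powr (- 8/7)"
        proof -
          have "1 / i = i powr (- 1)" using ik by (simp add: powr_minus_divide)
          moreover have "i powr (- 1) * i powr (- 1/7) = i powr (- 8/7)" by (subst powr_add[symmetric]) simp
          ultimately show ?thesis by (simp only:)
        qed
        finally show ?thesis by (smt (verit) powr_ge_zero)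
      next
        case False
        have "1 / i * k powr (- 1/7) \<le> 1 / k * k powr (- 1/7)"
          using False ik by (intro mult_right_mono divide_left_mono) auto
        also have "\<dots> = k powr (- 8/7)"
        proof -
          have "1 / k = k powr (- 1)" using ik by (simp add: powr_minus_divide)
          moreover have "k powr (- 1) * k powr (- 1/7) = k powr (- 8/7)" by (subst powr_add[symmetric]) simp
          ultimately show ?thesis by (simp only:)
        qed
        finally show ?thesis by (smt (verit) powr_ge_zero)
      qed
      finally have "(i + k) * (1 / i * k powr (- 8/7)) \<le> i powr (- 8/7) + 2 * k powr (- 8/7)" by simp
      then show "real (J + 2) * (1 / real (j + 1) * real (J - j + 1) powr (- 8/7)) \<le> ?u j + 2 * ?u (Suc J - Suc j)"
        unfolding ik(3) by (simp add: i_def k_def add.commute)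
    qed
    also have "\<dots> = (\<Sum>j<Suc J. ?u j) + 2 * (\<Sum>j<Suc J. ?u (Suc J - Suc j))"
      by (simp only: sum.distrib sum_distrib_left)
    also have "(\<Sum>j<Suc J. ?u (Suc J - Suc j)) = (\<Sum>j<Suc J. ?u j)"
      by (rule sum.nat_diff_reindex)
    also have "(\<Sum>j<Suc J. ?u j) + 2 * (\<Sum>j<Suc J. ?u j) \<le> K"
      using sum_le_suminf[OF sm, of "{..<Suc J}"] by (simp add: K_def)
    finally have "real (J + 2) * (\<Sum>j<Suc J. 1 / real (j + 1) * real (J - j + 1) powr (- 8/7)) \<le> K"
      by (simp only: sum_distrib_left)
    then show "(\<Sum>j<Suc J. 1 / real (j + 1) * real (J - j + 1) powr (- 8/7)) \<le> K / real (J + 2)"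
      by (simp only: pos_le_divide_eq of_nat_0_less_iff mult.commute)
  qed
qed

text \<open>The weights ln n are exchanged for weight 1 by splitting at sqrt N: beyond it ln n >=
  (ln N)/2, and up to it there are at most sqrt N integers, which is O(N / ln N).\<close>

lemma sum_abs_omega_conv_bound:
  obtains C where "C > 0" "\<And>J N. J \<ge> 1 \<Longrightarrow> 2 ^ J \<le> N \<Longrightarrow> N < 2 ^ Suc J \<Longrightarrow>
    (\<Sum>n=1..N. \<bar>of_int (omega_conv n)\<bar>) \<le> C * real N * harm (Suc J) / real J"
proof -
  let ?S = "{m. prime_omega m = 1 \<or> prime_omega m = 2}"
  obtain B where B: "B > 0" "\<And>J N. J \<ge> 1 \<Longrightarrow> N \<le> 2 ^ J \<Longrightarrow>
    (\<Sum>m | m \<in> ?S \<and> m \<le> N. ln (real m)) \<le> B * harm J * real N"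
    using sum_ln_omega_2 by blast
  show ?thesis
  proof
    show "(4 + 4 * B) / ln 2 > 0" using B by simp
    fix J N :: nat assume J: "J \<ge> 1" "2 ^ J \<le> N" "N < 2 ^ Suc J"
    have "(2::nat) ^ 1 \<le> 2 ^ J" using J(1) by (intro power_increasing) auto
    then have N: "N \<ge> 2" using J by simp
    have lnN: "ln N > 0" using N by simp
    have fin: "finite {m. m \<in> ?S \<and> m \<le> N}" by (rule finite_subset[of _ "{..N}"]) auto
    let ?R = "nat \<lfloor>sqrt N\<rfloor>"
    have "(\<Sum>n=1..N. \<bar>of_int (omega_conv n)\<bar>) \<le> (\<Sum>n=1..N. if n \<in> ?S then 2 else 0 :: real)"
    proof (intro sum_mono)
      fix n
      show "\<bar>real_of_int (omega_conv n)\<bar> \<le> (if n \<in> ?S then 2 else 0 :: real)" by (auto simp: omega_conv_def)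
    qed
    \<comment> \<open>The coefficient 4 / ln N is the bound 2 for |g| times 2 / ln N, as 1 <= 2 ln n
      / ln N beyond sqrt N.\<close>
    also have "\<dots> \<le> (\<Sum>n=1..N. 2 * (if n \<le> ?R then 1 else 0) + 4 / ln N * (if n \<in> ?S then ln (real n) else 0))"
    proof (intro sum_mono)
      fix n assume n: "n \<in> {1..N}"
      then have l0: "0 \<le> ln (real n)" by simp
      show "(if n \<in> ?S then 2 else 0) \<le> 2 * (if n \<le> ?R then 1 else 0) + 4 / ln N * (if n \<in> ?S then ln (real n) else 0)"
      proof (cases "n \<le> ?R \<or> n \<notin> ?S")
        case True
        then show ?thesis using l0 lnN by auto
      next
        case False
        then have "sqrt N \<le> real n" by (simp add: le_nat_iff le_floor_iff)
        then have "ln (sqrt N) \<le> ln (real n)" using N by (intro ln_mono) auto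
        then have "ln N \<le> 2 * ln (real n)" using N by (simp add: ln_sqrt)
        then show ?thesis using False lnN by (simp add: field_simps)
      qed
    qed
    also have "\<dots> = 2 * (\<Sum>n=1..N. if n \<le> ?R then 1 else 0) + 4 / ln N * (\<Sum>n=1..N. if n \<in> ?S then ln (real n) else 0)"
      by (simp only: sum.distrib sum_distrib_left)
    also have "(\<Sum>n=1..N. if n \<le> ?R then 1 else 0 :: real) \<le> sqrt N"
    proof -
      have "(\<Sum>n=1..N. if n \<le> ?R then 1 else 0 :: real) = real (card {n \<in> {1..N}. n \<le> ?R})"
        by (simp flip: sum.inter_filter)
      also have "\<dots> \<le> real (card {1..?R})" by (intro of_nat_mono card_mono) auto
      also have "\<dots> \<le> sqrt N" using N by simp
      finally show ?thesis .
    qed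
    also have "(\<Sum>n=1..N. if n \<in> ?S then ln (real n) else 0) \<le> B * harm (Suc J) * real N"
    proof -
      have "(\<Sum>n=1..N. if n \<in> ?S then ln (real n) else 0) = (\<Sum>n | n \<in> {1..N} \<and> n \<in> ?S. ln (real n))"
        by (simp flip: sum.inter_filter)
      also have "\<dots> = (\<Sum>m | m \<in> ?S \<and> m \<le> N. ln (real m))"
      proof (intro sum.cong refl set_eqI iffI)
        fix m assume m: "m \<in> {m \<in> ?S. m \<le> N}"
        then have "m \<ge> 2" using prime_omega_pos_ge_2[of m] by auto
        then show "m \<in> {n \<in> {1..N}. n \<in> ?S}" using m by simp
      qed auto
      also have "\<dots> \<le> B * harm (Suc J) * real N" using J by (intro B) auto
      finally show ?thesis .
    qed
    finally have 1: "(\<Sum>n=1..N. \<bar>of_int (omega_conv n)\<bar>) \<le> 2 * sqrt N + 4 / ln N * (B * harm (Suc J) * real N)"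
      using lnN by (simp add: mult_left_mono divide_right_mono)
    have "ln N = 2 * ln (sqrt N)" using N by (simp add: ln_sqrt)
    also have "\<dots> \<le> 2 * sqrt N" using N ln_le_minus_one[of "sqrt N"] by simp
    finally have "sqrt N * ln N \<le> sqrt N * (2 * sqrt N)" by (intro mult_left_mono) auto
    also have "\<dots> = 2 * real N" by simp
    finally have 2: "2 * sqrt N \<le> 4 * real N / ln N" using lnN by (simp add: field_simps)
    have "4 * real N / ln N * 1 \<le> 4 * real N / ln N * harm (Suc J)"
      using harm_ge_1[of "Suc J"] lnN by (intro mult_left_mono) auto
    then have "(\<Sum>n=1..N. \<bar>of_int (omega_conv n)\<bar>) \<le> (4 + 4 * B) * real N * harm (Suc J) / ln N"
      using 1 2 by (simp add: add_divide_distrib algebra_simps)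
    also have "\<dots> \<le> (4 + 4 * B) * real N * harm (Suc J) / (real J * ln 2)"
    proof -
      have "real J * ln 2 = ln (2 ^ J)" by (simp add: ln_realpow)
      also have "\<dots> \<le> ln N" using J(2) by (intro ln_mono) (auto simp: numeral_power_le_of_nat_cancel_iff)
      finally have "real J * ln 2 \<le> ln N" .
      then show ?thesis using B J harm_ge_1[of "Suc J"] lnN by (intro divide_left_mono) auto
    qed
    finally show "(\<Sum>n=1..N. \<bar>of_int (omega_conv n)\<bar>) \<le> (4 + 4 * B) / ln 2 * real N * harm (Suc J) / real J"
      by (simp add: mult_ac)
  qed
qed

text \<open>The harmonic factor is taken at J for all blocks j <= J, so that it can be pulled out of
  the convolution over j. The block j = 0 contains only the integer 2 and is bounded directly, since
  there the lower bound j ln 2 for the logarithm is 0.\<close>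

lemma dyadic_block_bound:
  obtains C where "C > 0" "\<And>J j. j \<le> J \<Longrightarrow>
    (\<Sum>q | q \<in> {m. prime_omega m = 1 \<or> prime_omega m = 2} \<and> 2 ^ j < q \<and> q \<le> 2 ^ Suc j. 1 / real q) \<le> C * harm (Suc J) / real (j + 1)"
proof -
  let ?S = "{m. prime_omega m = 1 \<or> prime_omega m = 2}"
  obtain B where B: "B > 0" "\<And>J N. J \<ge> 1 \<Longrightarrow> N \<le> 2 ^ J \<Longrightarrow>
    (\<Sum>m | m \<in> ?S \<and> m \<le> N. ln (real m)) \<le> B * harm J * real N"
    using sum_ln_omega_2 by blast
  define C where "C = 1 + 4 * B / ln 2"
  have C: "C \<ge> 1" "C \<ge> 4 * B / ln 2" using B by (auto simp: C_def)
  show ?thesis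
  proof
    show "C > 0" using C by simp
    fix J j :: nat assume j: "j \<le> J"
    have h1: "harm (Suc J) \<ge> (1::real)" by (rule harm_ge_1) simp
    show "(\<Sum>q | q \<in> ?S \<and> 2 ^ j < q \<and> q \<le> 2 ^ Suc j. 1 / real q) \<le> C * harm (Suc J) / real (j + 1)"
    proof (cases "j = 0")
      case True
      have "(\<Sum>q | q \<in> ?S \<and> 2 ^ j < q \<and> q \<le> 2 ^ Suc j. 1 / real q) \<le> (\<Sum>q\<in>{2::nat}. 1 / real q)"
        using True by (intro sum_mono2) auto
      also have "\<dots> \<le> 1 * 1" by simp
      also have "\<dots> \<le> C * harm (Suc J)" using C h1 by (intro mult_mono) auto
      finally show ?thesis using True by simp
    next
      case False
      have "(2::nat) ^ Suc j \<le> 2 ^ Suc J" using j by (intro power_increasing) auto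
      from B(2)[OF _ this] have "(\<Sum>m | m \<in> ?S \<and> m \<le> 2 ^ Suc j. ln (real m)) \<le> (B * harm (Suc J)) * 2 ^ Suc j" by simp
      then have "(\<Sum>q | q \<in> ?S \<and> 2 ^ j < q \<and> q \<le> 2 ^ Suc j. 1 / real q) \<le> 2 * (B * harm (Suc J)) / (real j * ln 2)"
        using False by (intro dyadic_reciprocal_bound) auto
      also have "\<dots> = (2 * B / ln 2 * harm (Suc J)) * (1 / real j)" by (simp add: mult.commute)
      also have "\<dots> \<le> (2 * B / ln 2 * harm (Suc J)) * (2 / real (j + 1))"
        using False B h1 by (intro mult_left_mono) (auto simp: field_simps)
      also have "\<dots> = (4 * B / ln 2) * (harm (Suc J) / real (j + 1))" by simp
      also have "\<dots> \<le> C * (harm (Suc J) / real (j + 1))" using C h1 by (intro mult_right_mono) auto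
      finally show ?thesis by simp
    qed
  qed
qed

text \<open>For d in the j-th block with j < J one has N div d >= 2^(J-j-1), so 1 + ln (N div d) is
  at least half of J - j + 1; for j = J the summand 1 alone suffices. The factor 4 absorbs
  2^(8/7).\<close>

lemma mu_sum_block:
  assumes C: "C \<ge> 0" "\<And>M. M \<ge> 1 \<Longrightarrow> \<bar>mu_sum M\<bar> \<le> C * (1 + ln (real M)) powr (- 8/7)"
    and J: "2 ^ J \<le> N" and j: "j \<le> J" and d: "d \<ge> 1" "d \<le> 2 ^ Suc j" "d \<le> N"
  shows "\<bar>mu_sum (N div d)\<bar> \<le> 4 * C * real (J - j + 1) powr (- 8/7)"
proof -
  let ?M = "N div d"
  let ?k = "J - j + 1"
  have M1: "?M \<ge> 1" using d by (simp add: less_eq_div_iff_mult_less_eq)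
  have "real ?k / 2 \<le> 1 + ln (real ?M)"
  proof (cases "j = J")
    case True
    then show ?thesis using M1 by (simp add: order_trans[OF _ add_increasing2])
  next
    case False
    then have jJ: "j < J" using j by simp
    have "2 ^ (J - Suc j) * d \<le> 2 ^ (J - Suc j) * 2 ^ Suc j" using d by simp
    also have "\<dots> = (2::nat) ^ J" using jJ by (subst power_add[symmetric]) simp
    also have "\<dots> \<le> N" by (rule J)
    finally have "2 ^ (J - Suc j) \<le> ?M" using d by (simp add: less_eq_div_iff_mult_less_eq)
    then have "(2::real) ^ (J - Suc j) \<le> real ?M" by (simp add: numeral_power_le_of_nat_cancel_iff)
    then have "ln (2 ^ (J - Suc j)) \<le> ln (real ?M)" by (intro ln_mono) auto
    then have "real (J - Suc j) * ln 2 \<le> ln (real ?M)" by (simp add: ln_realpow)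
    moreover have "real (J - Suc j) * (1/2) \<le> real (J - Suc j) * ln 2"
      using ln2_ge_two_thirds by (intro mult_left_mono) auto
    moreover have "real ?k = real (J - Suc j) + 2" using jJ by (simp add: of_nat_diff)
    ultimately show ?thesis by simp
  qed
  then have "(1 + ln (real ?M)) powr (- 8/7) \<le> (real ?k / 2) powr (- 8/7)"
    by (intro powr_mono2') auto
  also have "\<dots> = real ?k powr (- 8/7) * 2 powr (8/7)"
    by (simp add: powr_divide powr_minus field_simps)
  also have "\<dots> \<le> real ?k powr (- 8/7) * 2 powr 2"
    by (intro mult_left_mono powr_mono) auto
  finally have "(1 + ln (real ?M)) powr (- 8/7) \<le> 4 * real ?k powr (- 8/7)" by simp
  then have "C * (1 + ln (real ?M)) powr (- 8/7) \<le> C * (4 * real ?k powr (- 8/7))"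
    using C(1) by (intro mult_left_mono) auto
  then show ?thesis using C(2)[OF M1] by simp
qed

lemma omega_conv_mu_sum_bound:
  assumes C: "C \<ge> 0" "\<And>M. M \<ge> 1 \<Longrightarrow> \<bar>mu_sum M\<bar> \<le> C * (1 + ln (real M)) powr (- 8/7)"
  obtains K where "K > 0" "\<And>J N. 2 ^ J \<le> N \<Longrightarrow> N < 2 ^ Suc J \<Longrightarrow>
    \<bar>\<Sum>d=1..N. of_int (omega_conv d) / real d * mu_sum (N div d)\<bar> \<le> K * harm (Suc J) / real (J + 2)"
proof -
  let ?S = "{m. prime_omega m = 1 \<or> prime_omega m = 2}"
  obtain D where D: "D > 0" "\<And>J j. j \<le> J \<Longrightarrow>
    (\<Sum>q | q \<in> ?S \<and> 2 ^ j < q \<and> q \<le> 2 ^ Suc j. 1 / real q) \<le> D * harm (Suc J) / real (j + 1)"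
    using dyadic_block_bound by blast
  obtain L where L: "L > 0" "\<And>J. (\<Sum>j<Suc J. 1 / real (j + 1) * real (J - j + 1) powr (- 8/7)) \<le> L / real (J + 2)"
    using dyadic_convolution_bound by blast
  show ?thesis
  proof
    \<comment> \<open>8 is 2 from |g| <= 2 times 4 from \<open>mu_sum_block\<close>; the summand 1
      keeps the constant positive when C = 0.\<close>
    show "8 * C * D * L + 1 > 0" using C D L by (simp add: add_nonneg_pos)
    fix J N :: nat assume J: "2 ^ J \<le> N" "N < 2 ^ Suc J"
    have h1: "harm (Suc J) \<ge> (1::real)" by (rule harm_ge_1) simp
    let ?D = "\<lambda>j. {q. q \<in> ?S \<and> 2 ^ j < q \<and> q \<le> 2 ^ Suc j}"
    have finD: "finite (?D j)" for j by (rule finite_subset[of _ "{..2 ^ Suc j}"]) auto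
    have cover: "d \<in> (\<Union>j\<in>{..<Suc J}. ?D j)" if d: "d \<in> {1..N}" "d \<in> ?S" for d
    proof -
      \<comment> \<open>The blocks exclude their lower end 2^j and include 2^(j+1), so the block of
        d is found from the powers of two around d - 1, which is positive.\<close>
      have "d \<ge> 2" using prime_omega_pos_ge_2[of d] d by auto
      then obtain j where j: "2 ^ j \<le> d - 1" "d - 1 < 2 ^ Suc j" using ex_pow2_bounds[of "d - 1"] by force
      then have "2 ^ j < d" "d \<le> 2 ^ Suc j" using \<open>d \<ge> 2\<close> by auto
      moreover have "(2::nat) ^ j < 2 ^ Suc J" using \<open>2 ^ j < d\<close> d(1) J(2) by (auto intro: less_le_trans less_trans)
      then have "j < Suc J" by (simp only: power_strict_increasing_iff)
      ultimately show ?thesis using d(2) by auto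
    qed
    have "\<bar>\<Sum>d=1..N. of_int (omega_conv d) / real d * mu_sum (N div d)\<bar> \<le> (\<Sum>d=1..N. \<bar>of_int (omega_conv d) / real d * mu_sum (N div d)\<bar>)"
      by (rule sum_abs)
    also have "\<dots> \<le> (\<Sum>d=1..N. if d \<in> ?S then 2 * (1 / real d) * \<bar>mu_sum (N div d)\<bar> else 0)"
    proof (intro sum_mono)
      fix d
      show "\<bar>of_int (omega_conv d) / real d * mu_sum (N div d)\<bar> \<le> (if d \<in> ?S then 2 * (1 / real d) * \<bar>mu_sum (N div d)\<bar> else 0)"
        by (auto simp: omega_conv_def abs_mult divide_right_mono mult_right_mono)
    qed
    also have "\<dots> = (\<Sum>d\<in>{1..N} \<inter> ?S. 2 * (1 / real d) * \<bar>mu_sum (N div d)\<bar>)"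
      by (subst sum.inter_restrict) auto
    also have "{1..N} \<inter> ?S = (\<Union>j\<in>{..<Suc J}. ?D j \<inter> {1..N})" using cover by blast
    also have "(\<Sum>d\<in>(\<Union>j\<in>{..<Suc J}. ?D j \<inter> {1..N}). 2 * (1 / real d) * \<bar>mu_sum (N div d)\<bar>) = (\<Sum>j<Suc J. \<Sum>d\<in>?D j \<inter> {1..N}. 2 * (1 / real d) * \<bar>mu_sum (N div d)\<bar>)"
    proof (rule sum.UNION_disjoint)
      have "?D i \<inter> ?D j = {}" if "i < j" for i j
      proof -
        have "(2::nat) ^ Suc i \<le> 2 ^ j" using that by (intro power_increasing) auto
        then show ?thesis by force
      qed
      then show "\<forall>i\<in>{..<Suc J}. \<forall>j\<in>{..<Suc J}. i \<noteq> j \<longrightarrow> (?D i \<inter> {1..N}) \<inter> (?D j \<inter> {1..N}) = {}"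
        by (metis (no_types, lifting) Int_left_commute Int_commute inf_bot_right inf_assoc nat_neq_iff)
    qed (use finD in auto)
    also have "\<dots> \<le> (\<Sum>j<Suc J. 8 * C * (D * harm (Suc J)) * (1 / real (j + 1) * real (J - j + 1) powr (- 8/7)))"
    proof (intro sum_mono)
      fix j assume "j \<in> {..<Suc J}"
      then have j: "j \<le> J" by simp
      let ?w = "4 * C * real (J - j + 1) powr (- 8/7)"
      have w0: "?w \<ge> 0" using C by simp
      have "(\<Sum>d\<in>?D j \<inter> {1..N}. 2 * (1 / real d) * \<bar>mu_sum (N div d)\<bar>) \<le> (\<Sum>d\<in>?D j \<inter> {1..N}. 2 * (1 / real d) * ?w)"
        using j by (intro sum_mono mult_left_mono mu_sum_block C J) auto
      also have "\<dots> \<le> (\<Sum>d\<in>?D j. 2 * (1 / real d) * ?w)"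
        using w0 finD by (intro sum_mono2) auto
      also have "\<dots> = 2 * ?w * (\<Sum>d\<in>?D j. 1 / real d)" by (simp add: sum_distrib_left mult_ac)
      also have "\<dots> \<le> 2 * ?w * (D * harm (Suc J) / real (j + 1))"
        using w0 by (intro mult_left_mono D j) auto
      finally show "(\<Sum>d\<in>?D j \<inter> {1..N}. 2 * (1 / real d) * \<bar>mu_sum (N div d)\<bar>) \<le> 8 * C * (D * harm (Suc J)) * (1 / real (j + 1) * real (J - j + 1) powr (- 8/7))"
        by (simp add: mult_ac)
    qed
    also have "\<dots> = 8 * C * (D * harm (Suc J)) * (\<Sum>j<Suc J. 1 / real (j + 1) * real (J - j + 1) powr (- 8/7))"
      by (simp only: sum_distrib_left)
    also have "\<dots> \<le> 8 * C * (D * harm (Suc J)) * (L / real (J + 2))"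
      using C D h1 by (intro mult_left_mono L) auto
    also have "\<dots> \<le> (8 * C * D * L + 1) * harm (Suc J) / real (J + 2)"
      using h1 by (simp add: divide_right_mono algebra_simps)
    finally show "\<bar>\<Sum>d=1..N. of_int (omega_conv d) / real d * mu_sum (N div d)\<bar> \<le> (8 * C * D * L + 1) * harm (Suc J) / real (J + 2)" .
  qed
qed

lemma frac_sum_bigo_from_mu_sum_bound:
  assumes C: "C \<ge> 0" "\<And>M. M \<ge> 1 \<Longrightarrow> \<bar>mu_sum M\<bar> \<le> C * (1 + ln (real M)) powr (- 8/7)"
  shows "(\<lambda>x::real. \<Sum>n | 1 \<le> n \<and> real n \<le> x.
            of_int (moebius_mu n) * real (prime_omega n) ^ 2 * frac (x / real n))
         \<in> O[at_top](\<lambda>x::real. x * ln (ln x) powr (3/2) / ln x)"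
proof -
  obtain K where K: "K > 0" "\<And>J N. 2 ^ J \<le> N \<Longrightarrow> N < 2 ^ Suc J \<Longrightarrow>
    \<bar>\<Sum>d=1..N. of_int (omega_conv d) / real d * mu_sum (N div d)\<bar> \<le> K * harm (Suc J) / real (J + 2)"
    using omega_conv_mu_sum_bound[OF C] by blast
  obtain D where D: "D > 0" "\<And>J N. J \<ge> 1 \<Longrightarrow> 2 ^ J \<le> N \<Longrightarrow> N < 2 ^ Suc J \<Longrightarrow>
    (\<Sum>n=1..N. \<bar>of_int (omega_conv n)\<bar>) \<le> D * real N * harm (Suc J) / real J"
    using sum_abs_omega_conv_bound by blast
  \<comment> \<open>From exp (exp 1) on, ln (ln x) >= 1. The factor 10 ln 2 is 5 from the harmonic
    number times 2 ln 2 from 1/J.\<close>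
  have "norm (\<Sum>n | 1 \<le> n \<and> real n \<le> x. of_int (moebius_mu n) * real (prime_omega n) ^ 2 * frac (x / real n))
    \<le> (10 * ln 2 * (K + D)) * norm (x * ln (ln x) powr (3/2) / ln x)" if x: "x \<ge> exp (exp 1)" for x
  proof -
    have lx: "ln x \<ge> exp 1" using x by (simp add: ln_ge_iff order_less_le_trans[OF exp_gt_zero])
    then have "ln x > 0" using exp_gt_zero[of 1] by linarith
    then have llx: "ln (ln x) \<ge> 1" using lx by (simp add: ln_ge_iff)
    have "exp (exp 1) \<ge> (2::real)"
    proof -
      have "exp (1::real) \<ge> 2" using exp_ge_add_one_self[of 1] by simp
      then show ?thesis using exp_ge_add_one_self[of "exp 1"] by linarith
    qed
    then have x2: "x \<ge> 2" using x by simp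
    define N where "N = nat \<lfloor>x\<rfloor>"
    have N: "N \<ge> 2" "real N \<le> x" "x < real N + 1" using x2 by (auto simp: N_def le_nat_iff le_floor_iff)
    obtain J where J: "2 ^ J \<le> N" "N < 2 ^ Suc J" using ex_pow2_bounds[of N] N by auto
    have J1: "J \<ge> 1" using J(2) N(1) by (cases J) auto
    have "(2::real) ^ J \<le> real N" using J(1) by (simp add: numeral_power_le_of_nat_cancel_iff)
    then have xl: "2 ^ J \<le> x" using N by linarith
    have "real (N + 1) \<le> 2 ^ Suc J" using J(2) by (metis Suc_eq_plus1 Suc_leI of_nat_le_iff of_nat_numeral of_nat_power)
    then have xu: "x \<le> 2 ^ Suc J" using N by simp
    have "ln (2 ^ J) \<le> ln x" using xl by (intro ln_mono) auto
    then have Jl: "real J * ln 2 \<le> ln x" by (simp add: ln_realpow)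
    have "ln x \<le> ln (2 ^ Suc J)" using xu x2 by (intro ln_mono) auto
    then have "ln x \<le> real (Suc J) * ln 2" by (simp only: ln_realpow zero_less_numeral)
    also have "\<dots> \<le> (2 * real J) * ln 2" using J1 by (intro mult_right_mono) auto
    finally have iJ: "1 / real J \<le> 2 * ln 2 / ln x" using J1 \<open>ln x > 0\<close> by (simp add: field_simps)
    \<comment> \<open>As J is of the order of ln x, the harmonic number is O(log log x). Only this
      first power arises; since log log x >= 1, it is at most the power 3/2.\<close>
    have h: "harm (Suc J) \<le> 5 * ln (ln x) powr (3/2)"
    proof -
      have "harm (Suc J) \<le> 1 + ln (real (Suc J))" by (rule harm_le_ln) simp
      also have "ln (real (Suc J)) \<le> ln (4 * ln x)"
      proof (intro ln_mono)
        have "real J * (1/2) \<le> real J * ln 2" using ln2_ge_two_thirds by (intro mult_left_mono) auto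
        then have "real J \<le> 2 * ln x" using Jl by linarith
        then show "real (Suc J) \<le> 4 * ln x" using J1 by simp
      qed auto
      also have "\<dots> = ln 4 + ln (ln x)" using \<open>ln x > 0\<close> by (simp add: ln_mult)
      also have "ln 4 \<le> (3::real)" using ln_le_minus_one[of 4] by simp
      finally have "harm (Suc J) \<le> 5 * ln (ln x)" using llx by simp
      also have "ln (ln x) \<le> ln (ln x) powr (3/2)" using llx powr_mono[of 1 "3/2" "ln (ln x)"] by simp
      finally show ?thesis by simp
    qed
    have h1: "harm (Suc J) \<ge> (1::real)" by (rule harm_ge_1) simp
    have "\<bar>x * (\<Sum>d=1..N. of_int (omega_conv d) / real d * mu_sum (N div d)) - (\<Sum>n=1..N. of_int (omega_conv n))\<bar>
      \<le> x * (K * harm (Suc J) / real (J + 2)) + D * real N * harm (Suc J) / real J"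
    proof -
      have "\<bar>x * (\<Sum>d=1..N. of_int (omega_conv d) / real d * mu_sum (N div d))\<bar> \<le> x * (K * harm (Suc J) / real (J + 2))"
        using x2 mult_left_mono[OF K(2)[OF J], of x] abs_of_nonneg[of x] by (simp only: abs_mult)
      moreover have "\<bar>\<Sum>n=1..N. real_of_int (omega_conv n)\<bar> \<le> D * real N * harm (Suc J) / real J"
        using sum_abs D(2)[OF J1 J] by (rule order_trans)
      ultimately show ?thesis by linarith
    qed
    also have "\<dots> \<le> x * (K * harm (Suc J) / real J) + D * x * harm (Suc J) / real J"
      using x2 K D h1 J1 N by (intro add_mono mult_left_mono divide_left_mono divide_right_mono mult_right_mono) auto
    also have "\<dots> = (x * (K + D)) * (harm (Suc J) * (1 / real J))" by (simp add: add_divide_distrib algebra_simps)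
    also have "\<dots> \<le> (x * (K + D)) * ((5 * ln (ln x) powr (3/2)) * (2 * ln 2 / ln x))"
      using x2 K D h iJ h1 J1 by (intro mult_left_mono mult_mono) auto
    also have "\<dots> = (10 * ln 2 * (K + D)) * (x * ln (ln x) powr (3/2) / ln x)" by simp
    also have "\<dots> = (10 * ln 2 * (K + D)) * norm (x * ln (ln x) powr (3/2) / ln x)"
      using x2 \<open>ln x > 0\<close> by simp
    finally show ?thesis using x2 by (subst frac_sum_eq) (auto simp: N_def)
  qed
  then show ?thesis
    by (intro bigoI eventually_mono[OF eventually_ge_at_top[of "exp (exp 1)"]]) auto
qed

section \<open>The Laplace transform of the partial sums\<close>

definition m_exp :: "real \<Rightarrow> real" where
  "m_exp u = mu_sum (nat \<lfloor>exp u\<rfloor>)"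

lemma m_exp_neg: "u < 0 \<Longrightarrow> m_exp u = 0"
proof -
  assume "u < 0"
  then have "exp u < 1" by simp
  then have "\<lfloor>exp u\<rfloor> \<le> 0" by (simp add: floor_le_iff)
  then show ?thesis by (simp add: m_exp_def mu_sum_def)
qed

lemma abs_mu_sum_le_harm: "\<bar>mu_sum N\<bar> \<le> harm N"
proof -
  have "\<bar>mu_sum N\<bar> \<le> (\<Sum>n=1..N. \<bar>of_int (moebius_mu n) / real n\<bar>)"
    unfolding mu_sum_def by (rule sum_abs)
  also have "\<dots> \<le> (\<Sum>n=1..N. inverse (real n))"
  proof (intro sum_mono)
    fix n
    have "\<bar>real_of_int (moebius_mu n)\<bar> \<le> 1" using abs_moebius_mu_le[of n] by linarith
    then show "\<bar>of_int (moebius_mu n) / real n\<bar> \<le> inverse (real n)"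
      by (simp add: abs_divide divide_right_mono inverse_eq_divide)
  qed
  finally show ?thesis by (simp add: harm_def)
qed

lemma abs_m_exp_le: "\<bar>m_exp u\<bar> \<le> 1 + \<bar>u\<bar>"
proof (cases "u < 0")
  case True
  then show ?thesis by (simp add: m_exp_neg)
next
  case False
  define N where "N = nat \<lfloor>exp u\<rfloor>"
  have "exp u \<ge> 1" using False by simp
  then have N: "N \<ge> 1" "real N \<le> exp u" by (auto simp: N_def le_nat_iff le_floor_iff)
  have "\<bar>m_exp u\<bar> \<le> harm N" unfolding m_exp_def N_def by (rule abs_mu_sum_le_harm)
  also have "\<dots> \<le> 1 + ln (real N)" using N by (rule_tac harm_le_ln) simp
  also have "ln (real N) \<le> ln (exp u)" using N by (intro ln_mono) auto
  finally show ?thesis using False by simp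
qed

lemma m_exp_measurable [measurable]: "m_exp \<in> borel_measurable borel"
  unfolding m_exp_def by measurable

lemma mu_sum_diff_le: "M \<le> N \<Longrightarrow> \<bar>mu_sum N - mu_sum M\<bar> \<le> harm N - harm M"
proof (induction N rule: dec_induct)
  case (step N)
  have "\<bar>real_of_int (moebius_mu (Suc N))\<bar> \<le> 1" using abs_moebius_mu_le[of "Suc N"] by linarith
  then have "\<bar>of_int (moebius_mu (Suc N)) / real (Suc N)\<bar> \<le> inverse (real (Suc N))"
    by (simp only: abs_divide inverse_eq_divide abs_of_nat divide_right_mono of_nat_0_le_iff)
  moreover have "mu_sum (Suc N) = mu_sum N + of_int (moebius_mu (Suc N)) / real (Suc N)"
    by (simp add: mu_sum_def)
  moreover have "harm (Suc N) = (harm N :: real) + inverse (real (Suc N))" by (simp add: harm_Suc)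
  ultimately show ?case using step.IH by linarith
qed simp

text \<open>The difference is at most the sum of 1/n over e^u < n <= e^w. Its first term is at most
  e^(-u), which accounts for a possible jump just after u, and the others are bounded by the
  integral of 1/t, hence by w - u.\<close>

lemma m_exp_upper_diff:
  assumes "0 \<le> u" "u \<le> w"
  shows "\<bar>m_exp w - m_exp u\<bar> \<le> (w - u) + exp (- u)"
proof -
  define M where "M = nat \<lfloor>exp u\<rfloor>"
  define N where "N = nat \<lfloor>exp w\<rfloor>"
  have eu: "exp u \<ge> 1" "exp u \<le> exp w" using assms by auto
  have M: "M \<ge> 1" "real M \<le> exp u" "exp u < real M + 1" using eu by (auto simp: M_def le_nat_iff le_floor_iff)
  have N: "real N \<le> exp w" using eu by (simp add: N_def)
  have MN: "M \<le> N" unfolding M_def N_def using eu by (intro nat_mono floor_mono) auto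
  show ?thesis
  proof (cases "M = N")
    case True
    then show ?thesis using assms by (simp add: m_exp_def M_def N_def)
  next
    case False
    then have MN': "Suc M \<le> N" using MN by simp
    have "\<bar>mu_sum N - mu_sum M\<bar> \<le> harm N - harm M" using MN by (rule mu_sum_diff_le)
    moreover have "harm N - harm M = (harm N - harm (Suc M)) + 1 / real (Suc M)"
      by (simp add: harm_Suc inverse_eq_divide)
    moreover have "harm N - harm (Suc M) \<le> ln (real N) - ln (real (Suc M))"
    proof -
      have "M \<le> N - 1" using MN' by simp
      from decseq_harm_diff_ln[unfolded decseq_def, rule_format, OF this] MN' show ?thesis by simp
    qed
    moreover have "ln (real N) \<le> ln (exp w)" using N MN' by (intro ln_mono) auto
    moreover have "ln (exp u) \<le> ln (real (Suc M))" using M by (intro ln_mono) auto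
    moreover have "1 / real (Suc M) \<le> 1 / exp u" using M by (intro divide_left_mono) auto
    ultimately have "\<bar>mu_sum N - mu_sum M\<bar> \<le> (w - u) + exp (- u)"
      unfolding exp_minus inverse_eq_divide ln_exp by linarith
    then show ?thesis by (simp add: m_exp_def M_def N_def)
  qed
qed

lemma real_exp_Ici:
  fixes \<sigma> L :: real
  assumes "\<sigma> > 0"
  shows "has_bochner_integral lborel (\<lambda>u. indicator {L..} u * exp (- \<sigma> * u)) (exp (- \<sigma> * L) / \<sigma>)"
proof -
  have "(\<integral>\<^sup>+u. ennreal (exp (- \<sigma> * u)) * indicator {L..} u \<partial>lborel) = ennreal (0 - (- exp (- \<sigma> * L) / \<sigma>))"
  proof (rule nn_integral_FTC_atLeast)
    show "((\<lambda>u. - exp (- \<sigma> * u) / \<sigma>) has_real_derivative exp (- \<sigma> * u)) (at u)" for u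
      using assms by (auto intro!: derivative_eq_intros)
    have "((\<lambda>u. exp (- \<sigma> * u)) \<longlongrightarrow> 0) at_top"
      using assms by real_asymp
    then have "((\<lambda>u. - exp (- \<sigma> * u) / \<sigma>) \<longlongrightarrow> - 0 / \<sigma>) at_top"
      using assms by (intro tendsto_divide tendsto_minus tendsto_const) auto
    then show "((\<lambda>u. - exp (- \<sigma> * u) / \<sigma>) \<longlongrightarrow> 0) at_top" by simp
  qed auto
  moreover have "ennreal (exp (- \<sigma> * u)) * indicator {L..} u = ennreal (indicator {L..} u * exp (- \<sigma> * u))" for u
    by (simp split: split_indicator)
  ultimately have "(\<integral>\<^sup>+u. ennreal (indicator {L..} u * exp (- \<sigma> * u)) \<partial>lborel) = ennreal (exp (- \<sigma> * L) / \<sigma>)"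
    by simp
  then show ?thesis
    using assms by (intro has_bochner_integral_nn_integral) auto
qed

lemma complex_exp_Ici:
  fixes s :: complex and L :: real
  assumes s: "Re s > 0"
  shows "integrable lborel (\<lambda>u. indicator {L..} u *\<^sub>R exp (- s * of_real u))"
    and "(\<integral>u. indicator {L..} u *\<^sub>R exp (- s * of_real u) \<partial>lborel) = exp (- s * of_real L) / s"
proof -
  note r = real_exp_Ici[OF s, of L]
  have nrm: "norm (exp (- s * of_real u)) = exp (- Re s * u)" for u by simp
  show int: "integrable lborel (\<lambda>u. indicator {L..} u *\<^sub>R exp (- s * of_real u))"
  proof (rule Bochner_Integration.integrable_bound)
    show "integrable lborel (\<lambda>u. indicator {L..} u * exp (- Re s * u))"
      using r by (simp add: has_bochner_integral_iff)
    show "AE u in lborel. norm (indicator {L..} u *\<^sub>R exp (- s * of_real u)) \<le> norm (indicator {L..} u * exp (- Re s * u))"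
      by (simp split: split_indicator)
  qed simp
  have "s \<noteq> 0" using s by (metis less_irrefl zero_complex.sel(1))
  have "(LBINT u=ereal L..\<infinity>. exp (- s * of_real u)) = 0 - (- exp (- s * of_real L) / s)"
  proof (rule interval_integral_FTC_integrable)
    show "((\<lambda>u. - exp (- s * of_real u) / s) has_vector_derivative exp (- s * of_real x)) (at x)" for x
      using \<open>s \<noteq> 0\<close> by (auto intro!: derivative_eq_intros has_vector_derivative_real_field)
    show "isCont (\<lambda>u. exp (- s * of_real u)) x" for x by (intro continuous_intros)
    have "set_integrable lborel {L..} (\<lambda>u. exp (- s * of_real u))"
      using int by (simp add: set_integrable_def)
    then show "set_integrable lborel (einterval (ereal L) \<infinity>) (\<lambda>u. exp (- s * of_real u))"
      by (rule set_integrable_subset) (auto simp: einterval_def)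
    show "(((\<lambda>u. - exp (- s * of_real u) / s) \<circ> real_of_ereal) \<longlongrightarrow> - exp (- s * of_real L) / s) (at_right (ereal L))"
      unfolding ereal_tendsto_simps by (intro tendsto_intros \<open>s \<noteq> 0\<close>)
    have "((\<lambda>u. exp (- Re s * u)) \<longlongrightarrow> 0) at_top" using s by real_asymp
    then have "((\<lambda>u. norm (exp (- s * of_real u))) \<longlongrightarrow> 0) at_top" by (simp only: nrm)
    then have "((\<lambda>u. exp (- s * of_real u)) \<longlongrightarrow> 0) at_top" by (rule tendsto_norm_zero_cancel)
    then show "(((\<lambda>u. - exp (- s * of_real u) / s) \<circ> real_of_ereal) \<longlongrightarrow> 0) (at_left \<infinity>)"
      unfolding ereal_tendsto_simps using tendsto_divide[OF tendsto_minus tendsto_const \<open>s \<noteq> 0\<close>] by fastforce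
  qed simp
  then have 1: "(\<integral>u. indicator {L<..} u *\<^sub>R exp (- s * of_real u) \<partial>lborel) = exp (- s * of_real L) / s"
    by (simp add: interval_lebesgue_integral_def einterval_def set_lebesgue_integral_def greaterThan_def)
  have "(\<integral>u. indicator {L..} u *\<^sub>R exp (- s * of_real u) \<partial>lborel) = (\<integral>u. indicator {L<..} u *\<^sub>R exp (- s * of_real u) \<partial>lborel)"
  proof (intro integral_cong_AE)
    show "AE u in lborel. indicator {L..} u *\<^sub>R exp (- s * of_real u) = indicator {L<..} u *\<^sub>R exp (- s * of_real u)"
      using AE_lborel_singleton[of L] by eventually_elim (auto split: split_indicator)
  qed auto
  then show "(\<integral>u. indicator {L..} u *\<^sub>R exp (- s * of_real u) \<partial>lborel) = exp (- s * of_real L) / s"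
    using 1 by simp
qed

text \<open>m(e^u) is a sum of steps of height mu(n)/n starting at u = ln n, and the unit step
  starting there has the transform n^(-s)/s. Termwise integration gives the sum of mu(n) n^(-1-s),
  divided by s, which is 1/(s zeta(1+s)).\<close>

lemma m_exp_laplace:
  assumes s: "Re s > 0"
  shows "(\<integral>u. of_real (m_exp u) * exp (- s * of_real u) \<partial>lborel) = rszeta s"
proof -
  define a where "a = (\<lambda>n. complex_of_real (of_int (moebius_mu n) / real n))"
  define F where "F = (\<lambda>n u. a n * (indicator {ln (real n)..} u *\<^sub>R exp (- s * of_real u)))"
  have "s \<noteq> 0" using s by (metis less_irrefl zero_complex.sel(1))
  have na: "norm (a n) \<le> 1 / real n" for n
  proof -
    have "\<bar>real_of_int (moebius_mu n)\<bar> \<le> 1" using abs_moebius_mu_le[of n] by linarith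
    then show ?thesis by (simp add: a_def norm_divide divide_right_mono)
  qed
  have a0: "a 0 = 0" by (simp add: a_def)
  have Fint: "integrable lborel (F n)" for n
    unfolding F_def by (intro integrable_mult_right complex_exp_Ici s)
  have Fsupp: "F n u = 0" if "n \<notin> {..nat \<lfloor>exp u\<rfloor>}" for n u
  proof -
    have "exp u < real n" using that by (simp add: not_le nat_less_iff floor_less_iff)
    then have "u < ln (real n)" by (metis exp_gt_zero ln_exp ln_less_cancel_iff less_trans)
    then show ?thesis by (simp add: F_def)
  qed
  have Fsum: "(\<Sum>n. F n u) = of_real (m_exp u) * exp (- s * of_real u)" for u
  proof -
    have "(\<Sum>n. F n u) = (\<Sum>n\<le>nat \<lfloor>exp u\<rfloor>. F n u)"
      using Fsupp by (intro suminf_finite) auto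
    also have "\<dots> = (\<Sum>n\<in>{1..nat \<lfloor>exp u\<rfloor>}. F n u)"
      using a0 by (intro sum.mono_neutral_right) (auto simp: F_def Suc_le_eq)
    also have "\<dots> = (\<Sum>n\<in>{1..nat \<lfloor>exp u\<rfloor>}. a n * exp (- s * of_real u))"
    proof (intro sum.cong refl)
      fix n assume n: "n \<in> {1..nat \<lfloor>exp u\<rfloor>}"
      then have "real n \<le> exp u" by (simp add: le_nat_iff le_floor_iff)
      then have "ln (real n) \<le> ln (exp u)" using n by (intro ln_mono) auto
      then show "F n u = a n * exp (- s * of_real u)" by (simp add: F_def)
    qed
    also have "\<dots> = of_real (m_exp u) * exp (- s * of_real u)"
      by (simp add: m_exp_def mu_sum_def a_def sum_distrib_right)
    finally show ?thesis .
  qed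
  have intF: "integral\<^sup>L lborel (F n) = of_int (moebius_mu n) * of_nat n powr (- (1 + s)) / s" for n
  proof (cases "n = 0")
    case True
    then show ?thesis by (simp add: F_def a0)
  next
    case False
    have "integral\<^sup>L lborel (F n) = a n * (exp (- s * of_real (ln (real n))) / s)"
      unfolding F_def by (simp only: integral_mult_right_zero complex_exp_Ici(2)[OF s])
    also have "exp (- s * of_real (ln (real n))) = of_nat n powr (- s)"
      using False by (simp add: powr_def Ln_of_nat mult.commute)
    also have "a n * (of_nat n powr (- s) / s) = of_int (moebius_mu n) * (of_nat n powr (- 1) * of_nat n powr (- s)) / s"
      using False by (simp add: a_def powr_minus field_simps)
    also have "of_nat n powr (- 1) * of_nat n powr (- s) = (of_nat n powr (- (1 + s)) :: complex)"
      by (simp flip: powr_add)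
    finally show ?thesis .
  qed
  have nF: "(\<integral>u. norm (F n u) \<partial>lborel) \<le> real n powr (- 1 - Re s) / Re s" for n
  proof (cases "n = 0")
    case True
    then show ?thesis by (simp add: F_def a0)
  next
    case False
    have "(\<integral>u. norm (F n u) \<partial>lborel) = norm (a n) * (\<integral>u. indicator {ln (real n)..} u * exp (- Re s * u) \<partial>lborel)"
    proof -
      have "norm (F n u) = norm (a n) * (indicator {ln (real n)..} u * exp (- Re s * u))" for u
        by (simp add: F_def norm_mult split: split_indicator)
      then show ?thesis by (simp only: integral_mult_right_zero)
    qed
    also have "\<dots> = norm (a n) * (exp (- Re s * ln (real n)) / Re s)"
      by (simp only: has_bochner_integral_integral_eq[OF real_exp_Ici[OF s]])
    also have "\<dots> \<le> 1 / real n * (exp (- Re s * ln (real n)) / Re s)"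
      using s na by (intro mult_right_mono) auto
    also have "exp (- Re s * ln (real n)) = real n powr (- Re s)" using False by (simp add: powr_def)
    also have "1 / real n * (real n powr (- Re s) / Re s) = (real n powr (- 1) * real n powr (- Re s)) / Re s"
      using False by (simp add: powr_minus_divide)
    also have "real n powr (- 1) * real n powr (- Re s) = real n powr (- 1 - Re s)"
      by (subst powr_add[symmetric]) simp
    finally show ?thesis .
  qed
  \<comment> \<open>The norms of the steps integrate to at most n^(-1-Re s) / Re s; this justifies
    exchanging sum and integral for Re s > 0.\<close>
  have smF: "summable (\<lambda>n. \<integral>u. norm (F n u) \<partial>lborel)"
  proof (rule summable_comparison_test[OF exI, OF allI, OF impI])
    show "norm (\<integral>u. norm (F n u) \<partial>lborel) \<le> real n powr (- 1 - Re s) / Re s" for n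
      using nF[of n] by simp
    show "summable (\<lambda>n. real n powr (- 1 - Re s) / Re s)"
      using s by (intro summable_divide) (simp add: summable_real_powr_iff)
  qed
  have "(\<integral>u. (\<Sum>n. F n u) \<partial>lborel) = (\<Sum>n. integral\<^sup>L lborel (F n))"
  proof (rule integral_suminf[OF Fint _ smF])
    show "AE u in lborel. summable (\<lambda>n. norm (F n u))"
      using Fsupp by (intro AE_I2 summable_finite[of "{.._}"]) auto
  qed
  also have "\<dots> = (\<Sum>n. of_int (moebius_mu n) * of_nat n powr (- (1 + s)) / s)" by (simp only: intF)
  also have "\<dots> = (\<Sum>n. of_int (moebius_mu n) * of_nat n powr (- (1 + s))) / s"
  proof -
    have "Re (1 + s) > 1" using s by simp
    from abs_summable_summable[OF moebius_dirichlet_abs_summable[OF this]]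
    have "summable (\<lambda>n. of_int (moebius_mu n) * of_nat n powr (- (1 + s)) :: complex)"
      by (rule summable_on_imp_summable)
    then show ?thesis by (rule suminf_divide)
  qed
  also have "(\<Sum>n. of_int (moebius_mu n) * of_nat n powr (- (1 + s))) = (\<Sum>\<^sub>\<infinity>n. of_int (moebius_mu n) * (of_nat n powr (- (1 + s)) :: complex))"
  proof -
    have "Re (1 + s) > 1" using s by simp
    from has_sum_imp_sums[OF has_sum_infsum[OF abs_summable_summable[OF moebius_dirichlet_abs_summable[OF this]]]]
    show ?thesis by (rule sums_unique[symmetric])
  qed
  also have "\<dots> / s = 1 / (s * zeta_sum (1 + s))"
  proof -
    have "Re (1 + s) > 1" using s by simp
    from moebius_dirichlet_inverse[OF this] have e: "(\<Sum>\<^sub>\<infinity>n. of_int (moebius_mu n) * (of_nat n powr (- (1 + s)) :: complex)) * zeta_sum (1 + s) = 1" .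
    then have "zeta_sum (1 + s) \<noteq> 0" by auto
    then have "(\<Sum>\<^sub>\<infinity>n. of_int (moebius_mu n) * (of_nat n powr (- (1 + s)) :: complex)) = 1 / zeta_sum (1 + s)"
      using nonzero_eq_divide_eq[OF \<open>zeta_sum (1 + s) \<noteq> 0\<close>] e by blast
    then show ?thesis by (simp add: mult.commute)
  qed
  also have "\<dots> = rszeta s" by (simp add: rszeta_def szeta_eq_zeta_sum[OF s])
  finally show ?thesis by (simp only: Fsum)
qed

text \<open>The characteristic function of the standard normal law at w/h, after the substitution x
  = h t.\<close>

lemma gaussian_fourier:
  fixes h w :: real
  assumes h: "h > 0"
  shows "(\<integral>t. of_real (exp (- (h * t)\<^sup>2 / 2)) * iexp (t * w) \<partial>lborel) = of_real (2 * pi / h * std_normal_density (w / h))"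
proof -
  have "of_real (exp (- (w / h)\<^sup>2 / 2)) = char std_normal_distribution (w / h)"
    by (simp add: char_std_normal_distribution)
  also have "\<dots> = (\<integral>x. std_normal_density x *\<^sub>R iexp (w / h * x) \<partial>lborel)"
    unfolding char_def by (subst integral_density) (auto simp: normal_density_nonneg)
  also have "\<dots> = \<bar>h\<bar> *\<^sub>R (\<integral>t. std_normal_density (0 + h * t) *\<^sub>R iexp (w / h * (0 + h * t)) \<partial>lborel)"
    using h by (intro lborel_integral_real_affine) auto
  also have "(\<lambda>t. std_normal_density (0 + h * t) *\<^sub>R iexp (w / h * (0 + h * t))) =
    (\<lambda>t. complex_of_real (1 / sqrt (2 * pi)) * (of_real (exp (- (h * t)\<^sup>2 / 2)) * iexp (t * w)))"
    using h by (auto simp: std_normal_density_def scaleR_conv_of_real mult_ac)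
  also have "\<bar>h\<bar> *\<^sub>R (\<integral>t. complex_of_real (1 / sqrt (2 * pi)) * (of_real (exp (- (h * t)\<^sup>2 / 2)) * iexp (t * w)) \<partial>lborel)
    = of_real (h / sqrt (2 * pi)) * (\<integral>t. of_real (exp (- (h * t)\<^sup>2 / 2)) * iexp (t * w) \<partial>lborel)"
    using h by (subst integral_mult_right_zero) (simp add: scaleR_conv_of_real)
  finally have 1: "of_real (h / sqrt (2 * pi)) * (\<integral>t. of_real (exp (- (h * t)\<^sup>2 / 2)) * iexp (t * w) \<partial>lborel) = complex_of_real (exp (- (w / h)\<^sup>2 / 2))"
    by (rule sym)
  have nz: "complex_of_real (h / sqrt (2 * pi)) \<noteq> 0" using h by simp
  have "2 * pi = sqrt (2 * pi) * sqrt (2 * pi)" by simp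
  then have "exp (- (w / h)\<^sup>2 / 2) = (h / sqrt (2 * pi)) * (2 * pi / h * std_normal_density (w / h))"
    using h by (simp add: std_normal_density_def field_simps)
  then have "complex_of_real (exp (- (w / h)\<^sup>2 / 2)) = of_real (h / sqrt (2 * pi)) * of_real (2 * pi / h * std_normal_density (w / h))"
    by (simp only: of_real_mult)
  with 1 have "of_real (h / sqrt (2 * pi)) * (\<integral>t. of_real (exp (- (h * t)\<^sup>2 / 2)) * iexp (t * w) \<partial>lborel) = complex_of_real (h / sqrt (2 * pi)) * of_real (2 * pi / h * std_normal_density (w / h))"
    by simp
  then show ?thesis using nz by (simp only: mult_cancel_left) blast
qed

lemma gaussian_integrable:
  fixes h :: real
  assumes h: "h > 0"
  shows "integrable lborel (\<lambda>t. exp (- (h * t)\<^sup>2 / 2))"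
proof -
  have "integrable lborel (\<lambda>x. sqrt (2 * pi) * std_normal_density x)"
    by (intro integrable_mult_right) simp
  then have "integrable lborel (\<lambda>x::real. exp (- x\<^sup>2 / 2))"
    by (simp add: std_normal_density_def)
  from lborel_integrable_real_affine[OF this, of h 0] h show ?thesis by simp
qed

lemma m_exp_exp_integrable:
  fixes \<delta> :: real
  assumes \<delta>: "\<delta> > 0"
  shows "integrable lborel (\<lambda>u. m_exp u * exp (- \<delta> * u))"
proof (rule Bochner_Integration.integrable_bound)
  show "integrable lborel (\<lambda>u. (1 + 2 / \<delta>) * (indicator {0..} u * exp (- (\<delta> / 2) * u)))"
    using real_exp_Ici[of "\<delta> / 2" 0] \<delta> by (intro integrable_mult_right) (simp add: has_bochner_integral_iff)
  show "AE u in lborel. norm (m_exp u * exp (- \<delta> * u)) \<le> norm ((1 + 2 / \<delta>) * (indicator {0..} u * exp (- (\<delta> / 2) * u)))"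
  proof (intro AE_I2)
    fix u :: real
    show "norm (m_exp u * exp (- \<delta> * u)) \<le> norm ((1 + 2 / \<delta>) * (indicator {0..} u * exp (- (\<delta> / 2) * u)))"
    proof (cases "u < 0")
      case True
      then show ?thesis by (simp add: m_exp_neg)
    next
      case False
      \<comment> \<open>The linear growth of m(e^u) is absorbed by half of the damping: in the
        product, 2/\<delta> times \<delta> u/2 supplies the u.\<close>
      have "1 + u \<le> (1 + 2 / \<delta>) * (1 + \<delta> / 2 * u)" using \<delta> False by (simp add: field_simps)
      also have "\<dots> \<le> (1 + 2 / \<delta>) * exp (\<delta> / 2 * u)"
        using \<delta> by (intro mult_left_mono exp_ge_add_one_self) auto
      finally have "\<bar>m_exp u\<bar> \<le> (1 + 2 / \<delta>) * exp (\<delta> / 2 * u)" using abs_m_exp_le[of u] False by simp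
      then have "\<bar>m_exp u\<bar> * exp (- \<delta> * u) \<le> (1 + 2 / \<delta>) * exp (\<delta> / 2 * u) * exp (- \<delta> * u)"
        by (intro mult_right_mono) auto
      also have "\<dots> = (1 + 2 / \<delta>) * exp (- (\<delta> / 2) * u)"
        by (simp add: mult.assoc flip: exp_add)
      finally show ?thesis using False \<delta> by (simp add: abs_mult)
    qed
  qed
qed simp

text \<open>On Re s = \<delta> the transform is the Fourier transform of m(e^u) e^(-\<delta> u).
  Multiplying by the Gaussian in t amounts to averaging over u with a normal law of standard
  deviation h around v. Damping and Gaussian together make the double integral absolutely
  convergent, so Fubini applies.\<close>

lemma gauss_smoothing_identity:
  fixes \<delta> h v :: real
  assumes \<delta>: "\<delta> > 0" and h: "h > 0"
  shows "(\<integral>t. rszeta (Complex \<delta> t) * of_real (exp (- (h * t)\<^sup>2 / 2)) * iexp (t * v) \<partial>lborel) =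
    of_real (2 * pi * (\<integral>w. m_exp (v - h * w) * exp (- \<delta> * (v - h * w)) * std_normal_density w \<partial>lborel))"
proof -
  define E where "E = (\<lambda>t. complex_of_real (exp (- (h * t)\<^sup>2 / 2)))"
  define \<Phi> where "\<Phi> = (\<lambda>t u. of_real (m_exp u) * exp (- Complex \<delta> t * of_real u) * E t * iexp (t * v))"
  have [measurable]: "E \<in> borel_measurable borel" unfolding E_def by measurable
  have Phi_alt: "\<Phi> t u = of_real (m_exp u * exp (- \<delta> * u)) * (E t * iexp (t * (v - u)))" for t u
  proof -
    have "- Complex \<delta> t * of_real u = of_real (- \<delta> * u) + \<i> * of_real (t * - u)"
      by (simp add: complex_eq_iff)
    then have "exp (- Complex \<delta> t * of_real u) = of_real (exp (- \<delta> * u)) * iexp (t * - u)"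
      by (simp only: exp_add exp_of_real)
    moreover have "iexp (t * - u) * iexp (t * v) = iexp (t * (v - u))"
      by (simp add: algebra_simps flip: exp_add)
    ultimately show ?thesis by (simp add: \<Phi>_def mult_ac)
  qed
  have normPhi: "norm (\<Phi> t u) = \<bar>m_exp u * exp (- \<delta> * u)\<bar> * exp (- (h * t)\<^sup>2 / 2)" for t u
    by (simp add: Phi_alt norm_mult E_def abs_mult)
  have intPhi: "integrable (lborel \<Otimes>\<^sub>M lborel) (case_prod \<Phi>)"
  proof (rule lborel_pair.Fubini_integrable)
    show "case_prod \<Phi> \<in> borel_measurable (lborel \<Otimes>\<^sub>M lborel)"
      unfolding Phi_alt by measurable
    show "integrable lborel (\<lambda>t. \<integral>u. norm (case_prod \<Phi> (t, u)) \<partial>lborel)"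
      using gaussian_integrable[OF h] by (simp add: normPhi)
    show "AE t in lborel. integrable lborel (\<lambda>u. case_prod \<Phi> (t, u))"
    proof (intro AE_I2, rule Bochner_Integration.integrable_bound)
      fix t
      show "integrable lborel (\<lambda>u. exp (- (h * t)\<^sup>2 / 2) * (m_exp u * exp (- \<delta> * u)))"
        by (intro integrable_mult_right m_exp_exp_integrable \<delta>)
      show "(\<lambda>u. case_prod \<Phi> (t, u)) \<in> borel_measurable lborel"
        unfolding case_prod_conv Phi_alt by measurable
      show "AE u in lborel. norm (case_prod \<Phi> (t, u)) \<le> norm (exp (- (h * t)\<^sup>2 / 2) * (m_exp u * exp (- \<delta> * u)))"
        by (intro AE_I2) (simp add: normPhi abs_mult)
    qed
  qed
  have "(\<integral>t. rszeta (Complex \<delta> t) * E t * iexp (t * v) \<partial>lborel) = (\<integral>t. (\<integral>u. \<Phi> t u \<partial>lborel) \<partial>lborel)"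
  proof (intro Bochner_Integration.integral_cong refl)
    fix t
    have "rszeta (Complex \<delta> t) = (\<integral>u. of_real (m_exp u) * exp (- Complex \<delta> t * of_real u) \<partial>lborel)"
      using \<delta> by (intro m_exp_laplace[symmetric]) simp
    then show "rszeta (Complex \<delta> t) * E t * iexp (t * v) = (\<integral>u. \<Phi> t u \<partial>lborel)"
      by (simp only: \<Phi>_def integral_mult_left_zero)
  qed
  also have "\<dots> = (\<integral>u. (\<integral>t. \<Phi> t u \<partial>lborel) \<partial>lborel)"
    by (rule lborel_pair.Fubini_integral[OF intPhi, symmetric])
  also have "\<dots> = (\<integral>u. of_real (m_exp u * exp (- \<delta> * u) * (2 * pi / h * std_normal_density ((v - u) / h))) \<partial>lborel)"
  proof (intro Bochner_Integration.integral_cong refl)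
    fix u
    have "(\<integral>t. \<Phi> t u \<partial>lborel) = of_real (m_exp u * exp (- \<delta> * u)) * (\<integral>t. E t * iexp (t * (v - u)) \<partial>lborel)"
      unfolding Phi_alt by (rule integral_mult_right_zero)
    also have "(\<integral>t. E t * iexp (t * (v - u)) \<partial>lborel) = of_real (2 * pi / h * std_normal_density ((v - u) / h))"
      unfolding E_def by (rule gaussian_fourier[OF h])
    finally show "(\<integral>t. \<Phi> t u \<partial>lborel) = of_real (m_exp u * exp (- \<delta> * u) * (2 * pi / h * std_normal_density ((v - u) / h)))"
      by (simp only: of_real_mult)
  qed
  also have "\<dots> = of_real (\<integral>u. m_exp u * exp (- \<delta> * u) * (2 * pi / h * std_normal_density ((v - u) / h)) \<partial>lborel)"
    by (rule integral_complex_of_real)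
  \<comment> \<open>Substitution u = v - h w.\<close>
  also have "(\<integral>u. m_exp u * exp (- \<delta> * u) * (2 * pi / h * std_normal_density ((v - u) / h)) \<partial>lborel) =
    \<bar>- h\<bar> *\<^sub>R (\<integral>w. m_exp (v + - h * w) * exp (- \<delta> * (v + - h * w)) * (2 * pi / h * std_normal_density ((v - (v + - h * w)) / h)) \<partial>lborel)"
    using h by (intro lborel_integral_real_affine) auto
  also have "\<dots> = h * (\<integral>w. 2 * pi / h * (m_exp (v - h * w) * exp (- \<delta> * (v - h * w)) * std_normal_density w) \<partial>lborel)"
    using h by (simp add: mult_ac)
  also have "\<dots> = 2 * pi * (\<integral>w. m_exp (v - h * w) * exp (- \<delta> * (v - h * w)) * std_normal_density w \<partial>lborel)"
    using h by (subst integral_mult_right_zero) simp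
  finally show ?thesis by (simp only: E_def)
qed

text \<open>1 + y <= e^y reduces this to 3 y - y^2/2 <= 9/2, which is (y - 3)^2 >= 0.\<close>

lemma cubic_gauss_bound: "y \<ge> 0 \<Longrightarrow> (1 + y) ^ 3 * exp (- y\<^sup>2 / 2) \<le> exp (9 / 2 :: real)"
proof -
  assume y: "y \<ge> 0"
  have "(1 + y) ^ 3 \<le> exp y ^ 3" using y by (intro power_mono exp_ge_add_one_self) auto
  also have "\<dots> = exp (3 * y)" by (simp flip: exp_of_nat_mult)
  finally have "(1 + y) ^ 3 * exp (- y\<^sup>2 / 2) \<le> exp (3 * y) * exp (- y\<^sup>2 / 2)"
    by (intro mult_right_mono) auto
  also have "\<dots> = exp (3 * y - y\<^sup>2 / 2)" by (simp flip: exp_add)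
  also have "3 * y - y\<^sup>2 / 2 \<le> 9 / 2"
    using zero_le_power2[of "y - 3"] by (simp add: power2_eq_square algebra_simps)
  finally show ?thesis by simp
qed

text \<open>The Gaussian absorbs the power 11/4 = 2 + 3/4 of 1 + |h t|. The square is for the
  polynomial factors produced by differentiating the Gaussian twice. The remaining (1 + |h
  t|)^(-3/4) yields, by 1 + |h t| >= h (1 + |t|), a factor (1 + |t|)^(-3/4) at the cost h^(-3/4).
  Together with the decay of 1/Z this makes the integrable weight (1 + |t|)^(-3/2).\<close>

lemma gauss_weight_bound:
  fixes h t :: real
  assumes h: "0 < h" "h \<le> 1"
  shows "(1 + \<bar>h * t\<bar>)\<^sup>2 * exp (- (h * t)\<^sup>2 / 2) \<le> exp (9/2) * h powr (- 3/4) * (1 + \<bar>t\<bar>) powr (- 3/4)"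
proof -
  define y where "y = \<bar>h * t\<bar>"
  have y: "y \<ge> 0" "y\<^sup>2 = (h * t)\<^sup>2" by (auto simp: y_def)
  have "h * (1 + \<bar>t\<bar>) \<le> 1 + y" using h by (simp add: y_def abs_mult algebra_simps)
  then have "(1 + y) powr (- 3/4) \<le> (h * (1 + \<bar>t\<bar>)) powr (- 3/4)"
    using h by (intro powr_mono2') auto
  also have "\<dots> = h powr (- 3/4) * (1 + \<bar>t\<bar>) powr (- 3/4)" using h by (simp add: powr_mult)
  finally have 1: "(1 + y) powr (- 3/4) \<le> h powr (- 3/4) * (1 + \<bar>t\<bar>) powr (- 3/4)" .
  have "(1 + y) powr (11/4) \<le> (1 + y) powr 3" using y by (intro powr_mono) auto
  also have "\<dots> = (1 + y) ^ 3" using y by (simp add: powr_numeral)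
  finally have 2: "(1 + y) powr (11/4) * exp (- y\<^sup>2 / 2) \<le> exp (9/2)"
    using cubic_gauss_bound[OF y(1)] by (smt (verit) exp_ge_zero mult_right_mono)
  have "(1 + y)\<^sup>2 = (1 + y) powr 2" using y by (simp add: powr_numeral)
  also have "\<dots> = (1 + y) powr (11/4) * (1 + y) powr (- 3/4)" by (simp flip: powr_add)
  finally have "(1 + y)\<^sup>2 * exp (- y\<^sup>2 / 2) = ((1 + y) powr (11/4) * exp (- y\<^sup>2 / 2)) * (1 + y) powr (- 3/4)" by simp
  also have "\<dots> \<le> exp (9/2) * (h powr (- 3/4) * (1 + \<bar>t\<bar>) powr (- 3/4))"
    using 1 2 by (intro mult_mono) auto
  finally show ?thesis by (simp add: y y_def mult_ac)
qed

lemma integrable_three_halves: "integrable lborel (\<lambda>t::real. (1 + \<bar>t\<bar>) powr (- 3/2))"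
proof -
  let ?f = "\<lambda>t::real. (1 + \<bar>t\<bar>) powr (- 3/2)"
  have "(\<integral>\<^sup>+t. ennreal (?f t) * indicator {0..} t \<partial>lborel) = ennreal (0 - (- 2 * (1 + 0) powr (- 1/2)))"
  proof (rule nn_integral_FTC_atLeast)
    show "((\<lambda>t. - 2 * (1 + t) powr (- 1/2)) has_real_derivative ?f t) (at t)" if "0 \<le> t" for t
      using that by (auto intro!: derivative_eq_intros)
    show "((\<lambda>t::real. - 2 * (1 + t) powr (- 1/2)) \<longlongrightarrow> 0) at_top" by real_asymp
  qed auto
  moreover have "ennreal (?f t) * indicator {0..} t = ennreal (indicator {0..} t * ?f t)" for t
    by (simp split: split_indicator)
  ultimately have "(\<integral>\<^sup>+t. ennreal (indicator {0..} t * ?f t) \<partial>lborel) = ennreal 2"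
    by simp
  then have "has_bochner_integral lborel (\<lambda>t. indicator {0..} t * ?f t) 2"
    by (intro has_bochner_integral_nn_integral) auto
  then have 1: "integrable lborel (\<lambda>t. indicator {0..} t * ?f t)" by (simp add: has_bochner_integral_iff)
  have 2: "integrable lborel (\<lambda>t. indicator {0..} (0 + (- 1) * t) * ?f (0 + (- 1) * t))"
    by (rule lborel_integrable_real_affine[OF 1]) simp
  show ?thesis
  proof (rule Bochner_Integration.integrable_bound[OF Bochner_Integration.integrable_add[OF 1 2]])
    show "AE t in lborel. norm (?f t) \<le> norm (indicator {0..} t * ?f t + indicator {0..} (0 + (- 1) * t) * ?f (0 + (- 1) * t))"
      by (intro AE_I2) (auto split: split_indicator)
  qed simp
qed

section \<open>Gaussian smoothing\<close>

lemma integral_derivative_eq_0: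
  fixes H H' :: "real \<Rightarrow> complex"
  assumes "\<And>t. (H has_vector_derivative H' t) (at t)" "\<And>t. isCont H' t" "integrable lborel H'"
    and "(H \<longlongrightarrow> 0) at_top" "(H \<longlongrightarrow> 0) at_bot"
  shows "integral\<^sup>L lborel H' = 0"
proof -
  have "(LBINT t=-\<infinity>..\<infinity>. H' t) = 0 - 0"
  proof (rule interval_integral_FTC_integrable)
    show "set_integrable lborel (einterval (-\<infinity>) \<infinity>) H'"
      using assms(3) by (simp add: set_integrable_def einterval_def)
    show "((H \<circ> real_of_ereal) \<longlongrightarrow> 0) (at_right (-\<infinity>))" "((H \<circ> real_of_ereal) \<longlongrightarrow> 0) (at_left \<infinity>)"
      using assms(4,5) by (simp_all add: ereal_tendsto_simps)
  qed (use assms in auto)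
  then show ?thesis
    by (simp add: interval_lebesgue_integral_def set_lebesgue_integral_def einterval_def)
qed

lemma isCont_rszeta2:
  assumes "- 1/2 < Re s" "szeta s \<noteq> 0"
  shows "isCont rszeta2 s"
proof -
  have op: "open {s. - 1 / 2 < Re s}" by (rule open_halfspace_Re_gt)
  have c: "isCont ((deriv ^^ n) szeta) s" for n
    using holomorphic_on_imp_continuous_on[OF holomorphic_higher_deriv[OF szeta_holomorphic op, of n]] op assms(1)
    by (auto simp: continuous_on_eq_continuous_at)
  show ?thesis
    unfolding rszeta2_def using assms(2) c[of 0] c[of 1] c[of 2]
    by (intro continuous_intros) auto
qed

lemma has_vector_derivative_along_vertical:
  assumes "(f has_field_derivative f') (at (Complex \<delta> t))"
  shows "((\<lambda>t. f (Complex \<delta> t)) has_vector_derivative \<i> * f') (at t)"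
proof -
  have "((\<lambda>t. Complex \<delta> t) has_vector_derivative \<i>) (at t)"
    unfolding Complex_eq by (auto intro!: derivative_eq_intros)
  then show ?thesis
    using field_vector_diff_chain_at[of "\<lambda>t. Complex \<delta> t" \<i> t f f'] assms by (simp add: o_def)
qed

text \<open>Both integrations by parts are done at once. With K = E/Z on the line, E being the
  Gaussian, H = (K' - i v K) e^(itv) has the derivative (K'' + v^2 K) e^(itv) and tends to 0 at both
  ends. Hence v^2 times the integral of K e^(itv) is minus that of K'' e^(itv).\<close>

lemma rszeta_gauss_bound:
  obtains C t0 where "C > 0" "0 < t0"
    "\<And>\<delta> h v. 0 < \<delta> \<Longrightarrow> \<delta> < t0 \<Longrightarrow> 0 < h \<Longrightarrow> h \<le> 1 \<Longrightarrow> v > 0 \<Longrightarrow>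
      norm (\<integral>t. rszeta (Complex \<delta> t) * of_real (exp (- (h * t)\<^sup>2 / 2)) * iexp (t * v) \<partial>lborel) \<le> C * h powr (- 3/4) / v\<^sup>2"
proof -
  obtain B t0 where B: "B > 0" "0 < t0" "t0 \<le> 1"
    "\<And>\<delta> t. 0 < \<delta> \<Longrightarrow> \<delta> < t0 \<Longrightarrow> szeta (Complex \<delta> t) \<noteq> 0"
    "\<And>\<delta> t. 0 < \<delta> \<Longrightarrow> \<delta> < t0 \<Longrightarrow> norm (rszeta (Complex \<delta> t)) \<le> B * (1 + \<bar>t\<bar>) powr (- 3/4)"
    "\<And>\<delta> t. 0 < \<delta> \<Longrightarrow> \<delta> < t0 \<Longrightarrow> norm (rszeta1 (Complex \<delta> t)) \<le> B * (1 + \<bar>t\<bar>) powr (- 3/4)"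
    "\<And>\<delta> t. 0 < \<delta> \<Longrightarrow> \<delta> < t0 \<Longrightarrow> norm (rszeta2 (Complex \<delta> t)) \<le> B * (1 + \<bar>t\<bar>) powr (- 3/4)"
    by (rule rszeta_bounds) blast
  define I where "I = (\<integral>t. (1 + \<bar>t\<bar>) powr (- 3/2 :: real) \<partial>lborel)"
  have I0: "I \<ge> 0" unfolding I_def by (rule integral_nonneg_AE) simp
  show ?thesis
  proof
    show "2 * B * exp (9/2) * I + 1 > 0" using B(1) I0 by (simp add: add_nonneg_pos)
    show "0 < t0" by (fact B)
    fix \<delta> h v :: real
    assume \<delta>: "0 < \<delta>" "\<delta> < t0" and h: "0 < h" "h \<le> 1" and v: "v > 0"
    define g where "g = (\<lambda>t. rszeta (Complex \<delta> t))"
    define g1 where "g1 = (\<lambda>t. rszeta1 (Complex \<delta> t))"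
    define g2 where "g2 = (\<lambda>t. rszeta2 (Complex \<delta> t))"
    define E where "E = (\<lambda>t. complex_of_real (exp (- (h * t)\<^sup>2 / 2)))"
    define e where "e = (\<lambda>t. iexp (t * v))"
    have dg: "(g has_vector_derivative \<i> * g1 t) (at t)" for t
      unfolding g_def g1_def using \<delta> B(4)[OF \<delta>]
      by (intro has_vector_derivative_along_vertical rszeta_derivatives) auto
    have dg1: "(g1 has_vector_derivative \<i> * g2 t) (at t)" for t
      unfolding g2_def g1_def using \<delta> B(4)[OF \<delta>]
      by (intro has_vector_derivative_along_vertical rszeta_derivatives) auto
    have dE: "(E has_vector_derivative - of_real (h\<^sup>2 * t) * E t) (at t)" for t
    proof -
      have "((\<lambda>t. exp (- (h * t)\<^sup>2 / 2)) has_real_derivative - (h\<^sup>2 * t) * exp (- (h * t)\<^sup>2 / 2)) (at t)"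
        by (auto intro!: derivative_eq_intros simp: power2_eq_square)
      from has_vector_derivative_of_real[OF this]
      show ?thesis unfolding E_def by simp
    qed
    have de: "(e has_vector_derivative \<i> * of_real v * e t) (at t)" for t
      unfolding e_def by (auto intro!: derivative_eq_intros has_vector_derivative_real_field)
    have dr: "((\<lambda>t. complex_of_real (h\<^sup>2 * t)) has_vector_derivative of_real (h\<^sup>2)) (at t)" for t
      by (auto intro!: derivative_eq_intros)
    define K where "K = (\<lambda>t. g t * E t)"
    define K1 where "K1 = (\<lambda>t. \<i> * g1 t * E t - of_real (h\<^sup>2 * t) * g t * E t)"
    \<comment> \<open>K'' by the product rule, with E' = -h^2 t E; each derivative of 1/Z along the
      vertical line contributes a factor i.\<close>
    define K2 where "K2 = (\<lambda>t. - g2 t * E t - 2 * \<i> * of_real (h\<^sup>2 * t) * g1 t * E t + of_real ((h\<^sup>2 * t)\<^sup>2 - h\<^sup>2) * g t * E t)"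
    have dK: "(K has_vector_derivative K1 t) (at t)" for t
      unfolding K_def K1_def
      by (rule has_vector_derivative_eq_rhs[OF has_vector_derivative_mult[OF dg dE]]) (simp add: algebra_simps)
    have dK1: "(K1 has_vector_derivative K2 t) (at t)" for t
    proof -
      have "(K1 has_vector_derivative
         (\<i> * g1 t * (- of_real (h\<^sup>2 * t) * E t) + \<i> * (\<i> * g2 t) * E t) -
         ((of_real (h\<^sup>2 * t) * g t) * (- of_real (h\<^sup>2 * t) * E t) + (of_real (h\<^sup>2 * t) * (\<i> * g1 t) + of_real (h\<^sup>2) * g t) * E t)) (at t)"
        unfolding K1_def
        by (intro has_vector_derivative_diff has_vector_derivative_mult has_vector_derivative_mult_right dg dg1 dE dr)
      then show ?thesis
        by (rule has_vector_derivative_eq_rhs) (simp add: K2_def power2_eq_square algebra_simps)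
    qed
    define H where "H = (\<lambda>t. (K1 t - \<i> * of_real v * K t) * e t)"
    have dH: "(H has_vector_derivative (K2 t + of_real (v\<^sup>2) * K t) * e t) (at t)" for t
    proof -
      have "(H has_vector_derivative (K1 t - \<i> * of_real v * K t) * (\<i> * of_real v * e t) + (K2 t - \<i> * of_real v * K1 t) * e t) (at t)"
        unfolding H_def by (intro has_vector_derivative_mult has_vector_derivative_diff has_vector_derivative_mult_right dK dK1 de)
      then show ?thesis
        by (rule has_vector_derivative_eq_rhs) (simp add: power2_eq_square algebra_simps)
    qed
    define b where "b = 2 * B * exp (9/2) * h powr (- 3/4)"
    have b0: "b \<ge> 0" using B by (simp add: b_def)
    \<comment> \<open>K, K' and K'' all have the form X E, where X is bounded by a polynomial of
      degree at most 2 in |h t| times the common bound for 1/Z and its derivatives; 2 (1 + |h t|)^2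
      majorises all three polynomials.\<close>
    have bound: "norm X * norm (E t) \<le> b * (1 + \<bar>t\<bar>) powr (- 3/2)"
      if X: "norm X \<le> 2 * (1 + \<bar>h * t\<bar>)\<^sup>2 * (B * (1 + \<bar>t\<bar>) powr (- 3/4))" for X :: complex and t
    proof -
      have "norm X * norm (E t) \<le> (2 * (1 + \<bar>h * t\<bar>)\<^sup>2 * (B * (1 + \<bar>t\<bar>) powr (- 3/4))) * exp (- (h * t)\<^sup>2 / 2)"
        using X by (simp add: E_def mult_right_mono)
      also have "\<dots> = (2 * B * (1 + \<bar>t\<bar>) powr (- 3/4)) * ((1 + \<bar>h * t\<bar>)\<^sup>2 * exp (- (h * t)\<^sup>2 / 2))"
        by (simp only: mult_ac)
      also have "\<dots> \<le> (2 * B * (1 + \<bar>t\<bar>) powr (- 3/4)) * (exp (9/2) * h powr (- 3/4) * (1 + \<bar>t\<bar>) powr (- 3/4))"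
        using B(1) by (intro mult_left_mono gauss_weight_bound h) auto
      also have "\<dots> = b * ((1 + \<bar>t\<bar>) powr (- 3/4) * (1 + \<bar>t\<bar>) powr (- 3/4))"
        by (simp add: b_def mult_ac)
      also have "(1 + \<bar>t\<bar>) powr (- 3/4) * (1 + \<bar>t\<bar>) powr (- 3/4) = (1 + \<bar>t\<bar>) powr (- 3/2)"
        by (subst powr_add[symmetric]) simp
      finally show ?thesis .
    qed
    have g_le: "norm (g t) \<le> B * (1 + \<bar>t\<bar>) powr (- 3/4)" "norm (g1 t) \<le> B * (1 + \<bar>t\<bar>) powr (- 3/4)"
      "norm (g2 t) \<le> B * (1 + \<bar>t\<bar>) powr (- 3/4)" for t
      unfolding g_def g1_def g2_def by (intro B(5-7) \<delta>)+
    \<comment> \<open>By h <= 1, the factors h^2 |t| that come from E' are bounded by |h t|.\<close>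
    have ht: "\<bar>h\<^sup>2 * t\<bar> \<le> \<bar>h * t\<bar>" for t
    proof -
      have "\<bar>h\<^sup>2 * t\<bar> = h * \<bar>h * t\<bar>" using h by (simp add: power2_eq_square abs_mult)
      also have "\<dots> \<le> 1 * \<bar>h * t\<bar>" using h by (intro mult_right_mono) auto
      finally show ?thesis by simp
    qed
    have q1: "1 + y \<le> 2 * (1 + y)\<^sup>2" and q2: "2 + 2 * y + y\<^sup>2 \<le> 2 * (1 + y)\<^sup>2" if "y \<ge> 0" for y :: real
    proof -
      have "2 * (1 + y)\<^sup>2 = 2 + 4 * y + 2 * y\<^sup>2" by (simp add: power2_eq_square algebra_simps)
      then show "1 + y \<le> 2 * (1 + y)\<^sup>2" "2 + 2 * y + y\<^sup>2 \<le> 2 * (1 + y)\<^sup>2"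
        using that zero_le_power2[of y] by linarith+
    qed
    have h2: "h\<^sup>2 \<le> 1" using h by (simp add: power_le_one)
    have bK: "norm (K t) \<le> b * (1 + \<bar>t\<bar>) powr (- 3/2)" for t
    proof -
      have "1 \<le> (1 + \<bar>h * t\<bar>)\<^sup>2" by (rule one_le_power) simp
      then have le: "1 \<le> 2 * (1 + \<bar>h * t\<bar>)\<^sup>2" by linarith
      have "1 * (B * (1 + \<bar>t\<bar>) powr (- 3/4)) \<le> (2 * (1 + \<bar>h * t\<bar>)\<^sup>2) * (B * (1 + \<bar>t\<bar>) powr (- 3/4))"
        using B(1) by (intro mult_right_mono le) auto
      then show ?thesis unfolding K_def norm_mult using g_le(1)[of t] by (intro bound) simp
    qed
    have bK1: "norm (K1 t) \<le> b * (1 + \<bar>t\<bar>) powr (- 3/2)" for t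
    proof -
      let ?P = "B * (1 + \<bar>t\<bar>) powr (- 3/4)"
      have "norm (\<i> * g1 t - of_real (h\<^sup>2 * t) * g t) \<le> norm (g1 t) + \<bar>h\<^sup>2 * t\<bar> * norm (g t)"
        by (rule order_trans[OF norm_triangle_ineq4]) (simp add: norm_mult del: of_real_mult of_real_power)
      also have "\<dots> \<le> ?P + \<bar>h * t\<bar> * ?P"
        using g_le ht by (intro add_mono mult_mono) auto
      also have "\<dots> = (1 + \<bar>h * t\<bar>) * ?P" by (simp add: algebra_simps)
      also have "\<dots> \<le> (2 * (1 + \<bar>h * t\<bar>)\<^sup>2) * ?P"
        using B(1) by (intro mult_right_mono q1) auto
      finally have "norm (\<i> * g1 t - of_real (h\<^sup>2 * t) * g t) * norm (E t) \<le> b * (1 + \<bar>t\<bar>) powr (- 3/2)"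
        by (rule bound)
      then show ?thesis unfolding K1_def by (simp add: left_diff_distrib flip: norm_mult)
    qed
    have bK2: "norm (K2 t) \<le> b * (1 + \<bar>t\<bar>) powr (- 3/2)" for t
    proof -
      let ?P = "B * (1 + \<bar>t\<bar>) powr (- 3/4)"
      let ?X = "- g2 t - 2 * \<i> * of_real (h\<^sup>2 * t) * g1 t + of_real ((h\<^sup>2 * t)\<^sup>2 - h\<^sup>2) * g t"
      have "norm ?X \<le> norm (g2 t) + 2 * \<bar>h\<^sup>2 * t\<bar> * norm (g1 t) + \<bar>(h\<^sup>2 * t)\<^sup>2 - h\<^sup>2\<bar> * norm (g t)"
        by (intro order_trans[OF norm_triangle_ineq] add_mono order_trans[OF norm_triangle_ineq4]) (simp_all add: norm_mult del: of_real_diff of_real_mult of_real_power)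
      also have "\<dots> \<le> ?P + 2 * \<bar>h * t\<bar> * ?P + (\<bar>h * t\<bar>\<^sup>2 + 1) * ?P"
      proof (intro add_mono mult_mono g_le)
        have "\<bar>h\<^sup>2 * t\<bar>\<^sup>2 \<le> \<bar>h * t\<bar>\<^sup>2" using ht by (intro power_mono) auto
        then show "\<bar>(h\<^sup>2 * t)\<^sup>2 - h\<^sup>2\<bar> \<le> \<bar>h * t\<bar>\<^sup>2 + 1" using h2 zero_le_power2[of h] zero_le_power2[of "h\<^sup>2 * t"]
          unfolding power2_abs by linarith
      qed (use ht in auto)
      also have "\<dots> = (2 + 2 * \<bar>h * t\<bar> + \<bar>h * t\<bar>\<^sup>2) * ?P" by (simp add: algebra_simps)
      also have "\<dots> \<le> (2 * (1 + \<bar>h * t\<bar>)\<^sup>2) * ?P"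
        using B(1) by (intro mult_right_mono q2) auto
      finally have "norm ?X * norm (E t) \<le> b * (1 + \<bar>t\<bar>) powr (- 3/2)" by (rule bound)
      moreover have "K2 t = ?X * E t" unfolding K2_def by (simp only: distrib_right left_diff_distrib)
      ultimately show ?thesis by (simp only: norm_mult)
    qed
    have ne: "norm (e t) = 1" for t by (simp add: e_def)
    have cont: "continuous_on UNIV g" "continuous_on UNIV g1" "continuous_on UNIV E" "continuous_on UNIV e"
      using dg dg1 dE de by (auto intro!: continuous_at_imp_continuous_on has_vector_derivative_continuous)
    have contg2: "continuous_on UNIV g2"
    proof (rule continuous_at_imp_continuous_on, rule ballI)
      fix t
      have "isCont (\<lambda>t. Complex \<delta> t) t" unfolding Complex_eq by (intro continuous_intros)
      then show "isCont g2 t" unfolding g2_def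
        using isCont_o2[of t "\<lambda>t. Complex \<delta> t" rszeta2] isCont_rszeta2[of "Complex \<delta> t"] B(4)[OF \<delta>] \<delta> by simp
    qed
    have cK: "continuous_on UNIV K" "continuous_on UNIV K1" "continuous_on UNIV K2"
      unfolding K_def K1_def K2_def by (intro continuous_intros cont contg2)+
    have int: "integrable lborel (\<lambda>t. X t * e t)"
      if "continuous_on UNIV X" "\<And>t. norm (X t) \<le> b * (1 + \<bar>t\<bar>) powr (- 3/2)" for X
    proof (rule Bochner_Integration.integrable_bound)
      show "integrable lborel (\<lambda>t::real. b * (1 + \<bar>t\<bar>) powr (- 3/2))"
        by (intro integrable_mult_right integrable_three_halves)
      have "continuous_on UNIV (\<lambda>t. X t * e t)" by (intro continuous_intros cont that)
      then show "(\<lambda>t. X t * e t) \<in> borel_measurable lborel"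
        by (simp add: borel_measurable_continuous_onI)
      show "AE t in lborel. norm (X t * e t) \<le> norm (b * (1 + \<bar>t\<bar>) powr (- 3/2))"
        using that(2) b0 by (intro AE_I2) (simp add: norm_mult ne)
    qed
    have iK: "integrable lborel (\<lambda>t. K t * e t)" by (rule int[OF cK(1) bK])
    have iK2: "integrable lborel (\<lambda>t. K2 t * e t)" by (rule int[OF cK(3) bK2])
    have "integral\<^sup>L lborel (\<lambda>t. (K2 t + of_real (v\<^sup>2) * K t) * e t) = 0"
    proof (rule integral_derivative_eq_0[OF dH])
      have "continuous_on UNIV (\<lambda>t. (K2 t + of_real (v\<^sup>2) * K t) * e t)"
        by (intro continuous_intros cK cont)
      then show "isCont (\<lambda>t. (K2 t + of_real (v\<^sup>2) * K t) * e t) t" for t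
        by (simp add: continuous_on_eq_continuous_at)
      have "integrable lborel (\<lambda>t. K2 t * e t + of_real (v\<^sup>2) * (K t * e t))"
        by (intro Bochner_Integration.integrable_add integrable_mult_right iK iK2)
      then show "integrable lborel (\<lambda>t. (K2 t + of_real (v\<^sup>2) * K t) * e t)"
        by (simp add: algebra_simps)
      have "norm (H t) \<le> (1 + v) * b * (1 + \<bar>t\<bar>) powr (- 3/2)" for t
      proof -
        have "norm (H t) = norm (K1 t - \<i> * of_real v * K t)" by (simp add: H_def norm_mult ne)
        also have "\<dots> \<le> norm (K1 t) + v * norm (K t)"
          using v by (intro order_trans[OF norm_triangle_ineq4]) (simp add: norm_mult)
        also have "\<dots> \<le> b * (1 + \<bar>t\<bar>) powr (- 3/2) + v * (b * (1 + \<bar>t\<bar>) powr (- 3/2))"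
          using v by (intro add_mono mult_left_mono bK bK1) auto
        finally show ?thesis by (simp add: algebra_simps)
      qed
      note Hb = this
      have "((\<lambda>t::real. (1 + \<bar>t\<bar>) powr (- 3/2)) \<longlongrightarrow> 0) at_top" by real_asymp
      then have "((\<lambda>t. (1 + v) * b * (1 + \<bar>t\<bar>) powr (- 3/2)) \<longlongrightarrow> 0) at_top" by (rule tendsto_mult_right_zero)
      then show "(H \<longlongrightarrow> 0) at_top" by (rule Lim_null_comparison[rotated]) (intro always_eventually allI Hb)
      have "((\<lambda>t::real. (1 + \<bar>t\<bar>) powr (- 3/2)) \<longlongrightarrow> 0) at_bot" by real_asymp
      then have "((\<lambda>t. (1 + v) * b * (1 + \<bar>t\<bar>) powr (- 3/2)) \<longlongrightarrow> 0) at_bot" by (rule tendsto_mult_right_zero)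
      then show "(H \<longlongrightarrow> 0) at_bot" by (rule Lim_null_comparison[rotated]) (intro always_eventually allI Hb)
    qed
    moreover have "integral\<^sup>L lborel (\<lambda>t. (K2 t + of_real (v\<^sup>2) * K t) * e t) = integral\<^sup>L lborel (\<lambda>t. K2 t * e t) + of_real (v\<^sup>2) * integral\<^sup>L lborel (\<lambda>t. K t * e t)"
    proof -
      have "integral\<^sup>L lborel (\<lambda>t. K2 t * e t + of_real (v\<^sup>2) * (K t * e t)) = integral\<^sup>L lborel (\<lambda>t. K2 t * e t) + of_real (v\<^sup>2) * integral\<^sup>L lborel (\<lambda>t. K t * e t)"
        by (subst Bochner_Integration.integral_add) (intro integrable_mult_right iK iK2, simp_all only: integral_mult_right_zero, intro integrable_mult_right iK)
      then show ?thesis by (simp only: distrib_right mult.assoc)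
    qed
    ultimately have "of_real (v\<^sup>2) * integral\<^sup>L lborel (\<lambda>t. K t * e t) = - integral\<^sup>L lborel (\<lambda>t. K2 t * e t)"
      by (simp add: add_eq_0_iff)
    then have "v\<^sup>2 * norm (integral\<^sup>L lborel (\<lambda>t. K t * e t)) = norm (integral\<^sup>L lborel (\<lambda>t. K2 t * e t))"
      by (drule_tac arg_cong[where f = norm]) (simp add: norm_mult del: of_real_power)
    also have "\<dots> \<le> (\<integral>t. norm (K2 t * e t) \<partial>lborel)" by (rule integral_norm_bound)
    also have "\<dots> \<le> (\<integral>t. b * (1 + \<bar>t\<bar>) powr (- 3/2) \<partial>lborel)"
      using bK2 by (intro integral_mono integrable_norm iK2 integrable_mult_right integrable_three_halves) (simp add: norm_mult ne)
    also have "\<dots> = b * I" by (simp add: I_def)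
    finally have "norm (integral\<^sup>L lborel (\<lambda>t. K t * e t)) \<le> b * I / v\<^sup>2"
      using v by (simp add: field_simps)
    also have "\<dots> \<le> (2 * B * exp (9/2) * I + 1) * h powr (- 3/4) / v\<^sup>2"
      by (intro divide_right_mono) (auto simp: b_def algebra_simps)
    finally show "norm (\<integral>t. rszeta (Complex \<delta> t) * of_real (exp (- (h * t)\<^sup>2 / 2)) * iexp (t * v) \<partial>lborel) \<le> (2 * B * exp (9/2) * I + 1) * h powr (- 3/4) / v\<^sup>2"
      by (simp only: K_def g_def E_def e_def)
  qed
qed

text \<open>The bound is uniform in \<delta>, and \<delta> tends to 0 by dominated convergence.
  Since m(e^u) = 0 for u < 0, the factor e^(-\<delta> (v - h w)) is at most 1 wherever the integrand
  does not vanish, so 1 + v + |w| times the normal density dominates.\<close>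

lemma smoothed_fm_bound:
  obtains C where "C > 0"
    "\<And>h v. 0 < h \<Longrightarrow> h \<le> 1 \<Longrightarrow> v > 0 \<Longrightarrow>
      \<bar>\<integral>w. m_exp (v - h * w) * std_normal_density w \<partial>lborel\<bar> \<le> C * h powr (- 3/4) / v\<^sup>2"
proof -
  obtain C t0 where C: "C > 0" "0 < t0"
    "\<And>\<delta> h v. 0 < \<delta> \<Longrightarrow> \<delta> < t0 \<Longrightarrow> 0 < h \<Longrightarrow> h \<le> 1 \<Longrightarrow> v > 0 \<Longrightarrow>
      norm (\<integral>t. rszeta (Complex \<delta> t) * of_real (exp (- (h * t)\<^sup>2 / 2)) * iexp (t * v) \<partial>lborel) \<le> C * h powr (- 3/4) / v\<^sup>2"
    using rszeta_gauss_bound by blast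
  show ?thesis
  proof
    show "C > 0" by (fact C)
    fix h v :: real
    assume h: "0 < h" "h \<le> 1" and v: "v > 0"
    \<comment> \<open>The values t0/(k+2) tend to 0 and lie strictly below t0 already at k =
      0.\<close>
    let ?s = "\<lambda>k w. m_exp (v - h * w) * exp (- (t0 / (real k + 2)) * (v - h * w)) * std_normal_density w"
    let ?f = "\<lambda>w. m_exp (v - h * w) * std_normal_density w"
    have bd: "\<bar>integral\<^sup>L lborel (?s k)\<bar> \<le> C * h powr (- 3/4) / v\<^sup>2" for k
    proof -
      let ?d = "t0 / (real k + 2)"
      have d: "0 < ?d" "?d < t0" using C(2) by (auto simp: field_simps intro: add_pos_nonneg)
      have "2 * pi * \<bar>integral\<^sup>L lborel (?s k)\<bar> = norm (complex_of_real (2 * pi * integral\<^sup>L lborel (?s k)))"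
        by (simp only: norm_of_real abs_mult) simp
      also have "\<dots> \<le> C * h powr (- 3/4) / v\<^sup>2"
        using C(3)[OF d h v] unfolding gauss_smoothing_identity[OF d(1) h(1)] .
      finally have "2 * pi * \<bar>integral\<^sup>L lborel (?s k)\<bar> \<le> C * h powr (- 3/4) / v\<^sup>2" .
      moreover have "1 * \<bar>integral\<^sup>L lborel (?s k)\<bar> \<le> 2 * pi * \<bar>integral\<^sup>L lborel (?s k)\<bar>"
        using pi_ge_two by (intro mult_right_mono) auto
      ultimately show ?thesis by linarith
    qed
    have "(\<lambda>k. integral\<^sup>L lborel (?s k)) \<longlonglongrightarrow> integral\<^sup>L lborel ?f"
    proof (rule integral_dominated_convergence[where w = "\<lambda>w. (1 + v) * std_normal_density w + std_normal_density w * \<bar>w\<bar> ^ 1"])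
      show "integrable lborel (\<lambda>w. (1 + v) * std_normal_density w + std_normal_density w * \<bar>w\<bar> ^ 1)"
        by (intro Bochner_Integration.integrable_add integrable_mult_right integrable_std_normal_moment_abs) simp
      have "(\<lambda>k. t0 / (real k + 2)) \<longlonglongrightarrow> 0" by real_asymp
      then have "(\<lambda>k. m_exp (v - h * w) * exp (- (t0 / (real k + 2)) * (v - h * w)) * std_normal_density w) \<longlonglongrightarrow> m_exp (v - h * w) * exp (- 0 * (v - h * w)) * std_normal_density w" for w
        by (intro tendsto_intros)
      then show "AE w in lborel. (\<lambda>k. ?s k w) \<longlonglongrightarrow> ?f w" by simp
      show "AE w in lborel. norm (?s k w) \<le> (1 + v) * std_normal_density w + std_normal_density w * \<bar>w\<bar> ^ 1" for k
      proof (intro AE_I2)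
        fix w :: real
        have "\<bar>m_exp (v - h * w)\<bar> * exp (- (t0 / (real k + 2)) * (v - h * w)) \<le> 1 + v + \<bar>w\<bar>"
        proof (cases "v - h * w < 0")
          case True
          then show ?thesis using v by (simp add: m_exp_neg)
        next
          case False
          have "0 \<le> (t0 / (real k + 2)) * (v - h * w)" using False C(2) by (intro mult_nonneg_nonneg) auto
          then have "exp (- (t0 / (real k + 2)) * (v - h * w)) \<le> 1" by simp
          then have "\<bar>m_exp (v - h * w)\<bar> * exp (- (t0 / (real k + 2)) * (v - h * w)) \<le> (1 + \<bar>v - h * w\<bar>) * 1"
            by (intro mult_mono abs_m_exp_le) auto
          also have "\<dots> = 1 + \<bar>v - h * w\<bar>" by simp
          also have "\<bar>v - h * w\<bar> \<le> v + \<bar>h * w\<bar>" using v by linarith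
          also have "\<bar>h * w\<bar> \<le> 1 * \<bar>w\<bar>" unfolding abs_mult using h by (intro mult_right_mono) auto
          finally show ?thesis by (simp add: add.assoc)
        qed
        then have "\<bar>m_exp (v - h * w)\<bar> * exp (- (t0 / (real k + 2)) * (v - h * w)) * std_normal_density w \<le> (1 + v + \<bar>w\<bar>) * std_normal_density w"
          by (intro mult_right_mono) auto
        then show "norm (?s k w) \<le> (1 + v) * std_normal_density w + std_normal_density w * \<bar>w\<bar> ^ 1"
          by (simp add: abs_mult algebra_simps)
      qed
    qed auto
    then have "(\<lambda>k. \<bar>integral\<^sup>L lborel (?s k)\<bar>) \<longlonglongrightarrow> \<bar>integral\<^sup>L lborel ?f\<bar>"
      by (rule tendsto_rabs)
    then show "\<bar>integral\<^sup>L lborel ?f\<bar> \<le> C * h powr (- 3/4) / v\<^sup>2"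
      by (rule LIMSEQ_le_const2) (use bd in blast)
  qed
qed

text \<open>From v/2 on, \<open>m_exp_upper_diff\<close> applies with a jump term at most e^(-v/2).
  Below v/2 only the trivial bound 2 + 3v/2 is available, but there |a - v| > v/2, and 2 + 3v/2 <=
  5v/2 for v >= 2; this fixes the constant 5.\<close>

lemma m_exp_diff_le:
  assumes v: "v \<ge> 2"
  shows "\<bar>m_exp a - m_exp v\<bar> \<le> 5 * \<bar>a - v\<bar> + exp (- v / 2)"
proof -
  consider "a \<ge> v" | "v / 2 \<le> a" "a < v" | "a < v / 2" by linarith
  then show ?thesis
  proof cases
    case 1
    have "\<bar>m_exp a - m_exp v\<bar> \<le> (a - v) + exp (- v)" using 1 v by (intro m_exp_upper_diff) auto
    also have "\<dots> \<le> 5 * \<bar>a - v\<bar> + exp (- v / 2)" using 1 v by (intro add_mono) auto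
    finally show ?thesis .
  next
    case 2
    have "\<bar>m_exp a - m_exp v\<bar> \<le> (v - a) + exp (- a)"
      using 2 v by (subst abs_minus_commute, intro m_exp_upper_diff) auto
    also have "\<dots> \<le> 5 * \<bar>a - v\<bar> + exp (- v / 2)" using 2 v by (intro add_mono) auto
    finally show ?thesis .
  next
    case 3
    have fa: "\<bar>m_exp a\<bar> \<le> 1 + v / 2"
    proof (cases "a < 0")
      case True
      then show ?thesis using v by (simp add: m_exp_neg)
    next
      case False
      then show ?thesis using 3 abs_m_exp_le[of a] by linarith
    qed
    have fv: "\<bar>m_exp v\<bar> \<le> 1 + v" using abs_m_exp_le[of v] v by simp
    have "\<bar>m_exp a - m_exp v\<bar> \<le> (1 + v / 2) + (1 + v)"
      by (rule order_trans[OF abs_triangle_ineq4 add_mono[OF fa fv]])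
    also have "\<dots> \<le> 5 * (v - a)" using 3 v by (simp add: field_simps)
    also have "\<dots> \<le> 5 * \<bar>a - v\<bar> + exp (- v / 2)" using 3 v by simp
    finally show ?thesis .
  qed
qed

lemma exp_half_le_powr:
  fixes v :: real
  assumes v: "v \<ge> 1"
  shows "exp (- v / 2) \<le> 16 * v powr (- 8/7)"
proof -
  have "v / 4 \<le> exp (v / 4)" using exp_ge_add_one_self[of "v / 4"] by linarith
  then have "(v / 4)\<^sup>2 \<le> exp (v / 4) ^ 2" using v by (intro power_mono) auto
  also have "\<dots> = exp (v / 2)" by (simp flip: exp_of_nat_mult)
  finally have "v\<^sup>2 / 16 \<le> exp (v / 2)" by (simp add: power_divide)
  then have "exp (- v / 2) \<le> 16 * (1 / v\<^sup>2)" using v by (simp add: exp_minus field_simps)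
  also have "1 / v\<^sup>2 = v powr (- 2)" using v by (simp add: powr_minus_divide powr_numeral)
  also have "\<dots> \<le> v powr (- 8/7)" using v by (intro powr_mono) auto
  finally show ?thesis by simp
qed

lemma m_exp_bound:
  obtains C where "C > 0" "\<And>v. v \<ge> 2 \<Longrightarrow> \<bar>m_exp v\<bar> \<le> C * v powr (- 8/7)"
proof -
  obtain C where C: "C > 0"
    "\<And>h v. 0 < h \<Longrightarrow> h \<le> 1 \<Longrightarrow> v > 0 \<Longrightarrow>
      \<bar>\<integral>w. m_exp (v - h * w) * std_normal_density w \<partial>lborel\<bar> \<le> C * h powr (- 3/4) / v\<^sup>2"
    using smoothed_fm_bound by blast
  show ?thesis
  proof
    \<comment> \<open>21 = 5 + 16: 5 from \<open>m_exp_diff_le\<close> together with the first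
      absolute moment sqrt(2/pi) <= 1, and 16 from e^(-v/2) <= 16 v^(-8/7).\<close>
    show "C + 21 > 0" using C by simp
    fix v :: real assume v: "v \<ge> 2"
    define h where "h = v powr (- 8/7)"
    have h: "0 < h" "h \<le> 1" using v powr_mono[of "- 8/7" 0 v] by (auto simp: h_def)
    let ?e = "exp (- v / 2)"
    have i0: "integrable lborel (\<lambda>w. m_exp v * std_normal_density w)" by simp
    have iw: "integrable lborel (\<lambda>w. 5 * h * (std_normal_density w * \<bar>w\<bar>) + ?e * std_normal_density w)"
      using integrable_std_normal_moment_abs[of 1]
      by (intro Bochner_Integration.integrable_add integrable_mult_right) auto
    have le: "\<bar>m_exp (v - h * w) - m_exp v\<bar> * std_normal_density w \<le> 5 * h * (std_normal_density w * \<bar>w\<bar>) + ?e * std_normal_density w" for w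
    proof -
      have "\<bar>m_exp (v - h * w) - m_exp v\<bar> \<le> 5 * \<bar>h * w\<bar> + ?e"
        using m_exp_diff_le[OF v, of "v - h * w"] by simp
      then have "\<bar>m_exp (v - h * w) - m_exp v\<bar> * std_normal_density w \<le> (5 * \<bar>h * w\<bar> + ?e) * std_normal_density w"
        by (intro mult_right_mono) auto
      then show ?thesis using h by (simp add: abs_mult algebra_simps)
    qed
    have id: "integrable lborel (\<lambda>w. (m_exp (v - h * w) - m_exp v) * std_normal_density w)"
    proof (rule Bochner_Integration.integrable_bound[OF iw])
      show "AE w in lborel. norm ((m_exp (v - h * w) - m_exp v) * std_normal_density w) \<le> norm (5 * h * (std_normal_density w * \<bar>w\<bar>) + ?e * std_normal_density w)"
        using le h by (intro AE_I2) (simp add: abs_mult order_trans[OF le])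
    qed simp
    have "integral\<^sup>L lborel (\<lambda>w. m_exp v * std_normal_density w + (m_exp (v - h * w) - m_exp v) * std_normal_density w) =
      integral\<^sup>L lborel (\<lambda>w. m_exp v * std_normal_density w) + integral\<^sup>L lborel (\<lambda>w. (m_exp (v - h * w) - m_exp v) * std_normal_density w)"
      by (rule Bochner_Integration.integral_add[OF i0 id])
    moreover have "integral\<^sup>L lborel (\<lambda>w. m_exp v * std_normal_density w) = m_exp v" by simp
    moreover have "(\<lambda>w. m_exp v * std_normal_density w + (m_exp (v - h * w) - m_exp v) * std_normal_density w) = (\<lambda>w. m_exp (v - h * w) * std_normal_density w)"
      by (simp add: algebra_simps)
    \<comment> \<open>The density has total mass 1, so m(e^v) is the smoothed average minus the
      average of the differences.\<close>
    ultimately have eq: "m_exp v = integral\<^sup>L lborel (\<lambda>w. m_exp (v - h * w) * std_normal_density w) - integral\<^sup>L lborel (\<lambda>w. (m_exp (v - h * w) - m_exp v) * std_normal_density w)"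
      by simp
    have "\<bar>integral\<^sup>L lborel (\<lambda>w. (m_exp (v - h * w) - m_exp v) * std_normal_density w)\<bar> \<le> integral\<^sup>L lborel (\<lambda>w. \<bar>(m_exp (v - h * w) - m_exp v) * std_normal_density w\<bar>)"
      by (rule integral_abs_bound)
    also have "\<dots> \<le> integral\<^sup>L lborel (\<lambda>w. 5 * h * (std_normal_density w * \<bar>w\<bar>) + ?e * std_normal_density w)"
      using le by (intro integral_mono integrable_abs id iw) (simp add: abs_mult)
    also have "\<dots> = 5 * h * integral\<^sup>L lborel (\<lambda>w. std_normal_density w * \<bar>w\<bar>) + ?e"
    proof -
      have "integrable lborel (\<lambda>w. std_normal_density w * \<bar>w\<bar>)" using integrable_std_normal_moment_abs[of 1] by simp
      then show ?thesis by (subst Bochner_Integration.integral_add) auto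
    qed
    also have "integral\<^sup>L lborel (\<lambda>w. std_normal_density w * \<bar>w\<bar>) = sqrt (2 / pi)"
      using integral_std_normal_moment_abs_odd[of 0] by simp
    also have "5 * h * sqrt (2 / pi) + ?e \<le> 5 * h * 1 + 16 * h"
      using h pi_ge_two v exp_half_le_powr[of v] by (intro add_mono mult_left_mono) (auto simp: h_def)
    finally have 1: "\<bar>integral\<^sup>L lborel (\<lambda>w. (m_exp (v - h * w) - m_exp v) * std_normal_density w)\<bar> \<le> 21 * h" by simp
    \<comment> \<open>6/7 - 2 = -8/7, so the bound for the smoothed average equals C h.\<close>
    have "h powr (- 3/4) = v powr (6/7)" unfolding h_def powr_powr by simp
    moreover have "1 / v\<^sup>2 = v powr (- 2)" using v by (simp add: powr_minus_divide powr_numeral)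
    ultimately have "C * h powr (- 3/4) / v\<^sup>2 = C * (v powr (6/7) * v powr (- 2))"
      by (metis mult.assoc mult.right_neutral times_divide_eq_right)
    also have "v powr (6/7) * v powr (- 2) = h" by (subst powr_add[symmetric]) (simp add: h_def)
    finally have "\<bar>integral\<^sup>L lborel (\<lambda>w. m_exp (v - h * w) * std_normal_density w)\<bar> \<le> C * h"
      using C(2)[OF h, of v] v by simp
    then have "\<bar>m_exp v\<bar> \<le> C * h + 21 * h" using eq 1 by linarith
    then show "\<bar>m_exp v\<bar> \<le> (C + 21) * v powr (- 8/7)" by (simp add: h_def algebra_simps)
  qed
qed

text \<open>The variable is 1 + ln M rather than ln M: at M = 1 the latter is 0, and as
  \<open>0 powr (- 8/7) = 0\<close> the bound would fail there.\<close>

lemma mu_sum_bound: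
  obtains C where "C \<ge> 0" "\<And>M. M \<ge> 1 \<Longrightarrow> \<bar>mu_sum M\<bar> \<le> C * (1 + ln (real M)) powr (- 8/7)"
proof -
  obtain C where C: "C > 0" "\<And>v. v \<ge> 2 \<Longrightarrow> \<bar>m_exp v\<bar> \<le> C * v powr (- 8/7)"
    using m_exp_bound by blast
  show ?thesis
  proof
    \<comment> \<open>The 4 bounds 2^(8/7), the price of replacing v by 1 + v <= 2v when v >= 2. For
      v < 2 the trivial bound 3 = 27/9 is compared with (1+v)^(-8/7) >= 3^(-2).\<close>
    show "4 * C + 27 \<ge> 0" using C by simp
    fix M :: nat assume M: "M \<ge> 1"
    define v where "v = ln (real M)"
    have v: "v \<ge> 0" using M by (simp add: v_def)
    have "exp v = real M" using M by (simp add: v_def)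
    then have f: "m_exp v = mu_sum M" by (simp add: m_exp_def)
    show "\<bar>mu_sum M\<bar> \<le> (4 * C + 27) * (1 + ln (real M)) powr (- 8/7)"
    proof (cases "v \<ge> 2")
      case True
      have "2 powr (8/7) \<le> (2::real) powr 2" by (intro powr_mono) auto
      then have 2: "2 powr (8/7) \<le> (4::real)" by simp
      have "(2 * v) powr (- 8/7) \<le> (1 + v) powr (- 8/7)" using True by (intro powr_mono2') auto
      then have "2 powr (8/7) * (2 * v) powr (- 8/7) \<le> 4 * (1 + v) powr (- 8/7)"
        using 2 by (intro mult_mono) auto
      moreover have "2 powr (8/7) * (2 * v) powr (- 8/7) = v powr (- 8/7)"
        using True by (simp add: powr_mult powr_minus field_simps)
      ultimately have "v powr (- 8/7) \<le> 4 * (1 + v) powr (- 8/7)" by simp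
      then have "C * v powr (- 8/7) \<le> C * (4 * (1 + v) powr (- 8/7))" using C(1) by (intro mult_left_mono) auto
      then have "\<bar>m_exp v\<bar> \<le> 4 * C * (1 + v) powr (- 8/7)" using C(2)[OF True] by simp
      also have "\<dots> \<le> (4 * C + 27) * (1 + v) powr (- 8/7)" by (intro mult_right_mono) auto
      finally have "\<bar>m_exp v\<bar> \<le> (4 * C + 27) * (1 + v) powr (- 8/7)" .
      then show ?thesis unfolding f by (simp only: v_def)
    next
      case False
      have "(3::real) powr (- 2) \<le> 3 powr (- 8/7)" by (intro powr_mono) auto
      also have "\<dots> \<le> (1 + v) powr (- 8/7)" using False v by (intro powr_mono2') auto
      finally have 1: "1 / 9 \<le> (1 + v) powr (- 8/7)" by (simp add: powr_minus_divide)
      have "\<bar>m_exp v\<bar> \<le> 27 * (1 / 9)" using abs_m_exp_le[of v] v False by simp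
      also have "\<dots> \<le> (4 * C + 27) * (1 + v) powr (- 8/7)" using 1 C(1) by (intro mult_mono) auto
      finally have "\<bar>m_exp v\<bar> \<le> (4 * C + 27) * (1 + v) powr (- 8/7)" .
      then show ?thesis unfolding f by (simp only: v_def)
    qed
  qed
qed

theorem theorem2p2:
  shows "(\<lambda>x::real. \<Sum>n | 1 \<le> n \<and> real n \<le> x.
            of_int (moebius_mu n) * real (prime_omega n) ^ 2 * frac (x / real n))
         \<in> O[at_top](\<lambda>x::real. x * ln (ln x) powr (3/2) / ln x)"
proof -
  obtain C where "C \<ge> 0" "\<And>M. M \<ge> 1 \<Longrightarrow> \<bar>mu_sum M\<bar> \<le> C * (1 + ln (real M)) powr (- 8/7)"
    using mu_sum_bound by blast
  then show ?thesis by (rule frac_sum_bigo_from_mu_sum_bound)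
qed

end
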